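(* For every integer $d\ge1$, the pushforward under $h_K$ of Haar probability on $Y_{-d}=\Gamma a_{-d}U$ is $$(h_K)_*\nu_{Y_{-d}}=\mu^{\mathrm{fwd}}_{1,\,2d-1}.$$ Consequently, if $Y$ is a compact right $U$-orbit in $X$ with associated integer $m(Y)$, then for every integer $n\ge0$ with $n>m(Y)$, $$(h_K)_*\lambda^{\mathrm{per}}_{Y,n}=\mu^{\mathrm{fwd}}_{1,\,2(n-m(Y))-1},\qquad\text{where}\quad \lambda^{\mathrm{per}}_{Y,n}(f):=\int_Yf(ya_{-n})\,d\nu_Y(y).$$
   Context: Let $q$ be a prime power, $F=\mathbb F_q((t^{-1}))$, $\mathcal O=\mathbb F_q[[t^{-1}]]$, $\pi=t^{-1}$, $G=\mathrm{SL}_2(F)$, $\Gamma=\mathrm{SL}_2(\mathbb F_q[t])$, $K=\mathrm{SL}_2(\mathcal O)$, $X=\Gamma\backslash G$. Put $u(s)=\begin{pmatrix}1&s\\0&1\end{pmatrix}$, $U=\{u(s):s\in F\}$ acting on $X$ on the right, $a_n=\mathrm{diag}(t^n,t^{-n})$ for $n\in\mathbb Z$; Haar measure $ds$ on $F$ has $ds(\mathcal O)=1$. For a compact orbit $Y=\Gamma gU$, $\nu_Y$ is the normalized $U$-invariant probability measure on $Y$, and $m(Y)$ is the unique integer such that the lattice $\Lambda_U(Y)=\{s\in F:\Gamma gu(s)=\Gamma g\}$ has covolume $q^{-2m(Y)-1}$ in $F$ (it does not depend on $g$). The orbits $\Gamma a_mU$, $m\in\mathbb Z$, are compact. $\mathcal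 T$ is the Bruhat--Tits tree of $\mathrm{PGL}_2(F)$ (vertices: homothety classes of $\mathcal O$-lattices in $F^2$; $[L],[L']$ adjacent if representatives satisfy $\pi L\subsetneq L'\subsetneq L$, $L/L'\simeq\mathbb F_q$). With $v_n=[\mathrm{diag}(t^n,1)]\cdot[\mathcal O^2]$, $n\ge 0$, the quotient of $\mathcal T$ by $\mathrm{PGL}_2(\mathbb F_q[t])$ is the ray $v_0-v_1-\cdots$, and $h(v)$ is the $n\ge0$ for which $v$ lies in the orbit of $v_n$. All neighbors of a height-$0$ vertex have height $1$; a vertex of height $k\ge1$ has exactly one neighbor of height $k+1$ and exactly $q$ of height $k-1$. $h_K:X\to2\mathbb Z_{\ge0}$, $h_K(\Gamma g)=h(gv_0)$. An oriented edge $e=(z_{-1},z_0)$ with $h(z_0)=k\ge1$ and $h(z_{-1})=k-1$ is in the forward state $(\mathrm{fwd},k)$. $\mathrm{Desc}_N(e)$ is the set of terminal vertices $z_N$ of non-backtracking paths $z_{-1}\to z_0\to\cdots\to z_N$ ($q^N$ elements), and $\mu^{\mathrm{fwd}}_{k,N}(j)$ is $q^{-N}$ times the number of vertices of height $j$ in $\mathrm{Desc}_N(e)$ for $e$ in state $(\mathrm{fwd},k)$; this depends only on the state. *)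

theory Defs
  imports "HOL-Probability.Probability" "HOL-Computational_Algebra.Computational_Algebra"
begin

text \<open>
  The finite field with \<open>q\<close> elements is a type \<open>'a\<close> of sort \<open>{finite, field}\<close>, so
  \<open>q = CARD('a)\<close>.  The local field \<open>F\<close> of Laurent series in the uniformizer
  \<open>\<pi> = 1/t\<close> is \<open>'a fls\<close>, whose variable \<^term>\<open>fls_X\<close> is \<open>\<pi>\<close>; the metric of the
  library on this type is the \<open>\<pi>\<close>-adic one.
\<close>

section \<open>The field, its rings of integers and its Haar measure\<close>

definition tt :: "'a :: {finite, field} fls" where
  "tt = inverse fls_X"

definition O_F :: "'a :: {finite, field} fls set" where
  "O_F = range fps_to_fls"

definition poly_ring :: "'a :: {finite, field} fls set" where
  "poly_ring = range (\<lambda>p :: 'a poly. poly (map_poly fls_const p) tt)"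

definition haar :: "'a :: {finite, field} fls measure" where
  "haar = (THE \<mu>. sets \<mu> = sets borel \<and> (\<forall>s. distr \<mu> borel (\<lambda>x. s + x) = \<mu>) \<and> emeasure \<mu> O_F = 1)"

definition fundamental_domain ::
    "'a :: {finite, field} fls set \<Rightarrow> 'a fls set \<Rightarrow> bool" where
  "fundamental_domain \<Lambda> D \<longleftrightarrow> D \<in> sets borel \<and> (\<forall>x. \<exists>!l. l \<in> \<Lambda> \<and> x - l \<in> D)"

definition covolume :: "'a :: {finite, field} fls set \<Rightarrow> ennreal" where
  "covolume \<Lambda> = (THE c. \<exists>D. fundamental_domain \<Lambda> D \<and> emeasure haar D = c)"

section \<open>The homogeneous space and the unipotent orbits\<close>

definition mat22 :: "'b :: zero \<Rightarrow> 'b \<Rightarrow> 'b \<Rightarrow> 'b \<Rightarrow> 'b ^ 2 ^ 2" where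
  "mat22 a b c d = vector [vector [a, b], vector [c, d]]"

definition SL2 :: "'b :: comm_ring_1 set \<Rightarrow> ('b ^ 2 ^ 2) set" where
  "SL2 R = {g. (\<forall>i j. g $ i $ j \<in> R) \<and> det g = 1}"

definition GG :: "('a :: {finite, field} fls ^ 2 ^ 2) set" where
  "GG = SL2 UNIV"

definition Gam :: "('a :: {finite, field} fls ^ 2 ^ 2) set" where
  "Gam = SL2 poly_ring"

definition Gcoset :: "'a :: {finite, field} fls ^ 2 ^ 2 \<Rightarrow> ('a fls ^ 2 ^ 2) set" where
  "Gcoset g = (\<lambda>\<gamma>. \<gamma> ** g) ` Gam"

definition XX :: "('a :: {finite, field} fls ^ 2 ^ 2) set set" where
  "XX = Gcoset ` GG"

definition ract :: "('a :: {finite, field} fls ^ 2 ^ 2) set \<Rightarrow> 'a fls ^ 2 ^ 2 \<Rightarrow> ('a fls ^ 2 ^ 2) set"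
    (infixl \<open>\<star>\<close> 70) where
  "x \<star> b = (\<lambda>g. g ** b) ` x"

definition GG_top :: "('a :: {finite, field} fls ^ 2 ^ 2) topology" where
  "GG_top = top_of_set GG"

definition XX_top :: "('a :: {finite, field} fls ^ 2 ^ 2) set topology" where
  "XX_top = topology (\<lambda>A. A \<subseteq> XX \<and> openin GG_top {g \<in> GG. Gcoset g \<in> A})"

lemma openin_XX_top:
  fixes A :: "('a :: {finite, field} fls ^ 2 ^ 2) set set"
  shows "openin XX_top A \<longleftrightarrow> A \<subseteq> XX \<and> openin GG_top {g \<in> GG. Gcoset g \<in> A}"
proof -
  have "istopology (\<lambda>A :: ('a fls ^ 2 ^ 2) set set. A \<subseteq> XX \<and> openin GG_top {g \<in> GG. Gcoset g \<in> A})"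
    unfolding istopology_def
  proof (rule conjI; intro allI impI)
    fix S T :: "('a fls ^ 2 ^ 2) set set"
    assume S: "S \<subseteq> XX \<and> openin GG_top {g \<in> GG. Gcoset g \<in> S}"
      and T: "T \<subseteq> XX \<and> openin GG_top {g \<in> GG. Gcoset g \<in> T}"
    have "openin GG_top ({g \<in> GG. Gcoset g \<in> S} \<inter> {g \<in> GG. Gcoset g \<in> T})"
      using S T by (intro openin_Int) simp_all
    moreover have "{g \<in> GG. Gcoset g \<in> S} \<inter> {g \<in> GG. Gcoset g \<in> T} = {g \<in> GG. Gcoset g \<in> S \<inter> T}"
      by auto
    ultimately show "S \<inter> T \<subseteq> XX \<and> openin GG_top {g \<in> GG. Gcoset g \<in> S \<inter> T}"
      using S by auto
  next
    fix K :: "('a fls ^ 2 ^ 2) set set set"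
    assume K: "\<forall>S\<in>K. S \<subseteq> XX \<and> openin GG_top {g \<in> GG. Gcoset g \<in> S}"
    have "openin GG_top (\<Union>S\<in>K. {g \<in> GG. Gcoset g \<in> S})"
      using K by blast
    moreover have "(\<Union>S\<in>K. {g \<in> GG. Gcoset g \<in> S}) = {g \<in> GG. Gcoset g \<in> \<Union>K}"
      by auto
    ultimately show "\<Union>K \<subseteq> XX \<and> openin GG_top {g \<in> GG. Gcoset g \<in> \<Union>K}"
      using K by auto
  qed
  then show ?thesis
    by (simp add: XX_top_def topology_inverse')
qed

lemma topspace_XX_top: "topspace XX_top = (XX :: ('a :: {finite, field} fls ^ 2 ^ 2) set set)"
proof -
  have "{g \<in> GG. Gcoset g \<in> XX} = topspace (GG_top :: ('a fls ^ 2 ^ 2) topology)"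
    by (auto simp: XX_def GG_top_def)
  then have "openin XX_top (XX :: ('a fls ^ 2 ^ 2) set set)"
    by (simp add: openin_XX_top)
  then have "XX \<subseteq> topspace (XX_top :: ('a fls ^ 2 ^ 2) set topology)"
    by (rule openin_subset)
  moreover have "topspace (XX_top :: ('a fls ^ 2 ^ 2) set topology) \<subseteq> XX"
    using openin_XX_top[THEN iffD1, OF openin_topspace] by (rule conjunct1)
  ultimately show ?thesis
    by (rule subset_antisym[rotated])
qed

lemma quotient_map_Gcoset:
  "quotient_map GG_top XX_top (Gcoset :: 'a :: {finite, field} fls ^ 2 ^ 2 \<Rightarrow> _)"
proof -
  have "topspace (GG_top :: ('a fls ^ 2 ^ 2) topology) = GG"
    by (simp add: GG_top_def)
  then show ?thesis
    unfolding quotient_map_def topspace_XX_top openin_XX_top by (simp add: XX_def)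
qed

definition borel_of_top :: "'b topology \<Rightarrow> 'b measure" where
  "borel_of_top T = sigma (topspace T) {A. openin T A}"

definition uu :: "'a :: {finite, field} fls \<Rightarrow> 'a fls ^ 2 ^ 2" where
  "uu s = mat22 1 s 0 1"

definition aa :: "int \<Rightarrow> 'a :: {finite, field} fls ^ 2 ^ 2" where
  "aa n = mat22 (tt powi n) 0 0 (tt powi (- n))"

definition orbit_U :: "'a :: {finite, field} fls ^ 2 ^ 2 \<Rightarrow> ('a fls ^ 2 ^ 2) set set" where
  "orbit_U g = range (\<lambda>s. Gcoset g \<star> uu s)"

definition compact_orbit :: "('a :: {finite, field} fls ^ 2 ^ 2) set set \<Rightarrow> bool" where
  "compact_orbit Y \<longleftrightarrow> (\<exists>g\<in>GG. Y = orbit_U g) \<and> compactin XX_top Y"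

definition nu :: "('a :: {finite, field} fls ^ 2 ^ 2) set set \<Rightarrow> ('a fls ^ 2 ^ 2) set measure" where
  "nu Y = (THE \<nu>. sets \<nu> = sets (borel_of_top (subtopology XX_top Y)) \<and> prob_space \<nu> \<and>
             (\<forall>s. distr \<nu> \<nu> (\<lambda>y. y \<star> uu s) = \<nu>))"

definition Lambda_U :: "'a :: {finite, field} fls ^ 2 ^ 2 \<Rightarrow> 'a fls set" where
  "Lambda_U g = {s. Gcoset g \<star> uu s = Gcoset g}"

definition m_int :: "('a :: {finite, field} fls ^ 2 ^ 2) set set \<Rightarrow> int" where
  "m_int Y = (THE m. \<forall>g\<in>GG. Y = orbit_U g \<longrightarrow>
                covolume (Lambda_U g) = ennreal (real CARD('a) powi (- 2 * m - 1)))"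

text \<open>
  The functional \<open>f \<mapsto> \<integral> f (y a\<^sub>-\<^sub>n) d\<nu>\<^sub>Y(y)\<close> is integration against the image of \<open>\<nu>\<^sub>Y\<close>
  under \<open>y \<mapsto> y a\<^sub>-\<^sub>n\<close>.
\<close>

definition lambda_per ::
    "('a :: {finite, field} fls ^ 2 ^ 2) set set \<Rightarrow> int \<Rightarrow> ('a fls ^ 2 ^ 2) set measure" where
  "lambda_per Y n = distr (nu Y) (borel_of_top XX_top) (\<lambda>y. y \<star> aa (- n))"

section \<open>The tree and the height function\<close>

definition std_lattice :: "('a :: {finite, field} fls ^ 2) set" where
  "std_lattice = {x. \<forall>i. x $ i \<in> O_F}"

definition is_lattice :: "('a :: {finite, field} fls ^ 2) set \<Rightarrow> bool" where
  "is_lattice L \<longleftrightarrow> (\<exists>g. invertible g \<and> L = (\<lambda>x. g *v x) ` std_lattice)"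

definition homothety_class ::
    "('a :: {finite, field} fls ^ 2) set \<Rightarrow> ('a fls ^ 2) set set" where
  "homothety_class L = {(\<lambda>x. c *s x) ` L | c. c \<noteq> 0}"

definition vertices :: "('a :: {finite, field} fls ^ 2) set set set" where
  "vertices = homothety_class ` {L. is_lattice L}"

text \<open>
  The quotient \<open>L/L'\<close> is isomorphic as an \<open>\<O>\<close>-module to the residue field, on which
  \<open>\<O>\<close> acts through the constant coefficient: there is a surjective \<open>\<O>\<close>-linear map
  from \<open>L\<close> onto the residue field with kernel \<open>L'\<close>.
\<close>

definition quotient_is_residue_field ::
    "('a :: {finite, field} fls ^ 2) set \<Rightarrow> ('a fls ^ 2) set \<Rightarrow> bool" where
  "quotient_is_residue_field L L' \<longleftrightarrow>
     (\<exists>\<phi> :: 'a fls ^ 2 \<Rightarrow> 'a.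
        (\<forall>x\<in>L. \<forall>y\<in>L. \<phi> (x + y) = \<phi> x + \<phi> y) \<and>
        (\<forall>c\<in>O_F. \<forall>x\<in>L. \<phi> (c *s x) = fls_nth c 0 * \<phi> x) \<and>
        \<phi> ` L = UNIV \<and> {x \<in> L. \<phi> x = 0} = L')"

definition adj ::
    "('a :: {finite, field} fls ^ 2) set set \<Rightarrow> ('a fls ^ 2) set set \<Rightarrow> bool" where
  "adj z z' \<longleftrightarrow> z \<in> vertices \<and> z' \<in> vertices \<and>
     (\<exists>L\<in>z. \<exists>L'\<in>z'. (\<lambda>x. fls_X *s x) ` L \<subset> L' \<and> L' \<subset> L \<and> quotient_is_residue_field L L')"

definition vact ::
    "'a :: {finite, field} fls ^ 2 ^ 2 \<Rightarrow> ('a fls ^ 2) set set \<Rightarrow> ('a fls ^ 2) set set" where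
  "vact g z = (\<lambda>L. (\<lambda>x. g *v x) ` L) ` z"

definition vv :: "nat \<Rightarrow> ('a :: {finite, field} fls ^ 2) set set" where
  "vv n = vact (mat22 (tt ^ n) 0 0 1) (homothety_class std_lattice)"

text \<open>
  Scalar matrices fix every homothety class, so the orbits of \<open>PGL\<^sub>2\<close> of the polynomial
  ring on vertices are those of its \<open>GL\<^sub>2\<close>.
\<close>

definition GL2_poly :: "('a :: {finite, field} fls ^ 2 ^ 2) set" where
  "GL2_poly = {g. (\<forall>i j. g $ i $ j \<in> poly_ring) \<and>
     (\<exists>g'. (\<forall>i j. g' $ i $ j \<in> poly_ring) \<and> g ** g' = mat 1 \<and> g' ** g = mat 1)}"

definition height :: "('a :: {finite, field} fls ^ 2) set set \<Rightarrow> nat" where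
  "height v = (THE n. \<exists>\<gamma>\<in>GL2_poly. v = vact \<gamma> (vv n))"

definition h_K :: "('a :: {finite, field} fls ^ 2 ^ 2) set \<Rightarrow> nat" where
  "h_K x = (THE k. \<forall>g\<in>x. height (vact g (vv 0)) = k)"

section \<open>Forward states and descendants\<close>

definition fwd_state ::
    "nat \<Rightarrow> ('a :: {finite, field} fls ^ 2) set set \<Rightarrow> ('a fls ^ 2) set set \<Rightarrow> bool" where
  "fwd_state k z z' \<longleftrightarrow> adj z z' \<and> 1 \<le> k \<and> height z' = k \<and> height z = k - 1"

text \<open>Paths are indexed from \<open>0\<close>: \<open>p i\<close> is the vertex \<open>z\<^sub>i\<^sub>-\<^sub>1\<close>.\<close>

definition Desc ::
    "nat \<Rightarrow> ('a :: {finite, field} fls ^ 2) set set \<Rightarrow> ('a fls ^ 2) set set \<Rightarrow>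
       ('a fls ^ 2) set set set" where
  "Desc N z z' = {p (N + 1) | p :: nat \<Rightarrow> ('a fls ^ 2) set set.
     p 0 = z \<and> p 1 = z' \<and> (\<forall>i\<le>N. adj (p i) (p (i + 1))) \<and> (\<forall>i<N. p (i + 2) \<noteq> p i)}"

text \<open>
  Neither the arguments nor the value of \<open>\<mu>\<^sup>f\<^sup>w\<^sup>d\<close> mention the field in their types,
  so the field is passed as a type token.
\<close>

definition mu_fwd_mass :: "'a :: {finite, field} itself \<Rightarrow> nat \<Rightarrow> nat \<Rightarrow> nat \<Rightarrow> real" where
  "mu_fwd_mass _ k N j =
     (THE r. \<forall>z z' :: ('a fls ^ 2) set set. fwd_state k z z' \<longrightarrow>
        r = real (card {v \<in> Desc N z z'. height v = j}) / real CARD('a) ^ N)"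

definition mu_fwd :: "'a :: {finite, field} itself \<Rightarrow> nat \<Rightarrow> nat \<Rightarrow> nat measure" where
  "mu_fwd F k N = density (count_space UNIV) (\<lambda>j. ennreal (mu_fwd_mass F k N j))"

end

theory Submission
  imports Defs
begin

text \<open>
  Write \<open>\<delta>\<^sub>x\<close> for the diagonal matrix with entries \<open>x\<close> and \<open>x\<^sup>-\<^sup>1\<close>. The orbit \<open>\<Gamma>\<delta>\<^sub>xU\<close> consists of the points
  \<open>\<Gamma>u(s)\<delta>\<^sub>x\<close>, and two parameters \<open>s\<close> give the same point exactly when they differ by a polynomial. Since
  \<open>F = \<F>\<^sub>q[t] \<oplus> \<pi>\<O>\<close>, the orbit is a copy of \<open>\<pi>\<O>\<close>, and its invariant probability gives the image of every ball
  \<open>s + \<pi>\<^sup>k\<O>\<close> with \<open>k \<ge> 1\<close> the mass \<open>q\<^sup>1\<^sup>-\<^sup>k\<close> (\<open>invariant_prob_pball\<close>).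

  Right translation by \<open>a\<^sub>-\<^sub>n\<close> keeps \<open>s\<close> and replaces \<open>x\<close> by \<open>xt\<^sup>-\<^sup>n\<close>. If this new element has valuation \<open>d \<ge> 1\<close>, then
  the vertex attached to the translated point is the class of the matrix with rows \<open>(\<pi>\<^sup>2\<^sup>d, s)\<close> and \<open>(0, 1)\<close>
  (\<open>h_K_orbit_pt\<close>). It depends only on the ball \<open>s + \<pi>\<^sup>2\<^sup>d\<O>\<close>, so the heights along the orbit are those of the vertices
  attached to the balls of index \<open>2d\<close> inside \<open>\<pi>\<O>\<close>, which are \<open>q\<^sup>2\<^sup>d\<^sup>-\<^sup>1\<close> in number and equally likely.

  The same vertices occur in the tree. When vertices are viewed as balls of \<open>F\<close>, the neighbours of a ball are the next
  larger ball and the \<open>q\<close> next smaller ones inside it. A non-backtracking path that starts from \<open>\<O>\<close> to \<open>\<pi>\<O>\<close> therefore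
  keeps shrinking, and its endpoints after \<open>N\<close> further steps are precisely the balls of index \<open>N + 1\<close> inside \<open>\<pi>\<O>\<close>
  (\<open>Desc_eq\<close>). Every edge in the forward state of height \<open>1\<close> is a translate of this one by the arithmetic group
  (\<open>fwd_state_1_cases\<close>), which preserves heights. With \<open>N = 2d - 1\<close> both distributions count the same vertices
  (\<open>distr_height\<close>).

  It remains to see that the objects defined by descriptions exist and are unique. For the height this is reduction
  theory, that is, Euclid's algorithm on matrices. Haar measure and the measures on orbits are determined by the masses
  of balls, which invariance dictates; Haar measure is constructed from independent random digits.
  Covolumes are well defined because two fundamental domains of one lattice differ by translations of countably many pieces. Finally, every
  compact orbit has the form \<open>\<Gamma>\<delta>\<^sub>xU\<close> (\<open>compact_orbit_cases\<close>): otherwise Euclid's algorithm on the first column never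
  stops and produces points of the orbit tending to the coset of \<open>1\<close>, which does not lie on the orbit. For an orbit of
  this form the period lattice is \<open>x\<^sup>-\<^sup>2\<F>\<^sub>q[t]\<close>, so that \<open>m(Y)\<close> is minus the valuation of \<open>x\<close>, and translation by
  \<open>a\<^sub>-\<^sub>n\<close> leads to \<open>d = n - m(Y)\<close>.
\<close>

section \<open>Powers of the maximal ideal and the polynomial ring\<close>

text \<open>
  The fractional ideal \<open>\<pi>\<^sup>k\<O>\<close>, for \<open>k\<close> of any sign, phrased through coefficients because most
  membership proofs compare coefficients.
\<close>

definition pideal :: "int \<Rightarrow> 'a :: {finite, field} fls set" where
  "pideal k = {f. \<forall>n<k. fls_nth f n = 0}"

lemma pidealD: "f \<in> pideal k \<Longrightarrow> n < k \<Longrightarrow> fls_nth f n = 0"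
  by (simp add: pideal_def)

lemma pideal_iff_subdegree: "f \<in> pideal k \<longleftrightarrow> f = 0 \<or> k \<le> fls_subdegree f"
proof
  assume "f \<in> pideal k"
  then show "f = 0 \<or> k \<le> fls_subdegree f"
    by (metis nth_fls_subdegree_nonzero not_le pidealD)
qed (auto simp: pideal_def)

lemma pideal_0 [simp]: "0 \<in> pideal k"
  by (simp add: pideal_def)

lemma pideal_add: "f \<in> pideal k \<Longrightarrow> g \<in> pideal k \<Longrightarrow> f + g \<in> pideal k"
  by (simp add: pideal_def)

lemma pideal_uminus: "f \<in> pideal k \<Longrightarrow> - f \<in> pideal k"
  by (simp add: pideal_def)

lemma pideal_diff: "f \<in> pideal k \<Longrightarrow> g \<in> pideal k \<Longrightarrow> f - g \<in> pideal k"
  by (simp add: pideal_def)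

lemma pideal_minus_iff: "f - g \<in> pideal k \<longleftrightarrow> g - f \<in> pideal k"
  using pideal_uminus[of "f - g" k] pideal_uminus[of "g - f" k] by auto

lemma pideal_mono: "f \<in> pideal k \<Longrightarrow> l \<le> k \<Longrightarrow> f \<in> pideal l"
  by (simp add: pideal_def)

lemma pideal_mult:
  assumes "f \<in> pideal k" "g \<in> pideal l" "m \<le> k + l"
  shows "f * g \<in> pideal m"
proof (cases "f = 0 \<or> g = 0")
  case False
  with assms show ?thesis by (auto simp: pideal_iff_subdegree)
qed auto

lemma pideal_divide:
  assumes "f \<in> pideal k" "c \<noteq> 0" "l \<le> k - fls_subdegree c"
  shows "f / c \<in> pideal l"
proof (cases "f = 0")
  case False
  then have "fls_subdegree f = fls_subdegree (f / c) + fls_subdegree c"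
    using fls_subdegree_mult[of "f / c" c] assms(2) by simp
  then show ?thesis using assms False by (auto simp: pideal_iff_subdegree)
qed simp

text \<open>
  Multiplication by \<open>c\<close> rescales the filtration exactly, so it may be undone.
\<close>

lemma pideal_mult_iff:
  assumes "c \<noteq> 0"
  shows "c * f \<in> pideal (k + fls_subdegree c) \<longleftrightarrow> f \<in> pideal k"
  using assms by (cases "f = 0") (auto simp: pideal_iff_subdegree)

lemma O_F_eq_pideal: "O_F = (pideal 0 :: 'a::{finite,field} fls set)"
proof
  show "O_F \<subseteq> (pideal 0 :: 'a fls set)" by (auto simp: O_F_def pideal_def)
  show "pideal 0 \<subseteq> (O_F :: 'a fls set)"
  proof
    fix f :: "'a fls" assume "f \<in> pideal 0"
    then have "f = fps_to_fls (fls_regpart f)"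
      by (intro fls_eqI) (auto simp: pideal_def)
    then show "f \<in> O_F" unfolding O_F_def by (metis rangeI)
  qed
qed

lemma one_in_pideal: "1 \<in> pideal 0"
  by (simp add: pideal_def)

lemma const_in_pideal: "fls_const c \<in> pideal 0"
  by (simp add: pideal_def)

lemma tt_powi: "(tt :: 'a::{finite,field} fls) powi n = fls_X powi (- n)"
  by (simp only: tt_def power_int_inverse power_int_minus)

text \<open>
  A Laurent series in \<open>\<pi> = 1/t\<close> without positive powers of \<open>\<pi>\<close> has finitely many terms, hence is a
  polynomial in \<open>t\<close>. This description makes the splitting \<open>F = \<F>\<^sub>q[t] \<oplus> \<pi>\<O>\<close> visible.
\<close>

lemma poly_ring_eq: "poly_ring = {f :: 'a::{finite,field} fls. \<forall>n>0. fls_nth f n = 0}"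
proof -
  have ev: "poly (map_poly fls_const p) tt = (\<Sum>i\<le>degree p. fls_const (coeff p i) * (fls_X_inv :: 'a fls) ^ i)" for p
    by (simp add: poly_altdef degree_map_poly coeff_map_poly tt_def fls_inverse_X)
  have nth: "fls_nth (poly (map_poly fls_const p) (tt :: 'a fls)) n = (if n \<le> 0 then coeff p (nat (- n)) else 0)" for p n
  proof -
    have "fls_nth (poly (map_poly fls_const p) (tt :: 'a fls)) n
        = (\<Sum>i\<le>degree p. if n = - int i then coeff p i else 0)"
      unfolding ev fls_nth_sum by (intro sum.cong) auto
    also have "\<dots> = (\<Sum>i\<le>degree p. if nat (- n) = i \<and> n \<le> 0 then coeff p i else 0)"
      by (intro sum.cong) auto
    also have "\<dots> = (if n \<le> 0 then coeff p (nat (- n)) else 0)"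
      by (auto simp: coeff_eq_0)
    finally show ?thesis .
  qed
  show ?thesis
  proof
    show "poly_ring \<subseteq> {f :: 'a fls. \<forall>n>0. fls_nth f n = 0}"
      unfolding poly_ring_def by (auto simp: nth)
    show "{f :: 'a fls. \<forall>n>0. fls_nth f n = 0} \<subseteq> poly_ring"
    proof
      fix f :: "'a fls" assume f: "f \<in> {f. \<forall>n>0. fls_nth f n = 0}"
      define p where "p = Abs_poly (\<lambda>i. fls_nth f (- int i))"
      have "coeff p = (\<lambda>i. fls_nth f (- int i))"
        unfolding p_def by (rule Abs_poly_inverse) auto
      then have "f = poly (map_poly fls_const p) tt"
        using f by (intro fls_eqI) (auto simp: nth)
      then show "f \<in> poly_ring" unfolding poly_ring_def by auto
    qed
  qed
qed

lemma poly_ring_uminus: "f \<in> poly_ring \<Longrightarrow> - f \<in> poly_ring"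
  and poly_ring_diff: "f \<in> poly_ring \<Longrightarrow> g \<in> poly_ring \<Longrightarrow> f - g \<in> poly_ring"
  and poly_ring_0: "0 \<in> poly_ring"
  and poly_ring_1: "1 \<in> poly_ring"
  and poly_ring_const: "fls_const c \<in> poly_ring"
  by (auto simp: poly_ring_eq)

lemma poly_ring_mult:
  assumes "f \<in> poly_ring" "g \<in> poly_ring"
  shows "f * g \<in> poly_ring"
proof -
  have "fls_nth (f * g) n = 0" if "n > 0" for n
  proof -
    have "fls_nth f i * fls_nth g (n - i) = 0" for i
      using assms that by (cases "i > 0") (auto simp: poly_ring_eq)
    then show ?thesis unfolding fls_times_nth(2) by (intro sum.neutral) blast
  qed
  then show ?thesis by (simp add: poly_ring_eq)
qed

lemma poly_ring_Int_pideal: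
  assumes "f \<in> poly_ring" "f \<in> pideal 1"
  shows "f = 0"
proof (rule fls_eqI)
  fix n show "fls_nth f n = fls_nth 0 n"
    using assms by (cases "n > 0") (auto simp: poly_ring_eq pideal_def)
qed

lemma poly_ring_integral_const:
  assumes "f \<in> poly_ring" "f \<in> pideal 0"
  shows "f = fls_const (fls_nth f 0)"
proof (rule fls_eqI)
  fix n show "fls_nth f n = fls_nth (fls_const (fls_nth f 0)) n"
    using assms by (cases n "0 :: int" rule: linorder_cases) (auto simp: poly_ring_eq pideal_def)
qed

text \<open>
  Together with the trivial intersection above, this is the decomposition \<open>F = \<F>\<^sub>q[t] \<oplus> \<pi>\<O>\<close> on
  which all fundamental domains below rest.
\<close>

lemma ex_poly_part:
  obtains p where "p \<in> poly_ring" "f - p \<in> pideal 1"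
proof -
  define p where "p = Abs_fls (\<lambda>n. if n \<le> 0 then fls_nth f n else 0)"
  have p: "fls_nth p n = (if n \<le> 0 then fls_nth f n else 0)" for n
    unfolding p_def
    by (rule nth_Abs_fls_lower_bound[of "fls_subdegree f"]) simp
  show ?thesis by (rule that[of p]) (auto simp: poly_ring_eq pideal_def p)
qed

lemma countable_poly_ring: "countable (poly_ring :: 'a::{finite,field} fls set)"
proof -
  have "poly_ring \<subseteq> range (\<lambda>xs :: 'a list. poly (map_poly fls_const (Poly xs)) (tt :: 'a fls))"
    unfolding poly_ring_def by (auto intro: image_eqI[where x = "coeffs p" for p])
  moreover have "countable (UNIV :: 'a list set)" by simp
  ultimately show ?thesis by (meson countable_image countable_subset)
qed

section \<open>The topology\<close>

text \<open>
  The coset \<open>a + \<pi>\<^sup>k\<O>\<close>; a larger index is a smaller ball.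
\<close>

definition pball :: "'a :: {finite, field} fls \<Rightarrow> int \<Rightarrow> 'a fls set" where
  "pball a k = {x. x - a \<in> pideal k}"

lemma pball_self [simp]: "a \<in> pball a k"
  by (simp add: pball_def)

lemma pball_mono: "l \<le> k \<Longrightarrow> pball a k \<subseteq> pball a l"
  by (auto simp: pball_def intro: pideal_mono)

lemma pball_trans: "x \<in> pball y k \<Longrightarrow> y \<in> pball z k \<Longrightarrow> x \<in> pball z k"
  unfolding pball_def using pideal_add[of "x - y" k "y - z"] by simp

lemma pball_sym: "x \<in> pball y k \<longleftrightarrow> y \<in> pball x k"
  unfolding pball_def using pideal_minus_iff by blast

lemma pball_eq: "x \<in> pball a k \<Longrightarrow> pball x k = pball a k"
  by (meson pball_sym pball_trans subsetI subset_antisym)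

lemma pball_0: "pball 0 k = pideal k"
  by (simp add: pball_def)

text \<open>
  The metric is \<open>2\<^sup>-\<^sup>v\<close> for the valuation \<open>v\<close>, so its small closed balls are the balls of nonnegative index.
\<close>

lemma pball_iff_dist:
  "x \<in> pball a (int k) \<longleftrightarrow> dist x a \<le> inverse (2 ^ k)"
proof -
  consider "x = a" | "x \<noteq> a" "fls_subdegree (x - a) \<ge> 0" | "x \<noteq> a" "fls_subdegree (x - a) < 0" by linarith
  then show ?thesis
  proof cases
    case 2
    then show ?thesis by (auto simp: pball_def pideal_iff_subdegree dist_fls_def le_nat_iff)
  next
    case 3
    have "(1::real) < 2 ^ nat (- fls_subdegree (x - a))" using 3 by (intro one_less_power) auto
    moreover have "inverse (2 ^ k) \<le> (1::real)" by (simp add: field_simps)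
    ultimately have "\<not> (2::real) ^ nat (- fls_subdegree (x - a)) \<le> inverse (2 ^ k)" by linarith
    then have "\<not> dist x a \<le> inverse (2 ^ k)" using 3 by (simp add: dist_fls_def)
    then show ?thesis using 3 by (auto simp: pball_def pideal_iff_subdegree)
  qed (simp add: dist_fls_def)
qed

lemma open_iff_pball: "open S \<longleftrightarrow> (\<forall>a\<in>S. \<exists>k. pball a k \<subseteq> S)"
proof
  assume S: "open S"
  show "\<forall>a\<in>S. \<exists>k. pball a k \<subseteq> S"
  proof
    fix a assume "a \<in> S"
    then obtain r where r: "r > 0" "{y. dist y a < r} \<subseteq> S" using S unfolding open_fls_def by blast
    obtain k where k: "inverse (2 ^ k) < r"
      using real_arch_pow_inv[of r "1/2"] r(1) by (auto simp: power_one_over inverse_eq_divide)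
    have "dist x a < r" if "x \<in> pball a (int k)" for x
      using that k unfolding pball_iff_dist by linarith
    then have "pball a (int k) \<subseteq> S" using r(2) by blast
    then show "\<exists>k. pball a k \<subseteq> S" ..
  qed
next
  assume *: "\<forall>a\<in>S. \<exists>k. pball a k \<subseteq> S"
  show "open S" unfolding open_fls_def
  proof
    fix a assume "a \<in> S"
    then obtain k where "pball a k \<subseteq> S" using * by blast
    moreover have "pball a (int (nat k)) \<subseteq> pball a k" by (rule pball_mono) simp
    ultimately have "pball a (int (nat k)) \<subseteq> S" by blast
    then have "{y. dist y a < inverse (2 ^ nat k)} \<subseteq> S"
      by (auto dest!: less_imp_le simp flip: pball_iff_dist)
    then show "\<exists>r>0. {y. dist y a < r} \<subseteq> S" by (intro exI[of _ "inverse (2 ^ nat k)"]) auto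
  qed
qed

lemma open_pball: "open (pball a k)"
  unfolding open_iff_pball using pball_eq by blast

lemma continuous_on_mult_right:
  fixes c :: "'a::{finite,field} fls" shows "continuous_on UNIV (\<lambda>x. x * c)"
proof (cases "c = 0")
  case False
  show ?thesis
    unfolding continuous_on_open_vimage[OF open_UNIV]
  proof (intro allI impI)
    fix B :: "'a fls set" assume "open B"
    show "open ((\<lambda>x. x * c) -` B \<inter> UNIV)"
      unfolding open_iff_pball
    proof
      fix a assume "a \<in> (\<lambda>x. x * c) -` B \<inter> UNIV"
      then obtain k where k: "pball (a * c) k \<subseteq> B" using \<open>open B\<close> by (auto simp: open_iff_pball)
      have "x * c \<in> pball (a * c) k" if "x \<in> pball a (k - fls_subdegree c)" for x
        using that pideal_mult_iff[OF False, of "x - a" "k - fls_subdegree c"]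
        by (simp add: pball_def algebra_simps)
      then show "\<exists>k. pball a k \<subseteq> (\<lambda>x. x * c) -` B \<inter> UNIV" using k by blast
    qed
  qed
qed simp

text \<open>
  A ball of radius index \<open>k\<close> has a centre in \<open>\<pi>\<^sup>k\<^sup>-\<^sup>1\<close> times the polynomial ring, so there are
  only countably many balls.
\<close>

text \<open>
  Scaling the decomposition \<open>F = \<F>\<^sub>q[t] \<oplus> \<pi>\<O>\<close> by \<open>\<pi>\<^sup>k\<^sup>-\<^sup>1\<close> moves every centre into a countable set. This is
  where the second countability of \<open>F\<close> comes from.
\<close>

lemma pball_centre:
  fixes a :: "'a :: {finite, field} fls"
  obtains p where "p \<in> poly_ring" "pball a k = pball (fls_X powi (k - 1) * p) k"
proof -
  obtain p where p: "p \<in> poly_ring" "fls_X powi (1 - k) * a - p \<in> pideal 1"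
    using ex_poly_part by blast
  have "fls_X powi (k - 1) * (fls_X powi (1 - k) * a - p) \<in> pideal k"
    using pideal_mult_iff[of "fls_X powi (k - 1)" "fls_X powi (1 - k) * a - p" 1] p(2)
    by (simp del: fls_X_power_int)
  moreover have "fls_X powi (k - 1) * (fls_X powi (1 - k) * a - p) = a - fls_X powi (k - 1) * p"
    using power_int_add[of "fls_X :: 'a fls" "k - 1" "1 - k"] by (simp add: right_diff_distrib flip: mult.assoc del: fls_X_power_int)
  ultimately have "a \<in> pball (fls_X powi (k - 1) * p) k" by (simp add: pball_def)
  then show ?thesis using pball_eq that p(1) by blast
qed

lemma countable_pballs: "countable {pball a k | (a :: 'a :: {finite, field} fls) k. True}"
proof -
  have "{pball a k | (a :: 'a fls) k. True} \<subseteq> (\<Union>k. (\<lambda>p. pball (fls_X powi (k - 1) * p) k) ` poly_ring)"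
  proof
    fix B assume "B \<in> {pball a k | (a :: 'a fls) k. True}"
    then obtain a :: "'a fls" and k where B: "B = pball a k" by blast
    obtain p :: "'a fls" where "p \<in> poly_ring" "pball a k = pball (fls_X powi (k - 1) * p) k"
      by (rule pball_centre)
    then show "B \<in> (\<Union>k. (\<lambda>p. pball (fls_X powi (k - 1) * p) k) ` poly_ring)"
      unfolding B by blast
  qed
  then show ?thesis
    by (rule countable_subset) (simp add: countable_poly_ring)
qed

text \<open>
  The bound \<open>l\<close> lets the radii be small: on a compact orbit only balls of index at least \<open>1\<close> are embedded.
\<close>

lemma open_eq_Union_pballs:
  fixes S :: "'a :: {finite, field} fls set"
  assumes "open S"
  shows "\<exists>C. countable C \<and> C \<subseteq> {pball a k | a k. l \<le> k} \<and> S = \<Union>C"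
proof (intro exI conjI)
  let ?C = "{B \<in> {pball a k | a k. l \<le> k}. B \<subseteq> S}"
  show "countable ?C" by (rule countable_subset[OF _ countable_pballs]) auto
  show "S = \<Union>?C"
  proof
    show "S \<subseteq> \<Union>?C"
    proof
      fix a assume "a \<in> S"
      then obtain k where "pball a k \<subseteq> S" using assms by (auto simp: open_iff_pball)
      moreover have "pball a (max k l) \<subseteq> pball a k" by (rule pball_mono) simp
      ultimately have "pball a (max k l) \<subseteq> S" by blast
      then show "a \<in> \<Union>?C" by (intro UnionI[of "pball a (max k l)"]) (auto intro!: exI[of _ "max k l"])
    qed
  qed blast
qed blast

unbundle no Formal_Power_Series.fps_syntax

section \<open>Two by two matrices\<close>

lemma mat22_nth [simp]:
  "mat22 a b c d $ 1 $ 1 = a" "mat22 a b c d $ 1 $ 2 = b"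
  "mat22 a b c d $ 2 $ 1 = c" "mat22 a b c d $ 2 $ 2 = d"
  by (simp_all add: mat22_def)

lemma mat22_eq_iff [simp]:
  "mat22 a b c d = mat22 a' b' c' d' \<longleftrightarrow> a = a' \<and> b = b' \<and> c = c' \<and> d = d'"
  by (metis mat22_nth)

lemma mat22_exhaust: obtains a b c d where "g = mat22 a b c d"
proof
  show "g = mat22 (g $ 1 $ 1) (g $ 1 $ 2) (g $ 2 $ 1) (g $ 2 $ 2)"
    by (simp add: vec_eq_iff forall_2)
qed

lemma mat22_mult [simp]:
  "mat22 a b c d ** mat22 a' b' c' d' =
     mat22 (a * a' + b * c') (a * b' + b * d') (c * a' + d * c') (c * b' + d * d')"
  by (simp add: vec_eq_iff forall_2 matrix_matrix_mult_def sum_2)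

lemma mat22_mult_vec:
  "mat22 a b c d *v v = vector [a * v $ 1 + b * v $ 2, c * v $ 1 + d * v $ 2]"
  by (simp add: vec_eq_iff forall_2 matrix_vector_mult_def sum_2)

lemma mat_1_mat22: "mat 1 = mat22 1 0 0 1"
  by (simp add: vec_eq_iff forall_2 mat_def)

lemma det_mat22 [simp]: "det (mat22 a b c d :: 'b::comm_ring_1^2^2) = a * d - b * c"
  by (simp add: det_2)

definition subring :: "'b :: comm_ring_1 set \<Rightarrow> bool" where
  "subring R \<longleftrightarrow> 1 \<in> R \<and> (\<forall>x\<in>R. \<forall>y\<in>R. x - y \<in> R \<and> x * y \<in> R)"

lemma subringD:
  assumes "subring R"
  shows "1 \<in> R" "0 \<in> R" "x \<in> R \<Longrightarrow> y \<in> R \<Longrightarrow> x - y \<in> R" "x \<in> R \<Longrightarrow> y \<in> R \<Longrightarrow> x * y \<in> R"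
    "x \<in> R \<Longrightarrow> - x \<in> R" "x \<in> R \<Longrightarrow> y \<in> R \<Longrightarrow> x + y \<in> R"
proof -
  have "1 - 1 \<in> R" using assms unfolding subring_def by blast
  then show 0: "0 \<in> R" by simp
  show m: "- x \<in> R" if "x \<in> R" for x
  proof -
    have "0 - x \<in> R" using assms 0 that unfolding subring_def by blast
    then show ?thesis by simp
  qed
  show "x + y \<in> R" if "x \<in> R" "y \<in> R"
  proof -
    have "x - (- y) \<in> R" using assms m that unfolding subring_def by blast
    then show ?thesis by simp
  qed
qed (use assms in \<open>auto simp: subring_def\<close>)

lemma subring_UNIV: "subring UNIV"
  by (simp add: subring_def)

lemma subring_pideal: "subring (pideal 0)"
  by (auto simp: subring_def one_in_pideal pideal_diff intro: pideal_mult)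

lemma subring_poly_ring: "subring poly_ring"
  by (auto simp: subring_def poly_ring_1 poly_ring_diff poly_ring_mult)

text \<open>
  One notion serves two groups: the arithmetic group is the case of the polynomial ring, and the
  automorphism group of the standard lattice is the case of \<open>\<O>\<close>.
\<close>

definition GL2 :: "'b :: comm_ring_1 set \<Rightarrow> ('b ^ 2 ^ 2) set" where
  "GL2 R = {g. (\<forall>i j. g $ i $ j \<in> R) \<and>
     (\<exists>g'. (\<forall>i j. g' $ i $ j \<in> R) \<and> g ** g' = mat 1 \<and> g' ** g = mat 1)}"

lemma GL2_poly_eq: "GL2_poly = GL2 poly_ring"
  by (simp add: GL2_poly_def GL2_def)

text \<open>
  The adjugate gives the inverse, so only the determinant has to be a unit.
\<close>

lemma mat22_in_GL2_iff:
  assumes "subring R"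
  shows "mat22 a b c d \<in> GL2 R \<longleftrightarrow>
    a \<in> R \<and> b \<in> R \<and> c \<in> R \<and> d \<in> R \<and> (\<exists>e\<in>R. (a * d - b * c) * e = 1)"
proof
  assume "mat22 a b c d \<in> GL2 R"
  then obtain g' where g: "\<forall>i j. mat22 a b c d $ i $ j \<in> R" and R': "\<forall>i j. g' $ i $ j \<in> R"
    and g': "mat22 a b c d ** g' = mat 1"
    unfolding GL2_def by blast
  have e: "a \<in> R" "b \<in> R" "c \<in> R" "d \<in> R" using g by (simp_all add: forall_2)
  have "det g' \<in> R" unfolding det_2 using R' by (intro subringD(3,4)[OF assms]) blast+
  moreover have "(a * d - b * c) * det g' = 1"
    using arg_cong[OF g', of det] by (simp add: det_mul)
  ultimately show "a \<in> R \<and> b \<in> R \<and> c \<in> R \<and> d \<in> R \<and> (\<exists>e\<in>R. (a * d - b * c) * e = 1)"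
    using e by blast
next
  assume "a \<in> R \<and> b \<in> R \<and> c \<in> R \<and> d \<in> R \<and> (\<exists>e\<in>R. (a * d - b * c) * e = 1)"
  then obtain e where R: "a \<in> R" "b \<in> R" "c \<in> R" "d \<in> R" "e \<in> R" and e: "(a * d - b * c) * e = 1"
    by blast
  let ?g' = "mat22 (d * e) (- b * e) (- c * e) (a * e)"
  have "mat22 a b c d ** ?g' = mat 1" "?g' ** mat22 a b c d = mat 1"
    using e unfolding mat_1_mat22 mat22_mult mat22_eq_iff by (auto simp: algebra_simps)
  moreover have "\<forall>i j. ?g' $ i $ j \<in> R" using R subringD(4,5)[OF assms] by (simp add: forall_2)
  moreover have "\<forall>i j. mat22 a b c d $ i $ j \<in> R" using R by (simp add: forall_2)
  ultimately show "mat22 a b c d \<in> GL2 R" unfolding GL2_def by blast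
qed

lemma GL2_mult:
  assumes "subring R" "g \<in> GL2 R" "h \<in> GL2 R"
  shows "g ** h \<in> GL2 R"
proof -
  obtain a b c d where g: "g = mat22 a b c d" by (rule mat22_exhaust)
  obtain a' b' c' d' where h: "h = mat22 a' b' c' d'" by (rule mat22_exhaust)
  obtain e e' where *: "e \<in> R" "(a * d - b * c) * e = 1" "e' \<in> R" "(a' * d' - b' * c') * e' = 1"
    using assms unfolding g h mat22_in_GL2_iff[OF assms(1)] by blast
  have "((a * a' + b * c') * (c * b' + d * d') - (a * b' + b * d') * (c * a' + d * c')) * (e * e')
      = ((a * d - b * c) * e) * ((a' * d' - b' * c') * e')"
    by (simp add: algebra_simps)
  then have "((a * a' + b * c') * (c * b' + d * d') - (a * b' + b * d') * (c * a' + d * c')) * (e * e') = 1"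
    using * by simp
  moreover have "e * e' \<in> R" using * subringD(4)[OF assms(1)] by blast
  ultimately show ?thesis
    using assms(2,3) * unfolding g h mat22_mult mat22_in_GL2_iff[OF assms(1)]
    by (intro conjI subringD(4,6)[OF assms(1)] bexI[of _ "e * e'"]) blast+
qed

lemma GL2_one: "subring R \<Longrightarrow> mat 1 \<in> GL2 R"
  unfolding mat_1_mat22 using subringD[of R] by (auto simp: mat22_in_GL2_iff intro!: bexI[of _ 1])

lemma GL2_inverse:
  assumes "g \<in> GL2 R"
  obtains g' where "g' \<in> GL2 R" "g ** g' = mat 1" "g' ** g = mat 1"
  using assms unfolding GL2_def by blast

lemma GL2_mono: "R \<subseteq> S \<Longrightarrow> g \<in> GL2 R \<Longrightarrow> g \<in> GL2 S"
  unfolding GL2_def by blast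

lemma mat22_in_GL2_UNIV: "mat22 a b c (d :: 'b :: field) \<in> GL2 UNIV \<longleftrightarrow> a * d - b * c \<noteq> 0"
  by (auto simp: mat22_in_GL2_iff[OF subring_UNIV] intro!: exI[of _ "inverse (a * d - b * c)"])

lemma swap_in_GL2: "subring R \<Longrightarrow> mat22 0 1 1 0 \<in> GL2 R"
  using subringD[of R] by (auto simp: mat22_in_GL2_iff intro!: bexI[of _ "-1"])

lemma unipotent_in_GL2: "subring R \<Longrightarrow> p \<in> R \<Longrightarrow> mat22 1 p 0 1 \<in> GL2 R"
  and lower_unipotent_in_GL2: "subring R \<Longrightarrow> p \<in> R \<Longrightarrow> mat22 1 0 p 1 \<in> GL2 R"
  using subringD[of R] by (auto simp: mat22_in_GL2_iff intro!: bexI[of _ "1"])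

lemma pideal_unit_subdegree:
  assumes "x \<in> pideal 0" "e \<in> pideal 0" "x * e = 1"
  shows "fls_subdegree x = 0"
proof -
  have nz: "x \<noteq> 0" "e \<noteq> 0" using assms(3) by auto
  then have "fls_subdegree x + fls_subdegree e = 0"
    using fls_subdegree_mult[of x e] assms(3) by simp
  then show ?thesis using assms(1,2) nz by (auto simp: pideal_iff_subdegree)
qed

lemma poly_ring_subdegree:
  assumes "x \<in> poly_ring" "x \<noteq> 0"
  shows "fls_subdegree x \<le> 0"
proof (rule ccontr)
  assume "\<not> fls_subdegree x \<le> 0"
  then have "x \<in> pideal 1" by (simp add: pideal_iff_subdegree)
  then show False using assms poly_ring_Int_pideal by blast
qed

lemma poly_ring_unit_subdegree:
  assumes "x \<in> poly_ring" "e \<in> poly_ring" "x * e = 1"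
  shows "fls_subdegree x = 0"
proof -
  have nz: "x \<noteq> 0" "e \<noteq> 0" using assms(3) by auto
  then have "fls_subdegree x + fls_subdegree e = 0"
    using fls_subdegree_mult[of x e] assms(3) by simp
  then show ?thesis using assms(1,2) nz poly_ring_subdegree[of x] poly_ring_subdegree[of e] by simp
qed

section \<open>Lattice classes\<close>

definition lat :: "'a :: {finite, field} fls ^ 2 ^ 2 \<Rightarrow> ('a fls ^ 2) set" where
  "lat g = (\<lambda>x. g *v x) ` std_lattice"

definition cls :: "'a :: {finite, field} fls ^ 2 ^ 2 \<Rightarrow> ('a fls ^ 2) set set" where
  "cls g = homothety_class (lat g)"

lemma in_std_lattice: "v \<in> std_lattice \<longleftrightarrow> v $ 1 \<in> pideal 0 \<and> v $ 2 \<in> pideal 0"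
  by (simp add: std_lattice_def forall_2 O_F_eq_pideal)

lemma lat_mult: "lat (g ** h) = (\<lambda>x. g *v x) ` lat h"
  by (simp add: lat_def image_image matrix_vector_mul_assoc)

lemma scale_lat: "(\<lambda>x. c *s x) ` lat g = lat (mat22 c 0 0 c ** g)"
proof -
  have "c *s x = mat22 c 0 0 c *v x" for x
    by (simp add: mat22_mult_vec vec_eq_iff forall_2)
  then show ?thesis by (simp add: lat_mult)
qed

lemma lat_mat_1: "lat (mat 1) = std_lattice"
  by (simp add: lat_def)

lemma lat_integral_subset:
  assumes "\<kappa> \<in> GL2 (pideal 0)"
  shows "lat \<kappa> \<subseteq> std_lattice"
proof -
  obtain a b c d where \<kappa>: "\<kappa> = mat22 a b c d" by (rule mat22_exhaust)
  have "a \<in> pideal 0" "b \<in> pideal 0" "c \<in> pideal 0" "d \<in> pideal 0"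
    using assms by (auto simp: \<kappa> mat22_in_GL2_iff[OF subring_pideal])
  then show ?thesis
    by (auto simp: \<kappa> lat_def mat22_mult_vec in_std_lattice intro!: subringD(4,6)[OF subring_pideal])
qed

text \<open>
  Column operations over \<open>\<O>\<close> change the basis of a lattice, not the lattice.
\<close>

lemma lat_integral:
  assumes "\<kappa> \<in> GL2 (pideal 0)"
  shows "lat \<kappa> = std_lattice"
proof
  obtain \<kappa>' where \<kappa>': "\<kappa>' \<in> GL2 (pideal 0)" "\<kappa> ** \<kappa>' = mat 1"
    using GL2_inverse[OF assms] by blast
  have "(\<lambda>x. \<kappa> *v x) ` lat \<kappa>' \<subseteq> (\<lambda>x. \<kappa> *v x) ` std_lattice"
    by (intro image_mono lat_integral_subset \<kappa>')
  then show "std_lattice \<subseteq> lat \<kappa>"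
    by (simp add: lat_mult[symmetric] \<kappa>' lat_mat_1 lat_def[symmetric])
qed (rule lat_integral_subset[OF assms])

lemma lat_mult_integral: "\<kappa> \<in> GL2 (pideal 0) \<Longrightarrow> lat (g ** \<kappa>) = lat g"
  by (simp add: lat_mult lat_integral) (simp add: lat_def)

text \<open>
  If \<open>g\<close> and \<open>h\<close> span the same lattice, then \<open>h\<^sup>-\<^sup>1g\<close> and its inverse both preserve \<open>\<O>\<^sup>2\<close>, and the images
  of the standard basis show that their entries are integral.
\<close>

lemma lat_eq_imp:
  assumes "h \<in> GL2 UNIV" "g \<in> GL2 UNIV" "lat g = lat h"
  shows "\<exists>\<kappa>\<in>GL2 (pideal 0). g = h ** \<kappa>"
proof -
  have *: "\<forall>i j. k $ i $ j \<in> pideal 0" if "lat k = std_lattice" for k :: "'a fls^2^2"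
  proof -
    obtain a b c d where k: "k = mat22 a b c d" by (rule mat22_exhaust)
    have "k *v v \<in> std_lattice" if "v \<in> std_lattice" for v
      using that \<open>lat k = std_lattice\<close> unfolding lat_def by blast
    then have "k *v vector [1, 0] \<in> std_lattice" "k *v vector [0, 1] \<in> std_lattice"
      by (simp_all add: in_std_lattice one_in_pideal)
    then show ?thesis by (simp add: k mat22_mult_vec in_std_lattice forall_2)
  qed
  obtain h' where h': "h ** h' = mat 1" "h' ** h = mat 1" using GL2_inverse[OF assms(1)] by blast
  obtain g' where g': "g ** g' = mat 1" "g' ** g = mat 1" using GL2_inverse[OF assms(2)] by blast
  have 1: "lat (h' ** g) = std_lattice"
    by (simp add: lat_mult assms(3)) (simp add: lat_mult[symmetric] h' lat_mat_1)
  have 2: "lat (g' ** h) = std_lattice"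
    by (simp add: lat_mult assms(3)[symmetric]) (simp add: lat_mult[symmetric] g' lat_mat_1)
  have "(h' ** g) ** (g' ** h) = mat 1"
    by (metis g'(1) h'(2) matrix_mul_assoc matrix_mul_rid)
  moreover have "(g' ** h) ** (h' ** g) = mat 1"
    by (metis g'(2) h'(1) matrix_mul_assoc matrix_mul_rid)
  ultimately have "h' ** g \<in> GL2 (pideal 0)"
    unfolding GL2_def using *[OF 1] *[OF 2] by blast
  moreover have "g = h ** (h' ** g)" by (simp add: matrix_mul_assoc h')
  ultimately show ?thesis by blast
qed

lemma scale_image_scale: "(\<lambda>x. c *s x) ` (\<lambda>x. d *s x) ` L = (\<lambda>x. (c * d) *s x) ` L"
  for L :: "('b::comm_ring_1 ^ 'n) set"
  by (simp add: image_image vector_smult_assoc)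

lemma self_in_homothety_class: "L \<in> homothety_class L"
  unfolding homothety_class_def by (auto intro!: exI[of _ 1])

lemma homothety_class_scale:
  assumes "c \<noteq> 0"
  shows "homothety_class ((\<lambda>x. c *s x) ` L) = homothety_class L"
  unfolding homothety_class_def scale_image_scale
proof (intro set_eqI iffI; clarify)
  fix d :: "'a fls" assume "d \<noteq> 0"
  then show "\<exists>e. (\<lambda>x. (d * c) *s x) ` L = (\<lambda>x. e *s x) ` L \<and> e \<noteq> 0"
    using assms by (intro exI[of _ "d * c"]) auto
next
  fix d :: "'a fls" assume "d \<noteq> 0"
  then show "\<exists>e. (\<lambda>x. d *s x) ` L = (\<lambda>x. (e * c) *s x) ` L \<and> e \<noteq> 0"
    using assms by (intro exI[of _ "d / c"]) auto
qed

lemma homothety_class_eq: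
  assumes "L \<in> homothety_class M"
  shows "homothety_class L = homothety_class M"
proof -
  obtain c where "c \<noteq> 0" "L = (\<lambda>x. c *s x) ` M" using assms unfolding homothety_class_def by blast
  then show ?thesis using homothety_class_scale by blast
qed

lemma cls_scale: "c \<noteq> 0 \<Longrightarrow> cls (mat22 c 0 0 c ** g) = cls g"
  by (simp add: cls_def scale_lat[symmetric] homothety_class_scale)

text \<open>
  Every equality of vertices below is proved by exhibiting a scalar and a matrix of column operations.
\<close>

lemma cls_eqI:
  assumes "mat22 s 0 0 s ** g = h ** \<kappa>" "s \<noteq> 0" "\<kappa> \<in> GL2 (pideal 0)"
  shows "cls g = cls h"
proof -
  have "cls g = cls (h ** \<kappa>)" using cls_scale[OF assms(2), of g] assms(1) by simp
  then show ?thesis using assms(3) by (simp add: cls_def lat_mult_integral)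
qed

lemma scalar_in_GL2: "s \<noteq> 0 \<Longrightarrow> mat22 s 0 0 s \<in> GL2 (UNIV :: 'b::field set)"
  by (simp add: mat22_in_GL2_UNIV)

lemma scalar_commute: "mat22 s 0 0 s ** g = g ** mat22 s 0 0 (s :: 'b::comm_ring_1)"
  by (rule mat22_exhaust[of g]) (simp add: mult.commute)

lemma cls_eq_imp:
  assumes "cls g = cls h" "g \<in> GL2 UNIV" "h \<in> GL2 UNIV"
  obtains s \<kappa> where "s \<noteq> 0" "\<kappa> \<in> GL2 (pideal 0)" "mat22 s 0 0 s ** g = h ** \<kappa>"
proof -
  have "lat h \<in> cls g" using assms(1) self_in_homothety_class unfolding cls_def by blast
  then obtain s where s: "s \<noteq> 0" "lat h = lat (mat22 s 0 0 s ** g)"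
    unfolding cls_def homothety_class_def scale_lat by blast
  have "mat22 s 0 0 s ** g \<in> GL2 UNIV"
    by (intro GL2_mult subring_UNIV scalar_in_GL2 s assms)
  then obtain \<kappa> where "\<kappa> \<in> GL2 (pideal 0)" "mat22 s 0 0 s ** g = h ** \<kappa>"
    using lat_eq_imp[OF assms(3) _ s(2)[symmetric]] by blast
  then show ?thesis using that s(1) by blast
qed

lemma matrix_vector_smult: "g *v (c *s x) = c *s (g *v x)" for g :: "'b::comm_ring_1^'n^'m"
  by (simp add: vec_eq_iff matrix_vector_mult_def sum_distrib_left algebra_simps)

lemma vact_homothety_class: "vact g (homothety_class L) = homothety_class ((\<lambda>x. g *v x) ` L)"
proof -
  have "vact g (homothety_class L) = {(\<lambda>x. g *v x) ` (\<lambda>x. c *s x) ` L | c. c \<noteq> 0}"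
    unfolding vact_def homothety_class_def by blast
  also have "\<dots> = homothety_class ((\<lambda>x. g *v x) ` L)"
    unfolding homothety_class_def image_image matrix_vector_smult ..
  finally show ?thesis .
qed

lemma vact_cls: "vact g (cls h) = cls (g ** h)"
  by (simp add: cls_def vact_homothety_class lat_mult)

lemma invertible_iff_GL2: "invertible g \<longleftrightarrow> g \<in> GL2 UNIV"
  by (auto simp: invertible_def GL2_def)

lemma vertices_eq: "vertices = cls ` GL2 UNIV"
  by (auto simp: vertices_def is_lattice_def cls_def lat_def invertible_iff_GL2)

lemma vv_eq: "vv n = cls (mat22 (tt ^ n) 0 0 1)"
  by (simp add: vv_def vact_homothety_class cls_def lat_def)

section \<open>Neighbours in the tree\<close>

lemma X_division:
  fixes f :: "'a::{finite,field} fls"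
  assumes "f \<in> pideal 1"
  obtains w where "w \<in> pideal 0" "f = fls_X * w"
proof (rule that)
  show "f / fls_X \<in> pideal 0" by (rule pideal_divide[OF assms]) auto
  show "f = fls_X * (f / fls_X)" by (simp del: fls_divide_X)
qed

lemma nth_0_mult:
  assumes "f \<in> pideal 0" "g \<in> pideal 0"
  shows "fls_nth (f * g) 0 = fls_nth f 0 * fls_nth g 0"
proof -
  have "f - fls_const (fls_nth f 0) \<in> pideal 1"
    using assms by (auto simp: pideal_def)
  then have "(f - fls_const (fls_nth f 0)) * g \<in> pideal 1"
    by (rule pideal_mult) (use assms in auto)
  then have "fls_nth ((f - fls_const (fls_nth f 0)) * g) 0 = 0" by (rule pidealD) simp
  then show ?thesis by (simp add: algebra_simps)
qed

text \<open>The lattices between \<open>\<O>\<^sup>2\<close> and \<open>\<pi>\<O>\<^sup>2\<close> are the kernels of linear forms on the reduction.\<close>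

text \<open>
  As \<open>(\<alpha> : \<beta>)\<close> varies over the projective line, these are the lattices strictly between \<open>\<pi>\<O>\<^sup>2\<close> and
  \<open>\<O>\<^sup>2\<close>: the kernels of nonzero linear forms on the reduction \<open>\<O>\<^sup>2/\<pi>\<O>\<^sup>2\<close>.
\<close>

definition form_kernel :: "'a :: {finite, field} \<Rightarrow> 'a \<Rightarrow> ('a fls ^ 2) set" where
  "form_kernel \<alpha> \<beta> = {v \<in> std_lattice. \<alpha> * fls_nth (v $ 1) 0 + \<beta> * fls_nth (v $ 2) 0 = 0}"

lemma form_kernel_first:
  assumes "\<alpha> \<noteq> 0"
  shows "form_kernel \<alpha> \<beta> = lat (mat22 fls_X (fls_const (- \<beta> / \<alpha>)) 0 1)"
proof (intro set_eqI iffI)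
  fix v assume v: "v \<in> form_kernel \<alpha> \<beta>"
  let ?c = "fls_const (- \<beta> / \<alpha>)"
  have "fls_nth (v $ 1 - ?c * v $ 2) 0 = 0"
    using v assms by (simp add: form_kernel_def field_simps eq_neg_iff_add_eq_0)
  moreover have "v $ 1 - ?c * v $ 2 \<in> pideal 0"
    using v by (intro subringD[OF subring_pideal] const_in_pideal) (auto simp: form_kernel_def in_std_lattice)
  ultimately have "v $ 1 - ?c * v $ 2 \<in> pideal 1"
    by (auto simp: pideal_def) (metis less_irrefl linorder_neqE_linordered_idom zle_add1_eq_le add_0 not_less)
  then obtain w where w: "w \<in> pideal 0" "v $ 1 - ?c * v $ 2 = fls_X * w" by (rule X_division)
  have "v = mat22 fls_X ?c 0 1 *v vector [w, v $ 2]"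
    using w(2) by (simp add: mat22_mult_vec vec_eq_iff forall_2 algebra_simps)
  moreover have "vector [w, v $ 2] \<in> std_lattice"
    using w v by (simp add: form_kernel_def in_std_lattice)
  ultimately show "v \<in> lat (mat22 fls_X ?c 0 1)" unfolding lat_def by blast
next
  fix v assume "v \<in> lat (mat22 fls_X (fls_const (- \<beta> / \<alpha>)) 0 1)"
  then obtain w where "w \<in> std_lattice" and v: "v = mat22 fls_X (fls_const (- \<beta> / \<alpha>)) 0 1 *v w"
    unfolding lat_def by blast
  then have w: "w $ 1 \<in> pideal 0" "w $ 2 \<in> pideal 0" by (simp_all add: in_std_lattice)
  have Xw: "fls_X * w $ 1 \<in> pideal 1" by (rule pideal_mult[OF _ w(1)]) (auto simp: pideal_iff_subdegree)
  have "v $ 1 \<in> pideal 0" "v $ 2 \<in> pideal 0"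
    using w pideal_mono[OF Xw, of 0]
    by (auto simp: v mat22_mult_vec intro!: pideal_add pideal_diff pideal_mult[OF const_in_pideal])
  moreover have "fls_nth (fls_X * w $ 1) 0 = 0" by (rule pidealD[OF Xw]) simp
  ultimately show "v \<in> form_kernel \<alpha> \<beta>"
    using assms by (simp add: form_kernel_def in_std_lattice v mat22_mult_vec)
qed

lemma form_kernel_second:
  assumes "\<beta> \<noteq> 0"
  shows "form_kernel 0 \<beta> = lat (mat22 1 0 0 fls_X)"
proof (intro set_eqI iffI)
  fix v assume v: "v \<in> form_kernel 0 \<beta>"
  then have "v $ 2 \<in> pideal 1" using assms
    by (auto simp: form_kernel_def in_std_lattice pideal_def) (metis less_irrefl linorder_neqE_linordered_idom zle_add1_eq_le add_0 not_less)
  then obtain w where w: "w \<in> pideal 0" "v $ 2 = fls_X * w" by (rule X_division)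
  have "v = mat22 1 0 0 fls_X *v vector [v $ 1, w]"
    using w(2) by (simp add: mat22_mult_vec vec_eq_iff forall_2 algebra_simps)
  moreover have "vector [v $ 1, w] \<in> std_lattice"
    using w v by (simp add: form_kernel_def in_std_lattice)
  ultimately show "v \<in> lat (mat22 1 0 0 fls_X)" unfolding lat_def by blast
next
  fix v assume "v \<in> lat (mat22 1 0 0 (fls_X :: 'a fls))"
  then obtain w where "w \<in> std_lattice" and v: "v = mat22 1 0 0 fls_X *v w"
    unfolding lat_def by blast
  then have w: "w $ 1 \<in> pideal 0" "w $ 2 \<in> pideal 0" by (simp_all add: in_std_lattice)
  have Xw: "fls_X * w $ 2 \<in> pideal 1" by (rule pideal_mult[OF _ w(2)]) (auto simp: pideal_iff_subdegree)
  moreover have "fls_nth (fls_X * w $ 2) 0 = 0" by (rule pidealD[OF Xw]) simp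
  ultimately show "v \<in> form_kernel 0 \<beta>"
    using w pideal_mono[OF Xw] by (simp add: form_kernel_def in_std_lattice v mat22_mult_vec)
qed

text \<open>
  The map to the residue field is \<open>\<O>\<close>-linear, so it is determined by its values on the two columns of
  \<open>g\<close>, and it sees the coordinates of a vector only through their constant coefficients.
\<close>

lemma quotient_residue_imp_form_kernel:
  assumes "quotient_is_residue_field (lat g) L'"
  shows "\<exists>\<alpha> \<beta>. (\<alpha> \<noteq> 0 \<or> \<beta> \<noteq> 0) \<and> L' = (\<lambda>x. g *v x) ` form_kernel \<alpha> \<beta>"
proof -
  obtain \<phi> where add: "\<And>x y. x \<in> lat g \<Longrightarrow> y \<in> lat g \<Longrightarrow> \<phi> (x + y) = \<phi> x + \<phi> y"
    and scale: "\<And>c x. c \<in> O_F \<Longrightarrow> x \<in> lat g \<Longrightarrow> \<phi> (c *s x) = fls_nth c 0 * \<phi> x"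
    and surj: "\<phi> ` lat g = UNIV" and ker: "{x \<in> lat g. \<phi> x = 0} = L'"
    using assms unfolding quotient_is_residue_field_def by blast
  define \<alpha> \<beta> where "\<alpha> = \<phi> (g *v vector [1, 0])" and "\<beta> = \<phi> (g *v vector [0, 1])"
  have \<phi>: "\<phi> (g *v v) = \<alpha> * fls_nth (v $ 1) 0 + \<beta> * fls_nth (v $ 2) 0" if "v \<in> std_lattice" for v
  proof -
    have v: "v $ 1 \<in> pideal 0" "v $ 2 \<in> pideal 0" using that by (auto simp: in_std_lattice)
    have "v = v $ 1 *s vector [1, 0] + v $ 2 *s vector [0, 1]" by (simp add: vec_eq_iff forall_2)
    then have "g *v v = v $ 1 *s (g *v vector [1, 0]) + v $ 2 *s (g *v vector [0, 1])"
      by (metis matrix_vector_right_distrib matrix_vector_smult)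
    moreover have "g *v w \<in> lat g" if "w \<in> std_lattice" for w using that by (simp add: lat_def)
    moreover have "v $ 1 *s vector [1, 0] \<in> std_lattice" "v $ 2 *s vector [0, 1] \<in> std_lattice"
      "(vector [1, 0] :: 'a fls^2) \<in> std_lattice" "(vector [0, 1] :: 'a fls^2) \<in> std_lattice"
      using v by (simp_all add: in_std_lattice one_in_pideal)
    ultimately show ?thesis
      using v by (simp add: add scale O_F_eq_pideal \<alpha>_def \<beta>_def mult.commute flip: matrix_vector_smult)
        (simp add: add scale O_F_eq_pideal matrix_vector_smult mult.commute)
  qed
  have "L' = (\<lambda>x. g *v x) ` form_kernel \<alpha> \<beta>"
    unfolding ker[symmetric] form_kernel_def lat_def using \<phi> by auto
  moreover have "\<alpha> \<noteq> 0 \<or> \<beta> \<noteq> 0"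
  proof (rule ccontr)
    assume "\<not> (\<alpha> \<noteq> 0 \<or> \<beta> \<noteq> 0)"
    then have "\<phi> x = 0" if "x \<in> lat g" for x using that \<phi> unfolding lat_def by auto
    moreover have "1 \<in> \<phi> ` lat g" unfolding surj by simp
    ultimately show False by auto
  qed
  ultimately show ?thesis by blast
qed

text \<open>
  In the basis given by \<open>g\<close> the linear form itself is the required map. The inclusions are strict because the
  form is onto, and because it kills the vector \<open>(\<beta>, -\<alpha>)\<close>, which is not divisible by \<open>\<pi>\<close>.
\<close>

lemma form_kernel_quotient:
  fixes g :: "'a::{finite,field} fls ^ 2 ^ 2"
  assumes g: "g \<in> GL2 UNIV" and nz: "\<alpha> \<noteq> 0 \<or> \<beta> \<noteq> 0"
  defines "L' \<equiv> (\<lambda>x. g *v x) ` form_kernel \<alpha> \<beta>"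
  shows "(\<lambda>x. fls_X *s x) ` lat g \<subset> L'" "L' \<subset> lat g" "quotient_is_residue_field (lat g) L'"
proof -
  obtain h where h: "h ** g = mat 1" using GL2_inverse[OF g] by blast
  have hg: "h *v (g *v x) = x" for x by (simp add: matrix_vector_mul_assoc h)
  then have inj: "inj (\<lambda>x. g *v x)" by (metis injI)
  define f where "f v = \<alpha> * fls_nth (v $ 1) 0 + \<beta> * fls_nth (v $ 2) 0" for v :: "'a fls^2"
  define \<phi> where "\<phi> x = f (h *v x)" for x
  have ker: "{x \<in> lat g. \<phi> x = 0} = L'"
    unfolding L'_def lat_def form_kernel_def \<phi>_def f_def by (auto simp: hg)
  have fsurj: "\<exists>v\<in>std_lattice. f v = y" for y
  proof -
    have c: "vector [fls_const a, fls_const b] \<in> std_lattice" for a b :: 'a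
      by (simp add: in_std_lattice const_in_pideal)
    show ?thesis
    proof (cases "\<alpha> = 0")
      case True
      then show ?thesis using nz by (intro bexI[OF _ c[of 0 "y / \<beta>"]]) (simp add: f_def)
    next
      case False
      then show ?thesis by (intro bexI[OF _ c[of "y / \<alpha>" 0]]) (simp add: f_def)
    qed
  qed
  have "\<phi> ` lat g = UNIV" using fsurj unfolding \<phi>_def lat_def image_image hg by (auto simp: image_iff) metis
  moreover have "\<phi> (x + y) = \<phi> x + \<phi> y" for x y
    by (simp add: \<phi>_def f_def matrix_vector_right_distrib algebra_simps)
  moreover have "\<phi> (c *s x) = fls_nth c 0 * \<phi> x" if c: "c \<in> O_F" and x: "x \<in> lat g" for c x
  proof -
    obtain v where "v \<in> std_lattice" "x = g *v v" using x unfolding lat_def by blast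
    then show ?thesis
      using c by (simp add: \<phi>_def f_def hg matrix_vector_smult nth_0_mult O_F_eq_pideal in_std_lattice algebra_simps)
  qed
  ultimately show Q: "quotient_is_residue_field (lat g) L'"
    unfolding quotient_is_residue_field_def using ker by blast
  obtain v1 where "v1 \<in> std_lattice" "f v1 = 1" using fsurj by blast
  then have "g *v v1 \<in> lat g" "\<phi> (g *v v1) \<noteq> 0" by (auto simp: lat_def \<phi>_def hg)
  then show "L' \<subset> lat g" unfolding ker[symmetric] by blast
  let ?v = "vector [fls_const \<beta>, fls_const (- \<alpha>)] :: 'a fls^2"
  have vk: "?v \<in> form_kernel \<alpha> \<beta>" by (auto simp: form_kernel_def in_std_lattice intro: const_in_pideal pideal_uminus)
  have "?v \<noteq> fls_X *s w" if "w \<in> std_lattice" for w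
  proof
    assume eq: "?v = fls_X *s w"
    have "fls_X * w $ i \<in> pideal 1" for i
      by (rule pideal_mult[of _ 1 _ 0])
        (use that exhaust_2[of i] in \<open>auto simp: in_std_lattice pideal_iff_subdegree\<close>)
    then have "fls_nth ((fls_X *s w) $ i) 0 = 0" for i by (simp add: pideal_def)
    from this[of 1] this[of 2] have "\<beta> = 0" "\<alpha> = 0" unfolding eq[symmetric] by simp_all
    then show False using nz by simp
  qed
  then have "g *v ?v \<notin> (\<lambda>x. fls_X *s x) ` lat g"
    using inj unfolding lat_def image_image matrix_vector_smult[symmetric] by (auto dest: injD)
  moreover have "g *v ?v \<in> L'" unfolding L'_def using vk by blast
  moreover have "(\<lambda>x. fls_X *s x) ` lat g \<subseteq> L'"
  proof -
    have "fls_X *s w \<in> form_kernel \<alpha> \<beta>" if "w \<in> std_lattice" for w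
    proof -
      have X: "fls_X * w $ i \<in> pideal 1" for i
        by (rule pideal_mult[of _ 1 _ 0])
          (use that exhaust_2[of i] in \<open>auto simp: in_std_lattice pideal_iff_subdegree\<close>)
      then have "fls_nth (fls_X * w $ i) 0 = 0" "fls_X * w $ i \<in> pideal 0" for i
        using pidealD[OF X, of 0 i] pideal_mono[OF X, of 0 i] by auto
      then show ?thesis by (simp add: form_kernel_def in_std_lattice del: fls_mult_const_nth)
    qed
    then show ?thesis
      unfolding L'_def lat_def image_image matrix_vector_smult[symmetric] by blast
  qed
  ultimately show "(\<lambda>x. fls_X *s x) ` lat g \<subset> L'" by blast
qed

text \<open>
  The \<open>q + 1\<close> neighbours: translation by \<open>g\<close> reduces to the neighbours of \<open>[\<O>\<^sup>2]\<close>, which are the kernels of the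
  linear forms. Homothety classes absorb the choice of representatives.
\<close>

lemma adj_cls_iff:
  assumes g: "g \<in> GL2 UNIV"
  shows "adj (cls g) z' \<longleftrightarrow>
    (\<exists>c. z' = cls (g ** mat22 fls_X (fls_const c) 0 1)) \<or> z' = cls (g ** mat22 1 0 0 fls_X)"
proof -
  have cls_kernel: "(\<exists>c. homothety_class ((\<lambda>x. g *v x) ` form_kernel \<alpha> \<beta>) = cls (g ** mat22 fls_X (fls_const c) 0 1)) \<or>
      homothety_class ((\<lambda>x. g *v x) ` form_kernel \<alpha> \<beta>) = cls (g ** mat22 1 0 0 fls_X)" if "\<alpha> \<noteq> 0 \<or> \<beta> \<noteq> 0" for \<alpha> \<beta>
    using that
    by (cases "\<alpha> = 0")
      (auto simp: form_kernel_first form_kernel_second cls_def lat_mult intro!: disjI1 exI[of _ "- \<beta> / \<alpha>"])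
  show ?thesis
  proof
    assume "adj (cls g) z'"
    then obtain L L' where L: "L \<in> cls g" "L' \<in> z'" "quotient_is_residue_field L L'" and z': "z' \<in> vertices"
      unfolding adj_def by blast
    obtain s where s: "s \<noteq> 0" "L = lat (mat22 s 0 0 s ** g)"
      using L(1) unfolding cls_def homothety_class_def scale_lat by blast
    obtain \<alpha> \<beta> where ab: "\<alpha> \<noteq> 0 \<or> \<beta> \<noteq> 0" "L' = (\<lambda>x. (mat22 s 0 0 s ** g) *v x) ` form_kernel \<alpha> \<beta>"
      using quotient_residue_imp_form_kernel[OF L(3)[unfolded s(2)]] by blast
    have "mat22 s 0 0 s *v x = s *s x" for x :: "'a fls^2"
      by (simp add: mat22_mult_vec vec_eq_iff forall_2)
    then have "L' = (\<lambda>x. s *s x) ` (\<lambda>x. g *v x) ` form_kernel \<alpha> \<beta>"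
      by (simp add: ab(2) image_image flip: matrix_vector_mul_assoc)
    moreover have "z' = homothety_class L'"
      using z' L(2) homothety_class_eq unfolding vertices_def by blast
    ultimately have "z' = homothety_class ((\<lambda>x. g *v x) ` form_kernel \<alpha> \<beta>)"
      using homothety_class_scale[OF s(1)] by simp
    then show "(\<exists>c. z' = cls (g ** mat22 fls_X (fls_const c) 0 1)) \<or> z' = cls (g ** mat22 1 0 0 fls_X)"
      using cls_kernel[OF ab(1)] by simp
  next
    assume *: "(\<exists>c. z' = cls (g ** mat22 fls_X (fls_const c) 0 1)) \<or> z' = cls (g ** mat22 1 0 0 fls_X)"
    then obtain h where h: "z' = cls (g ** h)" "h \<in> GL2 UNIV"
      by (auto simp: mat22_in_GL2_UNIV)
    obtain \<alpha> \<beta> where ab: "\<alpha> \<noteq> 0 \<or> \<beta> \<noteq> 0" "z' = homothety_class ((\<lambda>x. g *v x) ` form_kernel \<alpha> \<beta>)"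
      using *
    proof (elim disjE exE)
      fix c assume "z' = cls (g ** mat22 fls_X (fls_const c) 0 1)"
      then show thesis using that[of 1 "-c"] by (simp add: form_kernel_first cls_def lat_mult)
    next
      assume "z' = cls (g ** mat22 1 0 0 fls_X)"
      then show thesis using that[of 0 1] by (simp add: form_kernel_second cls_def lat_mult)
    qed
    have "cls g \<in> vertices" "z' \<in> vertices"
      unfolding vertices_eq h using g h(2) by (blast intro: GL2_mult[OF subring_UNIV])+
    then show "adj (cls g) z'"
      using form_kernel_quotient[OF g ab(1)] self_in_homothety_class unfolding adj_def ab(2) cls_def by blast
  qed
qed

section \<open>Descendants\<close>

text \<open>The classes of \<open>horo_mat n s\<close> are the vertices that are not behind the end \<open>\<infinity>\<close>, in horospherical coordinates.\<close>

text \<open>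
  The class of this matrix corresponds to the ball \<open>s + \<pi>\<^sup>n\<O>\<close>: in the model of the tree whose vertices are the balls of
  \<open>F\<close>, moving away from the end \<open>\<infinity>\<close> means shrinking the ball.
\<close>

definition horo_mat :: "nat \<Rightarrow> 'a :: {finite, field} fls \<Rightarrow> 'a fls ^ 2 ^ 2" where
  "horo_mat n s = mat22 (fls_X ^ n) s 0 1"

lemma horo_mat_in_GL2: "horo_mat n s \<in> GL2 UNIV"
  by (simp add: horo_mat_def mat22_in_GL2_UNIV)

text \<open>
  A matrix of column operations between two such bases is upper triangular with units on the diagonal, so it
  preserves the level \<open>n\<close> and moves \<open>s\<close> inside \<open>\<pi>\<^sup>n\<O>\<close>.
\<close>

lemma cls_horo_mat_eq_iff:
  assumes g: "g \<in> GL2 UNIV"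
  shows "cls (g ** horo_mat n s) = cls (g ** horo_mat m r) \<longleftrightarrow> n = m \<and> s - r \<in> pideal (int n)"
proof
  assume eq: "cls (g ** horo_mat n s) = cls (g ** horo_mat m r)"
  obtain g' where g': "g' ** g = mat 1" using GL2_inverse[OF g] by blast
  have "vact g' (cls (g ** horo_mat n s)) = vact g' (cls (g ** horo_mat m r))" using eq by simp
  then have "cls (horo_mat n s) = cls (horo_mat m r)"
    by (simp add: vact_cls matrix_mul_assoc g')
  then obtain c \<kappa> where c: "c \<noteq> 0" "\<kappa> \<in> GL2 (pideal 0)" "mat22 c 0 0 c ** horo_mat n s = horo_mat m r ** \<kappa>"
    using cls_eq_imp horo_mat_in_GL2 by metis
  obtain a b k l where \<kappa>: "\<kappa> = mat22 a b k l" by (rule mat22_exhaust)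
  have eqs: "k = 0" "l = c" "c * fls_X ^ n = fls_X ^ m * a" "c * s = fls_X ^ m * b + r * c"
    using c(3) by (auto simp: horo_mat_def \<kappa>)
  obtain e where e: "a \<in> pideal 0" "b \<in> pideal 0" "c \<in> pideal 0" "e \<in> pideal 0" "a * c * e = 1"
    using c(2) unfolding \<kappa> mat22_in_GL2_iff[OF subring_pideal] eqs by auto
  have "fls_subdegree a = 0"
    by (rule pideal_unit_subdegree[of _ "c * e"]) (use e subringD[OF subring_pideal] in \<open>auto simp: mult.assoc\<close>)
  moreover have cs: "fls_subdegree c = 0"
    by (rule pideal_unit_subdegree[of _ "a * e"]) (use e subringD[OF subring_pideal] in \<open>auto simp: algebra_simps\<close>)
  moreover have "a \<noteq> 0" using e(5) by auto
  ultimately have nm: "n = m"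
    using arg_cong[OF eqs(3), of fls_subdegree] c(1) by simp
  have "c * (s - r) = fls_X ^ m * b" using eqs(4) by (simp add: algebra_simps)
  moreover have "fls_X ^ m * b \<in> pideal (int m)"
    by (rule pideal_mult[OF _ e(2), of _ "int m"]) (auto simp: pideal_iff_subdegree)
  ultimately have "s - r \<in> pideal (int m)"
    using pideal_mult_iff[OF c(1), of "s - r" "int m"] cs by simp
  then show "n = m \<and> s - r \<in> pideal (int n)" using nm by simp
next
  assume *: "n = m \<and> s - r \<in> pideal (int n)"
  define b where "b = (s - r) / fls_X ^ n"
  have "b \<in> pideal 0" unfolding b_def by (rule pideal_divide) (use * in auto)
  then have "mat22 1 b 0 1 \<in> GL2 (pideal 0)" by (rule unipotent_in_GL2[OF subring_pideal])
  moreover have "horo_mat n s = horo_mat m r ** mat22 1 b 0 1"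
    using * by (simp add: horo_mat_def b_def del: fls_divide_X_power)
  ultimately show "cls (g ** horo_mat n s) = cls (g ** horo_mat m r)"
    by (intro cls_eqI[of 1 _ _ "mat22 1 b 0 1"]) (auto simp: matrix_mul_assoc mat_1_mat22[symmetric])
qed

lemma adj_horo_mat_up:
  assumes g: "g \<in> GL2 UNIV"
  shows "adj (cls (g ** horo_mat n s)) (cls (g ** horo_mat (Suc n) s))"
proof -
  have "g ** horo_mat (Suc n) s = g ** horo_mat n s ** mat22 fls_X (fls_const 0) 0 1"
    by (simp add: horo_mat_def flip: matrix_mul_assoc) (simp add: mult.commute)
  then show ?thesis
    unfolding adj_cls_iff[OF GL2_mult[OF subring_UNIV g horo_mat_in_GL2]] by metis
qed

text \<open>
  A ball has one neighbour containing it and \<open>q\<close> neighbours contained in it.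
\<close>

lemma adj_horo_mat_cases:
  assumes g: "g \<in> GL2 UNIV" and adj: "adj (cls (g ** horo_mat (Suc n) s)) z"
  shows "z = cls (g ** horo_mat n s) \<or>
    (\<exists>c. z = cls (g ** horo_mat (Suc (Suc n)) (s + fls_X ^ Suc n * fls_const c)))"
proof -
  consider c where "z = cls (g ** horo_mat (Suc n) s ** mat22 fls_X (fls_const c) 0 1)"
    | "z = cls (g ** horo_mat (Suc n) s ** mat22 1 0 0 fls_X)"
    using adj unfolding adj_cls_iff[OF GL2_mult[OF subring_UNIV g horo_mat_in_GL2]] by blast
  then show ?thesis
  proof cases
    case 1
    moreover have "horo_mat (Suc n) s ** mat22 fls_X (fls_const c) 0 1 = horo_mat (Suc (Suc n)) (s + fls_X ^ Suc n * fls_const c)"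
      by (simp add: horo_mat_def algebra_simps)
    ultimately show ?thesis by (metis matrix_mul_assoc)
  next
    case 2
    have "horo_mat (Suc n) s ** mat22 1 0 0 fls_X = mat22 fls_X 0 0 fls_X ** horo_mat n s"
      by (simp add: horo_mat_def algebra_simps)
    then have "g ** horo_mat (Suc n) s ** mat22 1 0 0 fls_X = mat22 fls_X 0 0 fls_X ** (g ** horo_mat n s)"
      by (metis matrix_mul_assoc scalar_commute)
    then show ?thesis using 2 by (simp add: cls_scale)
  qed
qed

text \<open>
  A path that starts by shrinking the ball must shrink it at every step, since the only neighbour containing the
  current ball is the one just left. So after \<open>N\<close> further steps it has reached a ball of index \<open>N + 1\<close> inside
  \<open>\<pi>\<O>\<close>, and every such ball is reached.
\<close>

lemma Desc_eq:
  assumes g: "g \<in> GL2 UNIV"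
  shows "Desc N (cls g) (cls (g ** horo_mat 1 0)) = {cls (g ** horo_mat (N + 1) s) | s. s \<in> pideal 1}"
proof (intro set_eqI iffI)
  have g0: "cls g = cls (g ** horo_mat 0 0)"
    by (simp add: horo_mat_def mat_1_mat22[symmetric])
  fix v
  {
    assume "v \<in> Desc N (cls g) (cls (g ** horo_mat 1 0))"
    then obtain p where p: "v = p (N + 1)" "p 0 = cls g" "p 1 = cls (g ** horo_mat 1 0)"
      "\<And>i. i \<le> N \<Longrightarrow> adj (p i) (p (i + 1))" "\<And>i. i < N \<Longrightarrow> p (i + 2) \<noteq> p i"
      unfolding Desc_def by blast
    \<comment> \<open>The centre of a ball may be moved to any of its points, so one \<open>s\<close> can serve two consecutive balls.\<close>
    have "\<exists>s\<in>pideal 1. p i = cls (g ** horo_mat i s) \<and> p (i + 1) = cls (g ** horo_mat (i + 1) s)" if "i \<le> N" for i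
      using that
    proof (induction i)
      case 0
      then show ?case using p(2,3) g0 by (intro bexI[of _ 0]) auto
    next
      case (Suc i)
      then obtain s where s: "s \<in> pideal 1" "p i = cls (g ** horo_mat i s)" "p (i + 1) = cls (g ** horo_mat (i + 1) s)"
        by auto
      have "adj (cls (g ** horo_mat (Suc i) s)) (p (i + 2))" using p(4)[OF Suc.prems] s(3) by simp
      moreover have "p (i + 2) \<noteq> cls (g ** horo_mat i s)" using p(5)[of i] Suc.prems s(2) by simp
      ultimately obtain c where c: "p (i + 2) = cls (g ** horo_mat (Suc (Suc i)) (s + fls_X ^ Suc i * fls_const c))"
        using adj_horo_mat_cases[OF g] by blast
      have d: "fls_X ^ Suc i * fls_const c \<in> pideal (int (Suc i))"
        by (rule pideal_mult[OF _ const_in_pideal, of _ "int (Suc i)"]) (auto simp: pideal_iff_subdegree simp del: power_Suc)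
      have "p (i + 1) = cls (g ** horo_mat (Suc i) (s + fls_X ^ Suc i * fls_const c))"
        using s(3) d pideal_uminus[OF d] by (simp add: cls_horo_mat_eq_iff[OF g] del: power_Suc)
      moreover have "s + fls_X ^ Suc i * fls_const c \<in> pideal 1"
        using s(1) pideal_mono[OF d, of 1] by (intro pideal_add) auto
      ultimately show ?case using c by (intro bexI[of _ "s + fls_X ^ Suc i * fls_const c"]) auto
    qed
    from this[of N] show "v \<in> {cls (g ** horo_mat (N + 1) s) | s. s \<in> pideal 1}" using p(1) by auto
  next
    assume "v \<in> {cls (g ** horo_mat (N + 1) s) | s. s \<in> pideal 1}"
    then obtain s where s: "s \<in> pideal 1" "v = cls (g ** horo_mat (N + 1) s)" by blast
    let ?p = "\<lambda>i. cls (g ** horo_mat i s)"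
    have "?p 0 = cls g" "?p 1 = cls (g ** horo_mat 1 0)"
      unfolding g0 using s(1) by (auto simp: cls_horo_mat_eq_iff[OF g] intro: pideal_mono)
    moreover have "adj (?p i) (?p (i + 1))" for i using adj_horo_mat_up[OF g] by simp
    moreover have "?p (i + 2) \<noteq> ?p i" for i by (simp add: cls_horo_mat_eq_iff[OF g])
    ultimately show "v \<in> Desc N (cls g) (cls (g ** horo_mat 1 0))"
      unfolding Desc_def s(2) by (intro CollectI exI[of _ ?p]) auto
  }
qed

section \<open>Heights\<close>

text \<open>
  The class of this matrix is the vertex \<^term>\<open>vv n\<close> of the ray.
\<close>

definition diag_mat :: "nat \<Rightarrow> 'a :: {finite, field} fls ^ 2 ^ 2" where
  "diag_mat n = mat22 (tt ^ n) 0 0 1"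

lemma subdegree_tt_power: "fls_subdegree ((tt :: 'a::{finite,field} fls) ^ n) = - int n"
  by (simp add: tt_def fls_inverse_X)

lemma tt_neq_0 [simp]: "(tt :: 'a::{finite,field} fls) \<noteq> 0"
  by (simp add: tt_def)

lemma diag_mat_in_GL2: "diag_mat n \<in> GL2 UNIV"
  by (simp add: diag_mat_def mat22_in_GL2_UNIV)

lemma poly_in_UNIV: "\<gamma> \<in> GL2 poly_ring \<Longrightarrow> \<gamma> \<in> GL2 UNIV"
  by (rule GL2_mono[OF subset_UNIV])

text \<open>
  If \<open>n < m\<close>, then, comparing determinants, the scalar that relates the two lattices has negative valuation \<open>(n - m)/2\<close>. The lower row
  \<open>s (c t\<^sup>n, d)\<close> has to be integral, which forces the polynomials \<open>c\<close> and \<open>d\<close> to have positive valuation, that is,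
  to vanish.
\<close>

lemma cls_poly_diag_not_less:
  assumes \<gamma>: "\<gamma> \<in> GL2 poly_ring" and eq: "cls (\<gamma> ** diag_mat n) = cls (diag_mat m)"
  shows "\<not> n < m"
proof
  assume "n < m"
  obtain s \<kappa> where s: "s \<noteq> 0" "\<kappa> \<in> GL2 (pideal 0)" "mat22 s 0 0 s ** (\<gamma> ** diag_mat n) = diag_mat m ** \<kappa>"
    by (rule cls_eq_imp[OF eq]) (intro GL2_mult[OF subring_UNIV] poly_in_UNIV[OF \<gamma>] diag_mat_in_GL2)+
  obtain a b c d where g: "\<gamma> = mat22 a b c d" by (rule mat22_exhaust)
  obtain k11 k12 k21 k22 where k: "\<kappa> = mat22 k11 k12 k21 k22" by (rule mat22_exhaust)
  have eqs: "s * (a * tt ^ n) = tt ^ m * k11" "s * b = tt ^ m * k12" "s * (c * tt ^ n) = k21" "s * d = k22"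
    using s(3) by (auto simp: g k diag_mat_def)
  obtain e where e: "a \<in> poly_ring" "b \<in> poly_ring" "c \<in> poly_ring" "d \<in> poly_ring" "e \<in> poly_ring" "(a * d - b * c) * e = 1"
    using \<gamma> unfolding g mat22_in_GL2_iff[OF subring_poly_ring] by blast
  obtain f where f: "k11 \<in> pideal 0" "k12 \<in> pideal 0" "k21 \<in> pideal 0" "k22 \<in> pideal 0" "f \<in> pideal 0"
      "(k11 * k22 - k12 * k21) * f = 1"
    using s(2) unfolding k mat22_in_GL2_iff[OF subring_pideal] by blast
  define D E where "D = a * d - b * c" and "E = k11 * k22 - k12 * k21"
  have "D \<noteq> 0" "E \<noteq> 0" using e(6) f(6) unfolding D_def E_def by auto
  have "fls_subdegree D = 0"
    by (rule poly_ring_unit_subdegree[OF _ e(5)]) (use e in \<open>auto simp: D_def intro!: poly_ring_diff poly_ring_mult\<close>)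
  moreover have "fls_subdegree E = 0"
    by (rule pideal_unit_subdegree[OF _ f(5)]) (use f in \<open>auto simp: E_def intro!: pideal_diff subringD(4)[OF subring_pideal]\<close>)
  moreover have "s * s * tt ^ n * D = tt ^ m * E"
  proof -
    have "s * s * tt ^ n * D = (s * (a * tt ^ n)) * (s * d) - (s * b) * (s * (c * tt ^ n))"
      by (simp add: D_def algebra_simps)
    also have "\<dots> = tt ^ m * E" unfolding eqs by (simp add: E_def algebra_simps)
    finally show ?thesis .
  qed
  moreover have "fls_subdegree (s * s * tt ^ n * D) = 2 * fls_subdegree s - int n + fls_subdegree D"
    using \<open>D \<noteq> 0\<close> s(1) by (simp add: subdegree_tt_power)
  moreover have "fls_subdegree (tt ^ m * E) = fls_subdegree E - int m"
    using \<open>E \<noteq> 0\<close> by (simp add: subdegree_tt_power)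
  ultimately have "2 * fls_subdegree s = int n - int m" by simp
  then have neg: "fls_subdegree s < 0" using \<open>n < m\<close> by linarith
  have "c = 0"
  proof (rule ccontr)
    assume "c \<noteq> 0"
    then have "fls_subdegree k21 = fls_subdegree s + fls_subdegree c - int n" "k21 \<noteq> 0"
      using s(1) unfolding eqs(3)[symmetric] by (auto simp: subdegree_tt_power)
    then show False using f(3) neg poly_ring_subdegree[OF e(3) \<open>c \<noteq> 0\<close>] by (auto simp: pideal_iff_subdegree)
  qed
  moreover have "d = 0"
  proof (rule ccontr)
    assume "d \<noteq> 0"
    then have "fls_subdegree k22 = fls_subdegree s + fls_subdegree d" "k22 \<noteq> 0"
      using s(1) unfolding eqs(4)[symmetric] by auto
    then show False using f(4) neg poly_ring_subdegree[OF e(4) \<open>d \<noteq> 0\<close>] by (auto simp: pideal_iff_subdegree)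
  qed
  ultimately show False using \<open>D \<noteq> 0\<close> by (simp add: D_def)
qed

lemma cls_poly_diag_unique:
  assumes "\<gamma> \<in> GL2 poly_ring" "\<gamma>' \<in> GL2 poly_ring" "cls (\<gamma> ** diag_mat n) = cls (\<gamma>' ** diag_mat m)"
  shows "n = m"
proof -
  have "\<not> n < m" if 1: "\<gamma> \<in> GL2 poly_ring" and 2: "\<gamma>' \<in> GL2 poly_ring"
    and 3: "cls (\<gamma> ** diag_mat n) = cls (\<gamma>' ** diag_mat m)"
    for \<gamma> \<gamma>' :: "'a fls^2^2" and n m
  proof -
    obtain \<delta> where d: "\<delta> \<in> GL2 poly_ring" "\<delta> ** \<gamma>' = mat 1" using GL2_inverse[OF 2] by blast
    have "vact \<delta> (cls (\<gamma> ** diag_mat n)) = vact \<delta> (cls (\<gamma>' ** diag_mat m))" using 3 by simp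
    then have "cls ((\<delta> ** \<gamma>) ** diag_mat n) = cls (diag_mat m)"
      by (simp add: vact_cls matrix_mul_assoc d)
    then show ?thesis using cls_poly_diag_not_less GL2_mult[OF subring_poly_ring d(1) 1] by blast
  qed
  from this[OF assms] this[OF assms(2,1) assms(3)[symmetric]] show ?thesis by simp
qed

text \<open>
  The conclusion of reduction theory for a single vertex, isolated so that it can be transported along row and
  column operations.
\<close>

definition reducible_to_ray :: "'a :: {finite, field} fls ^ 2 ^ 2 \<Rightarrow> bool" where
  "reducible_to_ray g \<longleftrightarrow> (\<exists>\<gamma>\<in>GL2 poly_ring. \<exists>n. cls g = cls (\<gamma> ** diag_mat n))"

lemma reducible_to_ray_left:
  assumes "reducible_to_ray (\<gamma> ** g)" "\<gamma> \<in> GL2 poly_ring"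
  shows "reducible_to_ray g"
proof -
  obtain \<gamma>' n where *: "\<gamma>' \<in> GL2 poly_ring" "cls (\<gamma> ** g) = cls (\<gamma>' ** diag_mat n)"
    using assms(1) unfolding reducible_to_ray_def by blast
  obtain \<delta> where d: "\<delta> \<in> GL2 poly_ring" "\<delta> ** \<gamma> = mat 1" using GL2_inverse[OF assms(2)] by blast
  have "vact \<delta> (cls (\<gamma> ** g)) = vact \<delta> (cls (\<gamma>' ** diag_mat n))" using * by simp
  then have "cls g = cls ((\<delta> ** \<gamma>') ** diag_mat n)" by (simp add: vact_cls matrix_mul_assoc d)
  then show ?thesis unfolding reducible_to_ray_def using GL2_mult[OF subring_poly_ring d(1) *(1)] by blast
qed

lemma reducible_to_ray_cong: "cls g = cls h \<Longrightarrow> reducible_to_ray g \<longleftrightarrow> reducible_to_ray h"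
  by (simp add: reducible_to_ray_def)

text \<open>
  The power of \<open>t\<close> in \<open>x\<close> may have the wrong sign; swapping the two coordinates corrects it.
\<close>

lemma reducible_diagonal:
  assumes "x \<noteq> 0"
  shows "reducible_to_ray (mat22 x 0 0 1)"
proof -
  define k where "k = fls_subdegree x"
  define u where "u = x / fls_X powi k"
  have x: "x = fls_X powi k * u" by (simp add: u_def)
  have u0: "u \<noteq> 0" using assms by (simp add: u_def)
  have uO: "u \<in> pideal 0" unfolding u_def by (rule pideal_divide[of _ k]) (auto simp: k_def pideal_iff_subdegree)
  have "fls_subdegree u = 0"
    using arg_cong[OF x, of fls_subdegree] u0 by (simp add: k_def)
  then have "inverse u \<in> pideal 0" using u0 by (simp add: pideal_iff_subdegree)
  then have U: "mat22 u 0 0 1 \<in> GL2 (pideal 0)"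
    using uO u0 by (auto simp: mat22_in_GL2_iff[OF subring_pideal] one_in_pideal intro!: bexI[of _ "inverse u"])
  have "cls (mat22 x 0 0 1) = cls (mat22 (fls_X powi k) 0 0 1)"
    by (rule cls_eqI[of 1 _ _ "mat22 u 0 0 1"]) (use x U in auto)
  moreover have "reducible_to_ray (mat22 (fls_X powi k) 0 0 (1 :: 'a fls))"
  proof (cases "k \<le> 0")
    case True
    then have "tt ^ nat (- k) = (fls_X powi k :: 'a fls)"
      using tt_powi[of "- k", where 'a = 'a] by (simp add: power_int_def[of tt] del: fls_X_power_int)
    then show ?thesis unfolding reducible_to_ray_def diag_mat_def
      using GL2_one[OF subring_poly_ring] by (metis matrix_mul_lid)
  next
    case False
    then have t: "tt ^ nat k * (fls_X powi k :: 'a fls) = 1"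
      using tt_powi[of k, where 'a = 'a]
      by (simp add: power_int_def[of tt] power_int_minus del: fls_X_power_int)
    have "mat22 (tt ^ nat k) 0 0 (tt ^ nat k) ** mat22 (fls_X powi k) 0 0 (1 :: 'a fls)
        = (mat22 0 1 1 0 ** diag_mat (nat k)) ** mat22 0 1 1 0"
      using t by (simp add: diag_mat_def del: fls_X_power_int)
    then have "cls (mat22 (fls_X powi k) 0 0 (1 :: 'a fls)) = cls (mat22 0 1 1 0 ** diag_mat (nat k))"
      by (rule cls_eqI) (auto intro: swap_in_GL2 subring_pideal)
    then show ?thesis unfolding reducible_to_ray_def
      using swap_in_GL2[OF subring_poly_ring] by blast
  qed
  ultimately show ?thesis using reducible_to_ray_cong by blast
qed

text \<open>
  Euclid's algorithm in matrix form. Row operations over \<open>\<F>\<^sub>q[t]\<close> remove the polynomial part of \<open>y\<close>. If what remains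
  is divisible by \<open>x\<close>, a column operation clears it; otherwise swapping the rows gives a matrix of the same shape
  in which the valuation of \<open>x\<close> has dropped by twice the (positive) valuation of the remainder.
\<close>

lemma reducible_upper:
  assumes "x \<noteq> 0"
  shows "reducible_to_ray (mat22 x y 0 1)"
  using assms
proof (induction "nat (fls_subdegree x)" arbitrary: x y rule: less_induct)
  case less
  obtain p where p: "p \<in> poly_ring" "y - p \<in> pideal 1" using ex_poly_part by blast
  let ?z = "y - p"
  have "reducible_to_ray (mat22 x ?z 0 1)"
  proof (cases "?z \<in> pideal (fls_subdegree x)")
    case True
    then have "?z / x \<in> pideal 0" by (rule pideal_divide) (use less.prems in auto)
    then have "cls (mat22 x ?z 0 1) = cls (mat22 x 0 0 1)"
      by (intro cls_eqI[of 1 _ _ "mat22 1 (?z / x) 0 1"] unipotent_in_GL2[OF subring_pideal])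
        (use less.prems in auto)
    then show ?thesis using reducible_diagonal[OF less.prems] reducible_to_ray_cong by blast
  next
    case False
    then have z: "?z \<noteq> 0" "1 \<le> fls_subdegree ?z" "fls_subdegree ?z < fls_subdegree x"
      using p(2) by (auto simp: pideal_iff_subdegree)
    \<comment> \<open>The upper left entry after swapping rows, clearing the lower left entry and dividing by \<open>?z\<close>.\<close>
    define x' where "x' = - x / (?z * ?z)"
    have "x' \<noteq> 0" using less.prems z by (simp add: x'_def)
    moreover have "- x = x' * (?z * ?z)" using z(1) by (simp add: x'_def)
    then have "fls_subdegree x = fls_subdegree x' + 2 * fls_subdegree ?z"
      using z(1) \<open>x' \<noteq> 0\<close> by (metis (no_types, lifting) fls_subdegree_mult fls_uminus_subdegree mult_2 mult_eq_0_iff)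
    then have "nat (fls_subdegree x') < nat (fls_subdegree x)" using z by linarith
    ultimately have red: "reducible_to_ray (mat22 x' (1 / ?z) 0 1)" using less.hyps by blast
    have "x / ?z \<in> pideal 0"
      by (rule pideal_divide[of _ "fls_subdegree x"]) (use z in \<open>auto simp: pideal_iff_subdegree\<close>)
    then have "- (x / ?z) \<in> pideal 0" by (rule pideal_uminus)
    then have "cls (mat22 x' (1 / ?z) 0 1) = cls (mat22 0 1 1 0 ** mat22 x ?z 0 1)"
      by (intro cls_eqI[of ?z _ _ "mat22 1 0 (- (x / ?z)) 1"] lower_unipotent_in_GL2[OF subring_pideal])
        (use z in \<open>auto simp: x'_def\<close>)
    then have "reducible_to_ray (mat22 0 1 1 0 ** mat22 x ?z 0 1)"
      using red reducible_to_ray_cong by blast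
    then show ?thesis by (rule reducible_to_ray_left) (rule swap_in_GL2[OF subring_poly_ring])
  qed
  moreover have "mat22 x ?z 0 1 = mat22 1 (- p) 0 1 ** mat22 x y 0 1" by simp
  ultimately show ?case
    using reducible_to_ray_left unipotent_in_GL2[OF subring_poly_ring poly_ring_uminus[OF p(1)]] by metis
qed

text \<open>
  Column operations make any matrix upper triangular with lower right entry \<open>1\<close>, up to homothety.
\<close>

lemma reducible_GL2:
  assumes "g \<in> GL2 UNIV"
  shows "reducible_to_ray g"
proof -
  have upper: "reducible_to_ray (mat22 a b 0 d)" if "a \<noteq> 0" "d \<noteq> 0" for a b d :: "'a fls"
  proof -
    have "cls (mat22 (a / d) (b / d) 0 1) = cls (mat22 a b 0 d)"
      by (rule cls_eqI[of d _ _ "mat 1"]) (use that GL2_one[OF subring_pideal] in auto)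
    from reducible_to_ray_cong[OF this] show ?thesis
      using reducible_upper[of "a / d" "b / d"] that by simp
  qed
  have main: "reducible_to_ray (mat22 a b c d)"
    if "a * d - b * c \<noteq> 0" "d \<noteq> 0" "c \<in> pideal (fls_subdegree d)" for a b c d :: "'a fls"
  proof -
    have "c / d \<in> pideal 0" by (rule pideal_divide[OF that(3)]) (use that in auto)
    then have "- (c / d) \<in> pideal 0" by (rule pideal_uminus)
    then have "cls (mat22 (a - b * c / d) b 0 d) = cls (mat22 a b c d)"
      by (intro cls_eqI[of 1 _ _ "mat22 1 0 (- (c / d)) 1"] lower_unipotent_in_GL2[OF subring_pideal])
        (use that in auto)
    moreover have "a - b * c / d \<noteq> 0" using that by (auto simp: field_simps)
    ultimately show ?thesis
      using upper[of "a - b * c / d" d b] that by (simp add: reducible_to_ray_def)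
  qed
  obtain a b c d where g: "g = mat22 a b c d" by (rule mat22_exhaust)
  have nz: "a * d - b * c \<noteq> 0" using assms unfolding g mat22_in_GL2_UNIV .
  show ?thesis
  proof (cases "d \<noteq> 0 \<and> c \<in> pideal (fls_subdegree d)")
    case True
    then show ?thesis using main nz g by blast
  next
    case False
    then have "c \<noteq> 0" "d \<in> pideal (fls_subdegree c)" using nz by (auto simp: pideal_iff_subdegree)
    moreover have "b * c - a * d \<noteq> 0" using nz by auto
    ultimately have "reducible_to_ray (mat22 b a d c)" by (intro main) auto
    moreover have "cls (mat22 b a d c) = cls g" unfolding g
      by (rule cls_eqI[of 1 _ _ "mat22 0 1 1 0"]) (auto intro: swap_in_GL2 subring_pideal)
    ultimately show ?thesis using reducible_to_ray_cong by blast
  qed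
qed

text \<open>
  Uniqueness of the point of the ray makes the description defining the height meaningful.
\<close>

lemma height_eqI:
  assumes "\<gamma> \<in> GL2 poly_ring" "v = cls (\<gamma> ** diag_mat n)"
  shows "height v = n"
  unfolding height_def GL2_poly_eq vv_eq diag_mat_def[symmetric] vact_cls
proof (rule the_equality)
  show "\<exists>\<gamma>\<in>GL2 poly_ring. v = cls (\<gamma> ** diag_mat n)" using assms by blast
next
  fix m assume "\<exists>\<gamma>\<in>GL2 poly_ring. v = cls (\<gamma> ** diag_mat m)"
  then show "m = n" using cls_poly_diag_unique assms by blast
qed

lemma obtain_height:
  assumes "g \<in> GL2 UNIV"
  obtains \<gamma> where "\<gamma> \<in> GL2 poly_ring" "cls g = cls (\<gamma> ** diag_mat (height (cls g)))"
  using reducible_GL2[OF assms] height_eqI unfolding reducible_to_ray_def by metis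

lemma height_poly_invariant:
  assumes "\<gamma> \<in> GL2 poly_ring" "g \<in> GL2 UNIV"
  shows "height (cls (\<gamma> ** g)) = height (cls g)"
proof -
  obtain \<delta> where d: "\<delta> \<in> GL2 poly_ring" "cls g = cls (\<delta> ** diag_mat (height (cls g)))"
    by (rule obtain_height[OF assms(2)])
  have "cls (\<gamma> ** g) = vact \<gamma> (cls g)" by (simp add: vact_cls)
  also have "\<dots> = cls ((\<gamma> ** \<delta>) ** diag_mat (height (cls g)))"
    using d(2) by (metis vact_cls matrix_mul_assoc)
  finally show ?thesis using height_eqI GL2_mult[OF subring_poly_ring assms(1) d(1)] by blast
qed

section \<open>The forward distribution\<close>

text \<open>
  The balls of index \<open>n\<close> inside \<open>\<pi>\<O>\<close>, seen as vertices. The type token names the field, as in the definition of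
  the forward masses.
\<close>

definition horo_vertices :: "'a :: {finite, field} itself \<Rightarrow> nat \<Rightarrow> ('a fls ^ 2) set set set" where
  "horo_vertices _ n = {cls (horo_mat n s) | s. s \<in> pideal 1}"

lemma diag_mat_0: "diag_mat 0 = mat 1"
  by (simp add: diag_mat_def mat_1_mat22)

text \<open>
  A vertex of height \<open>0\<close> is a translate of \<open>[\<O>\<^sup>2]\<close>, and the stabilizer of \<open>[\<O>\<^sup>2]\<close> contains \<open>GL\<^sub>2(\<F>\<^sub>q)\<close>, which
  permutes its \<open>q + 1\<close> neighbours transitively. So all edges in this state are equivalent.
\<close>

lemma fwd_state_1_cases:
  assumes "fwd_state 1 z z'"
  obtains \<gamma> where "\<gamma> \<in> GL2 poly_ring" "z = cls \<gamma>" "z' = cls (\<gamma> ** horo_mat 1 0)"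
proof -
  have adj: "adj z z'" and h: "height z = 0" using assms by (auto simp: fwd_state_def)
  then obtain g where "g \<in> GL2 UNIV" "z = cls g" unfolding adj_def vertices_eq by blast
  then obtain \<gamma> where g: "\<gamma> \<in> GL2 poly_ring" "z = cls \<gamma>"
    using obtain_height h by (metis diag_mat_0 matrix_mul_rid)
  have "(\<exists>c. z' = cls (\<gamma> ** mat22 fls_X (fls_const c) 0 1)) \<or> z' = cls (\<gamma> ** mat22 1 0 0 fls_X)"
    using adj adj_cls_iff[OF poly_in_UNIV[OF g(1)]] g(2) by blast
  then show ?thesis
  proof (elim disjE exE)
    fix c assume z': "z' = cls (\<gamma> ** mat22 fls_X (fls_const c) 0 1)"
    let ?u = "mat22 1 (fls_const c) 0 1"
    have "cls (\<gamma> ** ?u) = cls \<gamma>"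
      by (rule cls_eqI[of 1 _ _ ?u]) (auto simp: mat_1_mat22[symmetric] intro: unipotent_in_GL2 subring_pideal const_in_pideal)
    moreover have "mat22 fls_X (fls_const c) 0 1 = ?u ** horo_mat 1 0" by (simp add: horo_mat_def)
    ultimately show thesis
      using that[of "\<gamma> ** ?u"] g z' GL2_mult[OF subring_poly_ring g(1) unipotent_in_GL2[OF subring_poly_ring poly_ring_const]]
      by (simp add: matrix_mul_assoc)
  next
    assume z': "z' = cls (\<gamma> ** mat22 1 0 0 fls_X)"
    let ?w = "mat22 0 1 1 0 :: 'a fls^2^2"
    have w: "?w \<in> GL2 (pideal 0)" by (rule swap_in_GL2[OF subring_pideal])
    have "cls (\<gamma> ** ?w) = cls \<gamma>"
      by (rule cls_eqI[of 1 _ _ ?w]) (auto simp: mat_1_mat22[symmetric] w)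
    moreover have "cls (\<gamma> ** mat22 1 0 0 fls_X) = cls (\<gamma> ** ?w ** horo_mat 1 0)"
      by (rule cls_eqI[of 1 _ _ ?w]) (auto simp: mat_1_mat22[symmetric] w horo_mat_def simp flip: matrix_mul_assoc)
    ultimately show thesis
      using that[of "\<gamma> ** ?w"] g z' GL2_mult[OF subring_poly_ring g(1) swap_in_GL2[OF subring_poly_ring]] by simp
  qed
qed

text \<open>
  The description defining the forward mass is vacuous unless some edge is in the state.
\<close>

lemma fwd_state_1_base: "fwd_state 1 (cls (mat 1)) (cls (horo_mat 1 0) :: ('a::{finite,field} fls^2) set set)"
proof -
  have "cls (horo_mat 1 0 :: 'a fls^2^2) = cls (mat22 0 1 1 0 ** diag_mat 1)"
    by (rule cls_eqI[of tt _ _ "mat22 0 1 1 0"])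
      (auto simp: horo_mat_def diag_mat_def tt_def intro: swap_in_GL2 subring_pideal)
  then have "height (cls (horo_mat 1 0 :: 'a fls^2^2)) = 1"
    by (intro height_eqI) (auto intro: swap_in_GL2 subring_poly_ring)
  moreover have "height (cls (mat 1 :: 'a fls^2^2)) = 0"
    by (rule height_eqI[OF GL2_one[OF subring_poly_ring]]) (simp add: diag_mat_0)
  moreover have "adj (cls (mat 1 ** horo_mat 0 0 :: 'a fls^2^2)) (cls (mat 1 ** horo_mat (Suc 0) 0))"
    by (rule adj_horo_mat_up[OF GL2_one[OF subring_UNIV]])
  ultimately show ?thesis by (simp add: fwd_state_def horo_mat_def mat_1_mat22[symmetric])
qed

text \<open>
  The descendants of any edge in this state are a translate of the descendants of the base edge by an element that
  preserves heights.
\<close>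

lemma mu_fwd_mass_1:
  "mu_fwd_mass TYPE('a::{finite,field}) 1 N j =
     real (card {v \<in> horo_vertices TYPE('a) (N + 1). height v = j}) / real CARD('a) ^ N"
proof -
  have card: "card {v \<in> Desc N z z'. height v = j} = card {v \<in> horo_vertices TYPE('a) (N + 1). height v = j}"
    if fwd: "fwd_state 1 z z'" for z z' :: "('a fls^2) set set"
  proof -
    obtain \<gamma> where g: "\<gamma> \<in> GL2 poly_ring" "z = cls \<gamma>" "z' = cls (\<gamma> ** horo_mat 1 0)"
      using fwd_state_1_cases[OF fwd] by blast
    obtain \<delta> where d: "\<delta> ** \<gamma> = mat 1" using GL2_inverse[OF g(1)] by blast
    have "vact \<delta> (vact \<gamma> v) = v" for v
      by (simp add: vact_def image_image matrix_vector_mul_assoc d)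
    then have inj: "inj (vact \<gamma>)" by (metis injI)
    have "Desc N z z' = vact \<gamma> ` horo_vertices TYPE('a) (N + 1)"
      unfolding g(2,3) Desc_eq[OF poly_in_UNIV[OF g(1)]] horo_vertices_def
      by (simp add: setcompr_eq_image image_image vact_cls)
    moreover have "height (vact \<gamma> v) = height v" if "v \<in> horo_vertices TYPE('a) (N + 1)" for v
      using that height_poly_invariant[OF g(1) horo_mat_in_GL2] unfolding horo_vertices_def by (auto simp: vact_cls)
    ultimately have "{v \<in> Desc N z z'. height v = j} = vact \<gamma> ` {v \<in> horo_vertices TYPE('a) (N + 1). height v = j}"
      by auto
    then show ?thesis using inj by (simp add: card_image inj_on_subset[OF inj])
  qed
  show ?thesis unfolding mu_fwd_mass_def
  proof (rule the_equality)
    show "\<forall>z z' :: ('a fls^2) set set. fwd_state 1 z z' \<longrightarrow>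
        real (card {v \<in> horo_vertices TYPE('a) (N + 1). height v = j}) / real CARD('a) ^ N =
        real (card {v \<in> Desc N z z'. height v = j}) / real CARD('a) ^ N"
      using card by simp
  next
    fix r assume r: "\<forall>z z' :: ('a fls^2) set set. fwd_state 1 z z' \<longrightarrow>
        r = real (card {v \<in> Desc N z z'. height v = j}) / real CARD('a) ^ N"
    then show "r = real (card {v \<in> horo_vertices TYPE('a) (N + 1). height v = j}) / real CARD('a) ^ N"
      using r[rule_format, OF fwd_state_1_base] card[OF fwd_state_1_base] by simp
  qed
qed

section \<open>Haar measure\<close>

lemma card_field_gt_1: "1 < CARD('a :: {finite, field})"
proof -
  have "card {0, 1 :: 'a} \<le> CARD('a)" by (rule card_mono) auto
  then show ?thesis by simp
qed

lemma pball_Int: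
  assumes "k \<le> l"
  shows "pball a k \<inter> pball b l = {} \<or> pball a k \<inter> pball b l = pball b l"
proof (cases "pball a k \<inter> pball b l = {}")
  case False
  then obtain x where x: "x \<in> pball a k" "x \<in> pball b l" by blast
  then have "pball b l \<subseteq> pball a k" using pball_mono[OF assms] pball_eq by metis
  then show ?thesis by blast
qed simp

lemma sets_borel_fls:
  "sets (borel :: 'a::{finite,field} fls measure) = sigma_sets UNIV {pball a k | a k. l \<le> k}"
proof -
  have "sigma_sets UNIV {S. open S} = sigma_sets UNIV {pball a k | (a :: 'a fls) k. l \<le> k}"
  proof (rule sigma_sets_eqI)
    fix S :: "'a fls set" assume "S \<in> {S. open S}"
    then obtain C where "countable C" "C \<subseteq> {pball a k | a k. l \<le> k}" "S = \<Union>C"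
      using open_eq_Union_pballs[of S l] by blast
    then show "S \<in> sigma_sets UNIV {pball a k | a k. l \<le> k}"
      by (auto intro!: sigma_sets_UNION)
  qed (auto intro!: sigma_sets.Basic open_pball)
  then show ?thesis by (simp add: borel_def)
qed

lemma pball_in_borel [measurable, simp]: "pball a k \<in> sets borel"
  by (simp add: open_pball borel_open)

lemma pball_vimage_plus: "(\<lambda>x. s + x) -` pball a k = pball (a - s) k"
  by (auto simp: pball_def algebra_simps)

lemma measurable_plus_fls [measurable]:
  "(\<lambda>x :: 'a::{finite,field} fls. s + x) \<in> borel_measurable borel"
  by (rule measurable_sigma_sets[OF sets_borel_fls[of 0]]) (auto simp: pball_vimage_plus)

text \<open>
  Two balls are nested or disjoint, so the balls form, with the empty set, a generating family stable under
  intersection; countably many balls of index \<open>0\<close> cover \<open>F\<close>.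
\<close>

lemma measure_eqI_pballs:
  fixes M N :: "'a::{finite,field} fls measure"
  assumes sets: "sets M = sets borel" "sets N = sets borel"
    and M: "\<And>a k. 0 \<le> k \<Longrightarrow> emeasure M (pball a k) = f k"
    and N: "\<And>a k. 0 \<le> k \<Longrightarrow> emeasure N (pball a k) = f k"
    and fin: "f 0 \<noteq> \<infinity>"
  shows "M = N"
proof -
  let ?E = "insert {} {pball a k | (a :: 'a fls) k. 0 \<le> k}"
  \<comment> \<open>The balls of index \<open>0\<close> are centred at the polynomials divisible by \<open>t\<close>.\<close>
  let ?A = "\<lambda>i. pball (fls_X powi (- 1) * from_nat_into poly_ring i :: 'a fls) 0"
  have E: "sigma_sets UNIV ?E = sigma_sets UNIV {pball a k | (a :: 'a fls) k. 0 \<le> k}"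
    by (rule sigma_sets_eqI) (auto intro: sigma_sets.intros)
  show ?thesis
  proof (rule measure_eqI_generator_eq[where E = ?E and \<Omega> = UNIV and A = ?A])
    show "Int_stable ?E"
    proof (rule Int_stableI)
      fix A B assume AB: "A \<in> ?E" "B \<in> ?E"
      then consider "A = {} \<or> B = {}" | a k b l where "A = pball a k" "B = pball b l" "0 \<le> k" "0 \<le> l"
        by blast
      then show "A \<inter> B \<in> ?E"
      proof cases
        case 2
        then have "A \<inter> B = {} \<or> A \<inter> B = A \<or> A \<inter> B = B"
          using pball_Int[of k l a b] pball_Int[of l k b a] by (cases "k \<le> l") (auto simp: Int_commute)
        then show ?thesis using AB by (elim disjE) simp_all
      qed auto
    qed
    show "emeasure M X = emeasure N X" if "X \<in> ?E" for X
      using that M N by auto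
    show "sets M = sigma_sets UNIV ?E" "sets N = sigma_sets UNIV ?E"
      using sets unfolding E sets_borel_fls[of 0] by auto
    show "(\<Union>i. ?A i) = UNIV"
    proof (intro set_eqI iffI)
      fix x :: "'a fls"
      obtain p :: "'a fls" where p: "p \<in> poly_ring" "pball x 0 = pball (fls_X powi (0 - 1) * p) 0"
        by (rule pball_centre)
      then obtain i where "from_nat_into poly_ring i = p"
        using from_nat_into_surj[OF countable_poly_ring] by blast
      then show "x \<in> (\<Union>i. ?A i)" using p(2) pball_self[of x 0] by (auto intro!: exI[of _ i])
    qed simp
    show "emeasure M (?A i) \<noteq> \<infinity>" for i using M fin by simp
  qed auto
qed

text \<open>A ball splits into \<open>q\<close> balls of the next radius.\<close>

text \<open>
  The pieces are indexed by the coefficient of \<open>\<pi>\<^sup>k\<close>.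
\<close>

lemma pball_split:
  "pball a k = (\<Union>c. pball (a + fls_const c * fls_X powi k) (k + 1))"
proof (intro set_eqI iffI)
  fix x assume x: "x \<in> pball a k"
  have "fls_nth (x - (a + fls_const (fls_nth (x - a) k) * fls_X powi k)) n = 0" if "n < k + 1" for n
    using that x by (cases "n = k") (auto simp: pball_def pideal_def)
  then have "x \<in> pball (a + fls_const (fls_nth (x - a) k) * fls_X powi k) (k + 1)"
    unfolding pball_def pideal_def by blast
  then show "x \<in> (\<Union>c. pball (a + fls_const c * fls_X powi k) (k + 1))" by blast
next
  fix x assume "x \<in> (\<Union>c. pball (a + fls_const c * fls_X powi k) (k + 1))"
  then obtain c where c: "x - (a + fls_const c * fls_X powi k) \<in> pideal (k + 1)"
    by (auto simp: pball_def)
  have "fls_nth (x - a) n = 0" if "n < k" for n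
    using pidealD[OF c, of n] that by simp
  then show "x \<in> pball a k" by (simp add: pball_def pideal_def)
qed

lemma pball_split_disjoint:
  "disjoint_family (\<lambda>c. pball (a + fls_const c * fls_X powi k) (k + 1))"
proof (unfold disjoint_family_on_def, intro ballI impI)
  fix c d :: 'a assume "c \<noteq> d"
  show "pball (a + fls_const c * fls_X powi k) (k + 1) \<inter> pball (a + fls_const d * fls_X powi k) (k + 1) = {}"
  proof (rule ccontr)
    assume "\<not> ?thesis"
    then obtain x where x: "x - (a + fls_const c * fls_X powi k) \<in> pideal (k + 1)"
      "x - (a + fls_const d * fls_X powi k) \<in> pideal (k + 1)" by (auto simp: pball_def)
    have "fls_nth (x - a) k - c = 0" "fls_nth (x - a) k - d = 0"
      using pidealD[OF x(1), of k] pidealD[OF x(2), of k] by simp_all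
    then show False using \<open>c \<noteq> d\<close> by simp
  qed
qed

text \<open>
  The self-similarity \<open>f k = q f (k + 1)\<close> determines a geometric sequence from one term. It is used for the masses of
  balls in \<open>F\<close> and of their images in an orbit; in an orbit it holds only for \<open>k \<ge> 1\<close>, whence the bound \<open>l\<close>.
\<close>

lemma ball_mass_up:
  assumes "\<And>k. l \<le> k \<Longrightarrow> f k = ennreal (real CARD('a::{finite,field})) * f (k + 1)"
    and "f l = ennreal (real CARD('a) powi (c - l))" and "l \<le> k"
  shows "f k = ennreal (real CARD('a) powi (c - k))"
  using \<open>l \<le> k\<close>
proof (induction k rule: int_ge_induct)
  case base
  show ?case by (rule assms)
next
  case (step k)
  have q: "real CARD('a) \<noteq> 0" by simp
  have "ennreal (real CARD('a)) * f (k + 1) = ennreal (real CARD('a) powi (c - k))"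
    using assms(1)[OF step.hyps] step.IH by simp
  also have "c - k = 1 + (c - (k + 1))" by simp
  also have "real CARD('a) powi (1 + (c - (k + 1))) = real CARD('a) * real CARD('a) powi (c - (k + 1))"
    using q by (subst power_int_add) auto
  finally have "ennreal (real CARD('a)) * f (k + 1) = ennreal (real CARD('a)) * ennreal (real CARD('a) powi (c - (k + 1)))"
    by (simp add: ennreal_mult)
  then show ?case using ennreal_mult_cancel_left by (metis ennreal_neq_top ennreal_eq_0_iff of_nat_0_less_iff zero_less_card_finite not_less)
qed

lemma ball_mass_down:
  assumes "\<And>k. f k = ennreal (real CARD('a::{finite,field})) * f (k + 1)"
    and "f l = ennreal (real CARD('a) powi (c - l))" and "k \<le> l"
  shows "f k = ennreal (real CARD('a) powi (c - k))"
  using \<open>k \<le> l\<close>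
proof (induction k rule: int_le_induct)
  case base
  show ?case by (rule assms)
next
  case (step k)
  have "f (k - 1) = ennreal (real CARD('a)) * ennreal (real CARD('a) powi (c - k))"
    using assms(1)[of "k - 1"] step.IH by simp
  also have "\<dots> = ennreal (real CARD('a) powi (1 + (c - k)))"
    by (subst power_int_add) (auto simp: ennreal_mult)
  finally show ?case by (simp add: algebra_simps)
qed

lemma emeasure_translate:
  fixes M :: "'a::{finite,field} fls measure"
  assumes "sets M = sets borel" "distr M borel (\<lambda>x. s + x) = M" "A \<in> sets borel"
  shows "emeasure M ((\<lambda>x. s + x) -` A) = emeasure M A"
proof -
  have "(\<lambda>x. s + x) \<in> measurable M borel" using measurable_plus_fls measurable_cong_sets[OF assms(1) refl] by blast
  then have "emeasure (distr M borel (\<lambda>x. s + x)) A = emeasure M ((\<lambda>x. s + x) -` A)"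
    using assms(3) sets_eq_imp_space_eq[OF assms(1)] by (simp add: emeasure_distr)
  then show ?thesis using assms(2) by simp
qed

text \<open>
  All balls of one index are translates of each other, and each splits into \<open>q\<close> balls of the next.
\<close>

lemma invariant_measure_pball:
  fixes M :: "'a::{finite,field} fls measure"
  assumes sets: "sets M = sets borel" and inv: "\<And>s. distr M borel (\<lambda>x. s + x) = M"
    and one: "emeasure M (pideal 0) = 1"
  shows "emeasure M (pball a k) = ennreal (real CARD('a) powi (- k))"
proof -
  have trans: "emeasure M (pball a k) = emeasure M (pball 0 k)" for a k
    using emeasure_translate[OF sets inv[of a], of "pball a k"] by (simp add: pball_vimage_plus)
  have step: "emeasure M (pball 0 k) = ennreal (real CARD('a)) * emeasure M (pball 0 (k + 1))" for k
  proof -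
    have "emeasure M (pball 0 k) = (\<Sum>c\<in>UNIV. emeasure M (pball (0 + fls_const c * fls_X powi k :: 'a fls) (k + 1)))"
      unfolding pball_split[of 0 k]
      by (rule sum_emeasure[symmetric, OF _ pball_split_disjoint]) (auto simp: sets)
    also have "\<dots> = (\<Sum>c\<in>(UNIV :: 'a set). emeasure M (pball 0 (k + 1)))"
      by (intro sum.cong refl trans)
    finally show ?thesis by (simp add: ennreal_of_nat_eq_real_of_nat)
  qed
  have base: "emeasure M (pball 0 0) = ennreal (real CARD('a) powi (0 - 0))" using one by (simp add: pball_0)
  have "emeasure M (pball 0 k) = ennreal (real CARD('a) powi (0 - k))"
  proof (cases "0 \<le> k")
    case True
    show ?thesis by (rule ball_mass_up[where f = "\<lambda>k. emeasure M (pball 0 k)", OF step base True])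
  next
    case False
    show ?thesis by (rule ball_mass_down[where f = "\<lambda>k. emeasure M (pball 0 k)", OF step base]) (use False in simp)
  qed
  then show ?thesis using trans[of a k] by simp
qed

definition digit_measure :: "(nat \<Rightarrow> 'a :: {finite, field}) measure" where
  "digit_measure = PiM UNIV (\<lambda>_. measure_pmf (pmf_of_set UNIV))"

definition polar_parts :: "'a :: {finite, field} fls set" where
  "polar_parts = {f. \<forall>n\<ge>0. fls_nth f n = 0}"

text \<open>
  A Laurent series is its polar part plus a power series. Counting measure on the polar parts and independent
  uniform digits for the power series give Haar measure as an image.
\<close>

definition digit_series :: "'a :: {finite, field} fls \<times> (nat \<Rightarrow> 'a) \<Rightarrow> 'a fls" where
  "digit_series = (\<lambda>(p, w). p + fps_to_fls (Abs_fps w))"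

lemma emeasure_digit_cylinder:
  fixes a :: "nat \<Rightarrow> 'a :: {finite, field}"
  shows "{w. \<forall>i\<in>{..<n}. w i \<in> {a i}} \<in> sets digit_measure"
    and "emeasure digit_measure {w. \<forall>i\<in>{..<n}. w i \<in> {a i}} = ennreal (inverse (real CARD('a)) ^ n)"
proof -
  interpret P: product_prob_space "\<lambda>_::nat. measure_pmf (pmf_of_set (UNIV :: 'a set))" UNIV
    by standard
  have sp: "space digit_measure = (UNIV :: (nat \<Rightarrow> 'a) set)"
    by (simp add: digit_measure_def space_PiM)
  have "{w \<in> space digit_measure. \<forall>i\<in>{..<n}. w i \<in> {a i}} \<in> sets digit_measure"
    unfolding digit_measure_def by measurable
  then show "{w. \<forall>i\<in>{..<n}. w i \<in> {a i}} \<in> sets digit_measure" by (simp add: sp)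
  have "emeasure digit_measure {w \<in> space digit_measure. \<forall>i\<in>{..<n}. w i \<in> {a i}}
      = (\<Prod>i<n. emeasure (measure_pmf (pmf_of_set UNIV)) {a i})"
    unfolding digit_measure_def by (rule P.emeasure_PiM_Collect) auto
  also have "\<dots> = (\<Prod>i<n. ennreal (inverse (real CARD('a))))"
    by (simp add: emeasure_pmf_single inverse_eq_divide)
  also have "\<dots> = ennreal (inverse (real CARD('a)) ^ n)"
    by (simp add: ennreal_power)
  finally show "emeasure digit_measure {w. \<forall>i\<in>{..<n}. w i \<in> {a i}} = ennreal (inverse (real CARD('a)) ^ n)"
    by (simp add: sp)
qed

text \<open>
  A ball of index \<open>k \<ge> 0\<close> prescribes the polar part and the first \<open>k\<close> digits, and nothing else.
\<close>

lemma digit_series_vimage: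
  fixes a :: "'a::{finite,field} fls"
  assumes "0 \<le> k"
  obtains p where "p \<in> polar_parts"
    "digit_series -` pball a k \<inter> (polar_parts \<times> UNIV) = {p} \<times> {w. \<forall>i\<in>{..<nat k}. w i \<in> {fls_nth a (int i)}}"
proof -
  define p where "p = Abs_fls (\<lambda>n. if n < 0 then fls_nth a n else 0)"
  have p: "fls_nth p n = (if n < 0 then fls_nth a n else 0)" for n
    unfolding p_def
    by (rule nth_Abs_fls_lower_bound[of "min 0 (fls_subdegree a)"]) auto
  have "digit_series (r, w) \<in> pball a k \<longleftrightarrow> r = p \<and> (\<forall>i<nat k. w i = fls_nth a (int i))"
    if r: "r \<in> polar_parts" for r w
  proof
    assume "digit_series (r, w) \<in> pball a k"
    then have *: "fls_nth r n + (if n < 0 then 0 else w (nat n)) - fls_nth a n = 0" if "n < k" for n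
      using pidealD[OF _ that, of "digit_series (r, w) - a"] \<open>digit_series (r, w) \<in> pball a k\<close>
      by (cases "n < 0") (simp_all add: digit_series_def pball_def)
    have "r = p"
    proof (rule fls_eqI)
      fix n show "fls_nth r n = fls_nth p n"
        using r *[of n] assms by (cases "n < 0") (auto simp: p polar_parts_def)
    qed
    moreover have "w i = fls_nth a (int i)" if "i < nat k" for i
      using *[of "int i"] that r by (simp add: polar_parts_def)
    ultimately show "r = p \<and> (\<forall>i<nat k. w i = fls_nth a (int i))" by blast
  next
    assume *: "r = p \<and> (\<forall>i<nat k. w i = fls_nth a (int i))"
    show "digit_series (r, w) \<in> pball a k"
      unfolding pball_def pideal_def digit_series_def
    proof (clarsimp simp: *[THEN conjunct1] p)
      fix n assume "n < k" "\<not> n < 0"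
      then show "w (nat n) = fls_nth a n" using *[THEN conjunct2, rule_format, of "nat n"] by simp
    qed
  qed
  then have "digit_series -` pball a k \<inter> (polar_parts \<times> UNIV) = {p} \<times> {w. \<forall>i\<in>{..<nat k}. w i \<in> {fls_nth a (int i)}}"
    if "p \<in> polar_parts" using that by auto
  moreover have "p \<in> polar_parts" by (simp add: polar_parts_def p)
  ultimately show ?thesis using that by blast
qed

definition haar_construction :: "'a :: {finite, field} fls measure" where
  "haar_construction = distr (count_space polar_parts \<Otimes>\<^sub>M digit_measure) borel digit_series"

lemma haar_construction_pball:
  fixes a :: "'a::{finite,field} fls"
  assumes "0 \<le> k"
  shows "emeasure haar_construction (pball a k) = ennreal (inverse (real CARD('a)) ^ nat k)"
proof -
  let ?N = "count_space polar_parts \<Otimes>\<^sub>M digit_measure :: ('a fls \<times> (nat \<Rightarrow> 'a)) measure"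
  interpret P: product_prob_space "\<lambda>_::nat. measure_pmf (pmf_of_set (UNIV :: 'a set))" UNIV
    by standard
  have prob: "prob_space (digit_measure :: (nat \<Rightarrow> 'a) measure)"
    unfolding digit_measure_def by (rule P.P.prob_space_axioms)
  interpret D: prob_space "digit_measure :: (nat \<Rightarrow> 'a) measure" by (rule prob)
  have sp: "space ?N = polar_parts \<times> UNIV"
    by (simp add: space_pair_measure digit_measure_def space_PiM)
  have meas: "digit_series \<in> measurable ?N borel"
  proof (rule measurable_sigma_sets[OF sets_borel_fls[of 0]])
    fix B :: "'a fls set" assume "B \<in> {pball a k | a k. 0 \<le> k}"
    then obtain a k where B: "B = pball a k" "0 \<le> k" by blast
    obtain p where p: "p \<in> polar_parts" "digit_series -` pball a k \<inter> (polar_parts \<times> UNIV) = {p} \<times> {w. \<forall>i\<in>{..<nat k}. w i \<in> {fls_nth a (int i)}}"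
      by (rule digit_series_vimage[OF B(2)])
    show "digit_series -` B \<inter> space ?N \<in> sets ?N"
      unfolding sp B p(2) using p(1) by (intro pair_measureI emeasure_digit_cylinder) simp
  qed auto
  obtain p where p: "p \<in> polar_parts" "digit_series -` pball a k \<inter> (polar_parts \<times> UNIV) = {p} \<times> {w. \<forall>i\<in>{..<nat k}. w i \<in> {fls_nth a (int i)}}"
    by (rule digit_series_vimage[OF assms])
  have "emeasure haar_construction (pball a k) = emeasure ?N (digit_series -` pball a k \<inter> space ?N)"
    unfolding haar_construction_def by (rule emeasure_distr[OF meas]) simp
  also have "\<dots> = emeasure (count_space polar_parts) {p} * emeasure digit_measure {w. \<forall>i\<in>{..<nat k}. w i \<in> {fls_nth a (int i)}}"
    unfolding sp p(2) using p(1) by (intro D.emeasure_pair_measure_Times emeasure_digit_cylinder) simp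
  also have "\<dots> = ennreal (inverse (real CARD('a)) ^ nat k)"
    using p(1) by (simp add: emeasure_digit_cylinder(2)[simplified])
  finally show ?thesis .
qed

text \<open>
  Existence comes from the construction, whose invariance is seen on balls; uniqueness holds because invariance
  determines the masses of all balls.
\<close>

lemma haar_eq: "haar = (haar_construction :: 'a :: {finite, field} fls measure)"
  unfolding haar_def
proof (rule the_equality)
  let ?H = "haar_construction :: 'a fls measure"
  have sets: "sets ?H = sets borel" by (simp add: haar_construction_def)
  have "distr ?H borel (\<lambda>x. s + x) = ?H" for s
  proof (rule measure_eqI_pballs[where f = "\<lambda>k. ennreal (inverse (real CARD('a)) ^ nat k)"])
    fix a :: "'a fls" and k :: int assume k: "0 \<le> k"
    have "(\<lambda>x. s + x) \<in> measurable ?H borel" using measurable_plus_fls measurable_cong_sets[OF sets refl] by blast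
    then show "emeasure (distr ?H borel (\<lambda>x. s + x)) (pball a k) = ennreal (inverse (real CARD('a)) ^ nat k)"
      using sets_eq_imp_space_eq[OF sets] by (simp add: emeasure_distr pball_vimage_plus haar_construction_pball[OF k])
  qed (auto simp: sets haar_construction_pball)
  moreover have "emeasure ?H O_F = 1"
    using haar_construction_pball[of 0 0] by (simp add: O_F_eq_pideal pball_0)
  ultimately show *: "sets ?H = sets borel \<and> (\<forall>s. distr ?H borel (\<lambda>x. s + x) = ?H) \<and> emeasure ?H O_F = 1"
    using sets by blast
  fix M :: "'a fls measure"
  assume M: "sets M = sets borel \<and> (\<forall>s. distr M borel (\<lambda>x. s + x) = M) \<and> emeasure M O_F = 1"
  show "M = ?H"
    by (rule measure_eqI_pballs[where f = "\<lambda>k. ennreal (real CARD('a) powi (- k))"])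
      (use M * in \<open>auto intro!: invariant_measure_pball simp: O_F_eq_pideal\<close>)
qed

lemma sets_haar [measurable_cong]: "sets haar = sets (borel :: 'a :: {finite, field} fls measure)"
  by (simp add: haar_eq haar_construction_def)

lemma haar_invariant: "distr haar borel (\<lambda>x. s + x) = (haar :: 'a :: {finite, field} fls measure)"
proof (rule measure_eqI_pballs[where f = "\<lambda>k. ennreal (inverse (real CARD('a)) ^ nat k)"])
  fix a :: "'a fls" and k :: int assume k: "0 \<le> k"
  have "(\<lambda>x. s + x) \<in> measurable haar borel" using measurable_plus_fls measurable_cong_sets[OF sets_haar refl] by blast
  then show "emeasure (distr haar borel (\<lambda>x. s + x)) (pball a k) = ennreal (inverse (real CARD('a)) ^ nat k)"
    using sets_eq_imp_space_eq[OF sets_haar]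
    by (simp add: emeasure_distr pball_vimage_plus) (simp add: haar_eq haar_construction_pball[OF k])
qed (use sets_haar in \<open>auto simp: haar_construction_pball haar_eq\<close>)

lemma haar_pball: "emeasure haar (pball a k) = ennreal (real CARD('a) powi (- k))"
  for a :: "'a :: {finite, field} fls"
  by (rule invariant_measure_pball[OF sets_haar haar_invariant])
    (use haar_construction_pball[of 0 0] in \<open>simp add: haar_eq pball_0\<close>)

section \<open>Covolumes\<close>

text \<open>
  Each domain is cut into pieces by the translates of the other, and a translation carries the pieces of one onto
  the pieces of the other. Countability of the lattice makes the pieces summable.
\<close>

lemma fundamental_domain_emeasure_eq:
  fixes \<Lambda> :: "'a :: {finite, field} fls set"
  assumes \<Lambda>: "countable \<Lambda>" "\<And>l. l \<in> \<Lambda> \<Longrightarrow> - l \<in> \<Lambda>"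
    and D: "fundamental_domain \<Lambda> D" and E: "fundamental_domain \<Lambda> E"
  shows "emeasure haar D = emeasure haar E"
proof -
  have sD: "D \<in> sets borel" and sE: "E \<in> sets borel" using D E by (auto simp: fundamental_domain_def)
  have sp: "space haar = (UNIV :: 'a fls set)" using sets_eq_imp_space_eq[OF sets_haar] by simp
  have tr: "(\<lambda>x. l + x) -` A \<in> sets haar" if "A \<in> sets borel" for l and A :: "'a fls set"
    using measurable_sets[OF measurable_plus_fls that, of l] by (simp add: sets_haar)
  have tr': "(\<lambda>x. x - l) -` A \<in> sets haar" if "A \<in> sets borel" for l and A :: "'a fls set"
    using tr[OF that, of "- l"] by simp
  let ?F = "\<lambda>l. D \<inter> (\<lambda>x. - l + x) -` E"
  let ?G = "\<lambda>l. (\<lambda>x. l + x) -` D \<inter> E"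
  have F: "?F l \<in> sets haar" "?G l \<in> sets haar" for l
    using sD sE tr tr' by (auto intro!: sets.Int simp: sets_haar)
  have "D = (\<Union>l\<in>\<Lambda>. ?F l)"
    using E unfolding fundamental_domain_def by (auto simp: algebra_simps) metis
  moreover have "disjoint_family_on ?F \<Lambda>"
    using E unfolding fundamental_domain_def disjoint_family_on_def by (auto simp: algebra_simps) blast
  ultimately have "emeasure haar D = (\<integral>\<^sup>+l. emeasure haar (?F l) \<partial>count_space \<Lambda>)"
    using emeasure_UN_countable[of \<Lambda> ?F haar] F(1) \<Lambda>(1) by simp
  also have "\<dots> = (\<integral>\<^sup>+l. emeasure haar (?G l) \<partial>count_space \<Lambda>)"
  proof (rule nn_integral_cong)
    fix l
    have "emeasure haar ((\<lambda>x. l + x) -` ?F l) = emeasure haar (?F l)"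
      by (rule emeasure_translate[OF sets_haar haar_invariant]) (use F(1) in \<open>simp add: sets_haar\<close>)
    moreover have "(\<lambda>x. l + x) -` ?F l = ?G l" by auto
    ultimately show "emeasure haar (?F l) = emeasure haar (?G l)" by simp
  qed
  also have "\<dots> = emeasure haar E"
  proof -
    have "E = (\<Union>l\<in>\<Lambda>. ?G l)"
    proof (intro set_eqI iffI)
      fix x assume "x \<in> E"
      obtain l where "l \<in> \<Lambda>" "x - l \<in> D" using D unfolding fundamental_domain_def by blast
      then show "x \<in> (\<Union>l\<in>\<Lambda>. ?G l)" using \<Lambda>(2) \<open>x \<in> E\<close> by (intro UN_I[of "- l"]) auto
    qed auto
    moreover have "disjoint_family_on ?G \<Lambda>"
    proof (unfold disjoint_family_on_def, intro ballI impI)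
      fix l m assume lm: "l \<in> \<Lambda>" "m \<in> \<Lambda>" "l \<noteq> m"
      have "\<not> (l + x \<in> D \<and> m + x \<in> D)" for x
      proof
        assume "l + x \<in> D \<and> m + x \<in> D"
        then have "x - (- l) \<in> D" "x - (- m) \<in> D" by (simp_all add: add.commute)
        then show False using D lm \<Lambda>(2) unfolding fundamental_domain_def by (metis neg_equal_iff_equal)
      qed
      then show "?G l \<inter> ?G m = {}" by auto
    qed
    ultimately show ?thesis using emeasure_UN_countable[of \<Lambda> ?G haar] F(2) \<Lambda>(1) by simp
  qed
  finally show ?thesis .
qed

text \<open>
  The lattice is \<open>w\<^sup>-\<^sup>1\<F>\<^sub>q[t]\<close>, and \<open>w\<^sup>-\<^sup>1\<pi>\<O>\<close> is a fundamental domain for it.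
\<close>

lemma covolume_scaled_poly_ring:
  fixes w :: "'a :: {finite, field} fls"
  assumes w: "w \<noteq> 0"
  shows "covolume {s. w * s \<in> poly_ring} = ennreal (real CARD('a) powi (fls_subdegree w - 1))"
proof -
  let ?L = "{s. w * s \<in> poly_ring}"
  let ?D = "pball 0 (1 - fls_subdegree w) :: 'a fls set"
  have D: "x \<in> ?D \<longleftrightarrow> w * x \<in> pideal 1" for x
    using pideal_mult_iff[OF w, of x "1 - fls_subdegree w"] by (simp add: pball_0)
  have fd: "fundamental_domain ?L ?D"
    unfolding fundamental_domain_def
  proof (intro conjI allI)
    fix x
    obtain p where p: "p \<in> poly_ring" "w * x - p \<in> pideal 1" by (rule ex_poly_part)
    show "\<exists>!l. l \<in> ?L \<and> x - l \<in> ?D"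
    proof (rule ex1I[of _ "p / w"])
      show "p / w \<in> ?L \<and> x - p / w \<in> ?D" using p w unfolding D by (simp add: right_diff_distrib)
    next
      fix l assume l: "l \<in> ?L \<and> x - l \<in> ?D"
      then have "w * (x - l) \<in> pideal 1" unfolding D by blast
      then have "(w * x - p) - w * (x - l) \<in> pideal 1" using p(2) by (rule pideal_diff[rotated])
      then have "w * l - p \<in> pideal 1" by (simp add: algebra_simps)
      moreover have "w * l - p \<in> poly_ring" using l p(1) by (auto intro: poly_ring_diff)
      ultimately have "w * l - p = 0" by (rule poly_ring_Int_pideal[rotated])
      then show "l = p / w" using w by (simp add: field_simps)
    qed
  qed simp
  have "?L = (\<lambda>p. p / w) ` poly_ring"
    using w by (auto simp: image_iff intro!: bexI[of _ "w * x" for x])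
  then have c: "countable ?L" using countable_poly_ring by (metis countable_image)
  have neg: "- l \<in> ?L" if "l \<in> ?L" for l using that poly_ring_uminus[of "w * l"] by simp
  have "covolume ?L = emeasure haar ?D"
    unfolding covolume_def using fd fundamental_domain_emeasure_eq[OF c neg] by (intro the_equality) blast+
  then show ?thesis by (simp add: haar_pball)
qed

section \<open>Cosets and orbits\<close>

lemma SL2_iff: "mat22 a b c d \<in> SL2 R \<longleftrightarrow> a \<in> R \<and> b \<in> R \<and> c \<in> R \<and> d \<in> R \<and> a * d - b * c = 1"
  by (auto simp: SL2_def forall_2)

lemma SL2_subset_GL2: "subring R \<Longrightarrow> g \<in> SL2 R \<Longrightarrow> g \<in> GL2 R"
  by (rule mat22_exhaust[of g]) (auto simp: SL2_iff mat22_in_GL2_iff subringD intro!: bexI[of _ 1])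

lemma SL2_mult:
  assumes "subring R" "g \<in> SL2 R" "h \<in> SL2 R"
  shows "g ** h \<in> SL2 R"
proof -
  obtain a b c d where g: "g = mat22 a b c d" by (rule mat22_exhaust)
  obtain a' b' c' d' where h: "h = mat22 a' b' c' d'" by (rule mat22_exhaust)
  have "(a * a' + b * c') * (c * b' + d * d') - (a * b' + b * d') * (c * a' + d * c') = (a * d - b * c) * (a' * d' - b' * c')"
    by (simp add: algebra_simps)
  then show ?thesis
    using assms(2,3) unfolding g h mat22_mult SL2_iff
    by (intro conjI subringD(4,6)[OF assms(1)]) auto
qed

lemma SL2_inverse:
  assumes "subring R" "g \<in> SL2 R"
  obtains g' where "g' \<in> SL2 R" "g ** g' = mat 1" "g' ** g = mat 1"
proof -
  obtain a b c d where g: "g = mat22 a b c d" by (rule mat22_exhaust)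
  show ?thesis
    by (rule that[of "mat22 d (- b) (- c) a"])
      (use assms in \<open>auto simp: g SL2_iff mat_1_mat22 algebra_simps subringD\<close>)
qed

lemma SL2_one: "subring R \<Longrightarrow> mat 1 \<in> SL2 R"
  by (simp add: mat_1_mat22 SL2_iff subringD)

lemma Gam_mult: "g \<in> Gam \<Longrightarrow> h \<in> Gam \<Longrightarrow> g ** h \<in> Gam"
  unfolding Gam_def by (rule SL2_mult[OF subring_poly_ring])

lemma Gcoset_eq_iff: "Gcoset g = Gcoset h \<longleftrightarrow> (\<exists>\<gamma>\<in>Gam. g = \<gamma> ** h)"
proof
  have one: "mat 1 \<in> Gam" unfolding Gam_def by (rule SL2_one[OF subring_poly_ring])
  {
    assume "Gcoset g = Gcoset h"
    moreover have "g \<in> Gcoset g" unfolding Gcoset_def using one by (metis image_eqI matrix_mul_lid)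
    ultimately show "\<exists>\<gamma>\<in>Gam. g = \<gamma> ** h" unfolding Gcoset_def by blast
  next
    assume "\<exists>\<gamma>\<in>Gam. g = \<gamma> ** h"
    then obtain \<gamma> where \<gamma>: "\<gamma> \<in> Gam" "g = \<gamma> ** h" by blast
    obtain \<delta> where \<delta>: "\<delta> \<in> Gam" "\<delta> ** \<gamma> = mat 1"
      using SL2_inverse[OF subring_poly_ring] \<gamma>(1) unfolding Gam_def by blast
    have h: "h = \<delta> ** g" by (simp add: \<gamma>(2) matrix_mul_assoc \<delta>(2))
    have "\<eta> ** g \<in> Gcoset h" if "\<eta> \<in> Gam" for \<eta>
      unfolding Gcoset_def \<gamma>(2) using Gam_mult[OF that \<gamma>(1)] by (auto simp: matrix_mul_assoc)
    moreover have "\<eta> ** h \<in> Gcoset g" if "\<eta> \<in> Gam" for \<eta>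
      unfolding Gcoset_def h using Gam_mult[OF that \<delta>(1)] by (auto simp: matrix_mul_assoc)
    ultimately show "Gcoset g = Gcoset h" unfolding Gcoset_def[of g] Gcoset_def[of h] by (auto simp: Gcoset_def)
  }
qed

lemma ract_Gcoset: "Gcoset g \<star> b = Gcoset (g ** b)"
  by (simp add: ract_def Gcoset_def image_image matrix_mul_assoc)

definition delta :: "'a :: {finite, field} fls \<Rightarrow> 'a fls ^ 2 ^ 2" where
  "delta x = mat22 x 0 0 (inverse x)"

text \<open>
  Writing the unipotent on the left of the diagonal matrix makes the parameter \<open>s\<close> periodic under \<open>\<F>\<^sub>q[t]\<close> for every
  \<open>x\<close>. The price is that \<open>u(r)\<close> acts as translation by \<open>x\<^sup>2r\<close>.
\<close>

definition orbit_pt :: "'a :: {finite, field} fls \<Rightarrow> 'a fls \<Rightarrow> ('a fls ^ 2 ^ 2) set" where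
  "orbit_pt x s = Gcoset (uu s ** delta x)"

lemma aa_eq_delta: "aa n = delta (tt powi n)"
  by (simp add: aa_def delta_def power_int_minus)

lemma uu_delta: "uu s ** delta x = mat22 x (s * inverse x) 0 (inverse x)"
  by (simp add: uu_def delta_def)

lemma uu_mult: "uu s ** uu r = uu (s + r)"
  by (simp add: uu_def add.commute)

lemma delta_uu: "x \<noteq> 0 \<Longrightarrow> delta x ** uu r = uu (x * x * r) ** delta x"
  by (simp add: uu_def delta_def)

lemma delta_mult: "delta x ** delta y = delta (x * y)"
  by (simp add: delta_def mult.commute)

lemma orbit_pt_uu: "x \<noteq> 0 \<Longrightarrow> orbit_pt x s \<star> uu r = orbit_pt x (s + x * x * r)"
  unfolding orbit_pt_def ract_Gcoset by (metis delta_uu matrix_mul_assoc uu_mult)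

text \<open>
  Right translation by the diagonal group does not touch the parameter, it only changes \<open>x\<close>.
\<close>

lemma orbit_pt_aa: "orbit_pt x s \<star> aa n = orbit_pt (x * tt powi n) s"
  by (simp add: orbit_pt_def ract_Gcoset aa_eq_delta delta_mult flip: matrix_mul_assoc)

lemma orbit_U_delta:
  assumes "x \<noteq> 0"
  shows "orbit_U (delta x) = range (orbit_pt x)"
proof -
  have "Gcoset (delta x) \<star> uu r = orbit_pt x (x * x * r)" for r
    using assms by (simp add: ract_Gcoset orbit_pt_def delta_uu)
  then have "orbit_U (delta x) = range (\<lambda>r. orbit_pt x (x * x * r))" unfolding orbit_U_def by simp
  also have "\<dots> = range (orbit_pt x)"
  proof (intro set_eqI iffI)
    fix y assume "y \<in> range (orbit_pt x)"
    then obtain s where "y = orbit_pt x (x * x * (s / (x * x)))" using assms by auto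
    then show "y \<in> range (\<lambda>r. orbit_pt x (x * x * r))" by blast
  qed auto
  finally show ?thesis .
qed

lemma delta_in_GG: "x \<noteq> 0 \<Longrightarrow> delta x \<in> GG"
  by (simp add: GG_def delta_def SL2_iff)

lemma uu_in_GG: "uu s \<in> GG"
  by (simp add: GG_def uu_def SL2_iff)

lemma GG_mult: "g \<in> GG \<Longrightarrow> h \<in> GG \<Longrightarrow> g ** h \<in> GG"
  unfolding GG_def by (rule SL2_mult[OF subring_UNIV])

lemma orbit_pt_in_XX: "x \<noteq> 0 \<Longrightarrow> orbit_pt x s \<in> XX"
  unfolding orbit_pt_def XX_def by (blast intro: GG_mult uu_in_GG delta_in_GG)

lemma orbit_pt_eq_iff:
  assumes "x \<noteq> 0"
  shows "orbit_pt x s = orbit_pt x r \<longleftrightarrow> s - r \<in> poly_ring"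
proof
  assume "orbit_pt x s = orbit_pt x r"
  then obtain \<gamma> where \<gamma>: "\<gamma> \<in> Gam" "uu s ** delta x = \<gamma> ** (uu r ** delta x)"
    unfolding orbit_pt_def Gcoset_eq_iff by blast
  obtain a b c d where g: "\<gamma> = mat22 a b c d" by (rule mat22_exhaust)
  have "a = 1" "s = a * r + b" "b \<in> poly_ring"
    using \<gamma> assms unfolding g uu_delta by (auto simp: Gam_def SL2_iff field_simps)
  then show "s - r \<in> poly_ring" by simp
next
  assume "s - r \<in> poly_ring"
  then have "uu (s - r) \<in> Gam"
    by (simp add: Gam_def uu_def SL2_iff poly_ring_1 poly_ring_0)
  moreover have "uu s ** delta x = uu (s - r) ** (uu r ** delta x)"
    by (simp add: matrix_mul_assoc uu_mult)
  ultimately show "orbit_pt x s = orbit_pt x r" unfolding orbit_pt_def Gcoset_eq_iff by blast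
qed

text \<open>
  Elements of a coset differ by elements of the arithmetic group, which preserve the height.
\<close>

lemma h_K_Gcoset:
  assumes "g \<in> GG"
  shows "h_K (Gcoset g) = height (cls g)"
proof -
  have g2: "g \<in> GL2 UNIV" using assms unfolding GG_def by (rule SL2_subset_GL2[OF subring_UNIV])
  have "height (vact g' (vv 0)) = height (cls g)" if g': "g' \<in> Gcoset g" for g'
  proof -
    obtain \<gamma> where "\<gamma> \<in> Gam" "g' = \<gamma> ** g" using g' unfolding Gcoset_def by blast
    moreover from this have "\<gamma> \<in> GL2 poly_ring" unfolding Gam_def by (intro SL2_subset_GL2[OF subring_poly_ring])
    moreover have "vact g' (vv 0) = cls g'" by (simp add: vv_eq vact_cls mat_1_mat22[symmetric])
    ultimately show ?thesis using height_poly_invariant[OF _ g2] by simp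
  qed
  moreover have "g \<in> Gcoset g" using Gcoset_eq_iff[of g g] SL2_one[OF subring_poly_ring]
    unfolding Gcoset_def Gam_def by (metis image_eqI matrix_mul_lid)
  ultimately show ?thesis unfolding h_K_def by (intro the_equality) (blast, metis)
qed

text \<open>
  Multiplying by the scalar \<open>x\<close> turns the matrix \<open>u(s) \<delta>\<^sub>x\<close> into one with rows \<open>(x\<^sup>2, s)\<close> and \<open>(0, 1)\<close>, and the unit
  part of \<open>x\<^sup>2\<close> is a column operation. Hence the height depends on \<open>s\<close> only modulo \<open>\<pi>\<^sup>2\<^sup>d\<O>\<close>.
\<close>

lemma h_K_orbit_pt:
  assumes x: "x \<noteq> 0" "fls_subdegree x = int d"
  shows "h_K (orbit_pt x s) = height (cls (horo_mat (2 * d) s))"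
proof -
  define u where "u = x * x / fls_X ^ (2 * d)"
  have sub: "fls_subdegree (x * x) = int (2 * d)" using x by simp
  have xx: "x * x = fls_X ^ (2 * d) * u" by (simp add: u_def del: fls_divide_X_power)
  have u0: "u \<noteq> 0" using x(1) xx by auto
  have "u \<in> pideal 0" unfolding u_def by (rule pideal_divide[of _ "int (2 * d)"]) (use sub in \<open>auto simp: pideal_iff_subdegree\<close>)
  moreover have "fls_subdegree u = 0" using arg_cong[OF xx, of fls_subdegree] sub u0 by simp
  then have "inverse u \<in> pideal 0" using u0 by (simp add: pideal_iff_subdegree)
  ultimately have "mat22 u 0 0 1 \<in> GL2 (pideal 0)"
    using u0 by (auto simp: mat22_in_GL2_iff[OF subring_pideal] one_in_pideal intro!: bexI[of _ "inverse u"])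
  then have "cls (uu s ** delta x) = cls (horo_mat (2 * d) s)"
    by (intro cls_eqI[of x _ _ "mat22 u 0 0 1"]) (use x xx in \<open>auto simp: uu_delta horo_mat_def\<close>)
  then show ?thesis
    unfolding orbit_pt_def by (simp add: h_K_Gcoset GG_mult uu_in_GG delta_in_GG x(1))
qed

section \<open>The topology of the space\<close>

text \<open>
  These sets are a neighbourhood basis of \<open>1\<close> in \<open>G\<close>; for \<open>l \<ge> 0\<close> they are the principal congruence subgroups of
  \<open>SL\<^sub>2(\<O>)\<close>.
\<close>

definition congruence_subgroup :: "int \<Rightarrow> ('a :: {finite, field} fls ^ 2 ^ 2) set" where
  "congruence_subgroup l = {\<kappa> \<in> GG. \<kappa> $ 1 $ 1 - 1 \<in> pideal l \<and> \<kappa> $ 1 $ 2 \<in> pideal l \<and>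
     \<kappa> $ 2 $ 1 \<in> pideal l \<and> \<kappa> $ 2 $ 2 - 1 \<in> pideal l}"

lemma mat22_in_congruence_subgroup:
  "mat22 a b c d \<in> congruence_subgroup l \<longleftrightarrow>
     a * d - b * c = 1 \<and> a - 1 \<in> pideal l \<and> b \<in> pideal l \<and> c \<in> pideal l \<and> d - 1 \<in> pideal l"
  by (auto simp: congruence_subgroup_def GG_def SL2_iff)

lemma congruence_subgroup_mono: "l \<le> k \<Longrightarrow> congruence_subgroup k \<subseteq> congruence_subgroup l"
  by (auto simp: congruence_subgroup_def intro: pideal_mono)

lemma minus_one_in_pideal:
  assumes "a - 1 \<in> pideal l" "0 \<le> l"
  shows "a \<in> pideal 0"
  using pideal_add[OF pideal_mono[OF assms] one_in_pideal] by simp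

lemma congruence_subgroup_subset_SL2:
  assumes "0 \<le> l" "\<kappa> \<in> congruence_subgroup l"
  shows "\<kappa> \<in> SL2 (pideal 0)"
proof -
  obtain a b c d where k: "\<kappa> = mat22 a b c d" by (rule mat22_exhaust)
  show ?thesis
    using assms(2) minus_one_in_pideal[OF _ assms(1)] pideal_mono[OF _ assms(1)]
    unfolding k mat22_in_congruence_subgroup SL2_iff by blast
qed

lemma congruence_subgroup_one: "mat 1 \<in> congruence_subgroup l"
  by (simp add: mat_1_mat22 mat22_in_congruence_subgroup)

lemma congruence_subgroup_subset_GG: "\<kappa> \<in> congruence_subgroup l \<Longrightarrow> \<kappa> \<in> GG"
  by (simp add: congruence_subgroup_def)

lemma congruence_subgroup_mult:
  assumes l: "0 \<le> l" and \<kappa>: "\<kappa> \<in> congruence_subgroup l" "\<kappa>' \<in> congruence_subgroup l"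
  shows "\<kappa> ** \<kappa>' \<in> congruence_subgroup l"
proof -
  obtain a b c d where k: "\<kappa> = mat22 a b c d" by (rule mat22_exhaust)
  obtain a' b' c' d' where k': "\<kappa>' = mat22 a' b' c' d'" by (rule mat22_exhaust)
  have 1: "a - 1 \<in> pideal l" "b \<in> pideal l" "c \<in> pideal l" "d - 1 \<in> pideal l"
      "a' - 1 \<in> pideal l" "b' \<in> pideal l" "c' \<in> pideal l" "d' - 1 \<in> pideal l"
    using \<kappa> unfolding k k' mat22_in_congruence_subgroup by blast+
  have 2: "a' \<in> pideal 0" "d' \<in> pideal 0" using 1 l minus_one_in_pideal by blast+
  have mult: "x * y \<in> pideal l" if "x \<in> pideal l" "y \<in> pideal l" for x y :: "'a fls"
    using that by (rule pideal_mult) (use l in simp)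
  have mult0: "x * y \<in> pideal l" if "x \<in> pideal l" "y \<in> pideal 0" for x y :: "'a fls"
    using that by (rule pideal_mult) simp
  have "(a - 1) * a' + (a' - 1) + b * c' \<in> pideal l" "(a - 1) * b' + b' + b * d' \<in> pideal l"
    "c * a' + (d - 1) * c' + c' \<in> pideal l" "c * b' + ((d - 1) * d' + (d' - 1)) \<in> pideal l"
    using 1 2 by - (intro pideal_add; (rule mult; assumption | rule mult0; assumption | assumption))+
  moreover have "\<kappa> ** \<kappa>' \<in> GG" using \<kappa> congruence_subgroup_subset_GG GG_mult by blast
  ultimately show ?thesis
    unfolding k k' congruence_subgroup_def mat22_mult mem_Collect_eq mat22_nth by (simp add: algebra_simps)
qed

lemma congruence_subgroup_inverse:
  assumes "\<kappa> \<in> congruence_subgroup l"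
  obtains \<kappa>' where "\<kappa>' \<in> congruence_subgroup l" "\<kappa> ** \<kappa>' = mat 1" "\<kappa>' ** \<kappa> = mat 1"
proof -
  obtain a b c d where k: "\<kappa> = mat22 a b c d" by (rule mat22_exhaust)
  show ?thesis
    by (rule that[of "mat22 d (- b) (- c) a"])
      (use assms in \<open>auto simp: k mat22_in_congruence_subgroup mat_1_mat22 algebra_simps intro: pideal_uminus\<close>)
qed

lemma ex_pideal: "\<exists>k\<le>0. f \<in> pideal k"
  by (rule exI[of _ "min 0 (fls_subdegree f)"]) (auto simp: pideal_iff_subdegree)

text \<open>
  A matrix \<open>h'\<close> entrywise close to \<open>h\<close> is \<open>h \<kappa>\<close> with \<open>\<kappa> - 1 = h\<^sup>-\<^sup>1(h' - h)\<close>; the loss of precision is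
  bounded by the valuations of the entries of \<open>h\<close>. This criterion replaces continuity of matrix multiplication.
\<close>

lemma openin_GG_topI:
  fixes A :: "('a::{finite,field} fls ^ 2 ^ 2) set"
  assumes A: "A \<subseteq> GG" and l: "\<And>h \<kappa>. h \<in> A \<Longrightarrow> \<kappa> \<in> congruence_subgroup l \<Longrightarrow> h ** \<kappa> \<in> A"
  shows "openin GG_top A"
proof (subst openin_subopen, rule ballI)
  fix h assume h: "h \<in> A"
  obtain a b c d where abcd: "h = mat22 a b c d" by (rule mat22_exhaust)
  have det: "a * d - b * c = 1" using h A unfolding abcd by (auto simp: GG_def SL2_iff)
  obtain k1 k2 k3 k4 where k: "a \<in> pideal k1" "b \<in> pideal k2" "c \<in> pideal k3" "d \<in> pideal k4"
    using ex_pideal by metis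
  define k0 where "k0 = min (min k1 k2) (min k3 k4)"
  have k0: "a \<in> pideal k0" "b \<in> pideal k0" "c \<in> pideal k0" "d \<in> pideal k0"
    using k unfolding k0_def by (auto intro: pideal_mono)
  let ?N = "{h'. \<forall>i. h' $ i \<in> {v. \<forall>j. v $ j \<in> pball (h $ i $ j) (l - k0)}}"
  have N: "open ?N" by (intro open_vector_box allI open_pball)
  have mult: "x * y - z * w \<in> pideal l"
    if "x \<in> pideal k0" "y \<in> pideal (l - k0)" "z \<in> pideal k0" "w \<in> pideal (l - k0)" for x y z w :: "'a fls"
    by (rule pideal_diff; rule pideal_mult[of _ k0 _ "l - k0"]) (use that in auto)
  have "h' \<in> A" if h': "h' \<in> GG" "h' \<in> ?N" for h'
  proof -
    obtain a' b' c' d' where h'_eq: "h' = mat22 a' b' c' d'" by (rule mat22_exhaust)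
    have diff: "a' - a \<in> pideal (l - k0)" "b' - b \<in> pideal (l - k0)" "c' - c \<in> pideal (l - k0)" "d' - d \<in> pideal (l - k0)"
      using h'(2) unfolding h'_eq abcd by (auto simp: forall_2 pball_def)
    let ?k = "mat22 d (- b) (- c) a ** h'"
    have "d * (a' - a) - b * (c' - c) \<in> pideal l" "d * (b' - b) - b * (d' - d) \<in> pideal l"
      "a * (c' - c) - c * (a' - a) \<in> pideal l" "a * (d' - d) - c * (b' - b) \<in> pideal l"
      using diff k0 by - (rule mult; assumption)+
    moreover have "d * (a' - a) - b * (c' - c) = d * a' - b * c' - (a * d - b * c)"
      "d * (b' - b) - b * (d' - d) = d * b' - b * d'" "a * (c' - c) - c * (a' - a) = a * c' - c * a'"
      "a * (d' - d) - c * (b' - b) = a * d' - c * b' - (a * d - b * c)"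
      by (simp_all add: algebra_simps)
    moreover have "?k \<in> GG"
      by (rule GG_mult[OF _ h'(1)]) (use det in \<open>simp add: GG_def SL2_iff mult.commute\<close>)
    ultimately have "?k \<in> congruence_subgroup l"
      unfolding congruence_subgroup_def h'_eq by (simp add: det)
    then have "h ** ?k \<in> A" by (rule l[OF h])
    moreover have "h ** mat22 d (- b) (- c) a = mat 1"
      using det by (simp add: abcd mat_1_mat22 mult.commute)
    ultimately show ?thesis by (simp add: matrix_mul_assoc)
  qed
  then have "GG \<inter> ?N \<subseteq> A" by blast
  moreover have "openin GG_top (GG \<inter> ?N)" unfolding GG_top_def by (rule openin_open_Int[OF N])
  moreover have "h \<in> GG \<inter> ?N" using h A by auto
  ultimately show "\<exists>T. openin GG_top T \<and> h \<in> T \<and> T \<subseteq> A" by blast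
qed

lemma openin_XX_topI:
  fixes A :: "('a::{finite,field} fls ^ 2 ^ 2) set set"
  assumes "A \<subseteq> XX" "\<And>h \<kappa>. h \<in> GG \<Longrightarrow> Gcoset h \<in> A \<Longrightarrow> \<kappa> \<in> congruence_subgroup l \<Longrightarrow> Gcoset (h ** \<kappa>) \<in> A"
  shows "openin XX_top A"
  unfolding openin_XX_top
proof (intro conjI openin_GG_topI[of _ l])
  fix h \<kappa> :: "'a fls ^ 2 ^ 2"
  assume "h \<in> {g \<in> GG. Gcoset g \<in> A}" "\<kappa> \<in> congruence_subgroup l"
  then show "h ** \<kappa> \<in> {g \<in> GG. Gcoset g \<in> A}"
    using assms(2) GG_mult congruence_subgroup_subset_GG by blast
qed (use assms(1) in auto)

lemma continuous_on_uu_delta: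
  fixes x :: "'a::{finite,field} fls"
  shows "continuous_on UNIV (\<lambda>s. uu s ** delta x)"
proof -
  let ?e = "\<lambda>(i :: 2) (j :: 2) s. if i = 1 then if j = 1 then x else s * inverse x else if j = 1 then 0 else inverse x"
  have eq: "(\<lambda>s. uu s ** delta x) = (\<lambda>s. \<chi> i j. ?e i j s)"
    by (simp add: uu_delta vec_eq_iff forall_2 fun_eq_iff)
  have "continuous_on UNIV (?e i j)" for i j
    by (cases "i = 1"; cases "j = 1") (simp_all add: continuous_on_mult_right)
  then have "continuous_on UNIV (\<lambda>s. \<chi> j. ?e i j s)" for i
    by (rule continuous_on_vec_lambda)
  then show ?thesis unfolding eq by (rule continuous_on_vec_lambda)
qed

lemma open_orbit_pt_vimage:
  assumes "x \<noteq> 0" "openin XX_top A"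
  shows "open {s. orbit_pt x s \<in> A}"
proof -
  obtain U where U: "open U" "{g \<in> GG. Gcoset g \<in> A} = GG \<inter> U"
    using assms(2) unfolding openin_XX_top GG_top_def openin_open by blast
  have "orbit_pt x s \<in> A \<longleftrightarrow> uu s ** delta x \<in> U" for s
    using U(2) GG_mult[OF uu_in_GG delta_in_GG[OF assms(1)], of s] unfolding orbit_pt_def by blast
  then have "{s. orbit_pt x s \<in> A} = (\<lambda>s. uu s ** delta x) -` U" by auto
  moreover have "open ((\<lambda>s. uu s ** delta x) -` U)"
    by (rule open_vimage[OF U(1) continuous_on_uu_delta])
  ultimately show ?thesis by simp
qed

text \<open>
  The orbit map is open onto the orbit. If \<open>u(s) \<delta> \<kappa> = \<gamma> u(r) \<delta>\<close> with \<open>\<kappa>\<close> close to \<open>1\<close>, then \<open>\<gamma>\<close> has a small lower left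
  entry and diagonal entries close to \<open>1\<close>; being a polynomial matrix, it is \<open>u(\<beta>)\<close>, and \<open>r + \<beta>\<close> is close to
  \<open>s\<close>. So points of the orbit that are close in the space \<open>X\<close> have parameters that are close modulo \<open>\<F>\<^sub>q[t]\<close>.
\<close>

lemma openin_orbit_pt_pball:
  fixes x :: "'a::{finite,field} fls"
  assumes x: "x \<noteq> 0"
  shows "openin (subtopology XX_top (range (orbit_pt x))) (orbit_pt x ` pball a k)"
proof -
  \<comment> \<open>Conjugation by \<open>\<delta>\<^sub>x\<close> costs twice the valuation of \<open>x\<close> in precision, and index \<open>1\<close> makes polynomials vanish.\<close>
  define l where "l = max k 1 + 2 * \<bar>fls_subdegree x\<bar>"
  let ?H = "{uu s ** delta x ** \<kappa> | s \<kappa>. s \<in> pball a k \<and> \<kappa> \<in> congruence_subgroup l}"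
  have H: "?H \<subseteq> GG"
    by (auto intro!: GG_mult uu_in_GG delta_in_GG[OF x] dest: congruence_subgroup_subset_GG)
  have l: "0 \<le> l" "1 \<le> l" "1 \<le> l - 2 * fls_subdegree x" "k \<le> 2 * fls_subdegree x + l"
    unfolding l_def by linarith+
  have "openin XX_top (Gcoset ` ?H)"
  proof (rule openin_XX_topI[of _ l])
    show "Gcoset ` ?H \<subseteq> XX" using H unfolding XX_def by (rule image_mono)
    fix h \<kappa> :: "'a fls ^ 2 ^ 2"
    assume h: "Gcoset h \<in> Gcoset ` ?H" and \<kappa>: "\<kappa> \<in> congruence_subgroup l"
    then obtain s \<kappa>' where *: "Gcoset h = Gcoset (uu s ** delta x ** \<kappa>')" "s \<in> pball a k" "\<kappa>' \<in> congruence_subgroup l"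
      by blast
    have "Gcoset (h ** \<kappa>) = Gcoset (uu s ** delta x ** (\<kappa>' ** \<kappa>))"
      using *(1) by (metis ract_Gcoset matrix_mul_assoc)
    then show "Gcoset (h ** \<kappa>) \<in> Gcoset ` ?H"
      using *(2) congruence_subgroup_mult[OF l(1) *(3) \<kappa>] by blast
  qed
  moreover have "Gcoset ` ?H \<inter> range (orbit_pt x) = orbit_pt x ` pball a k"
  proof (intro set_eqI iffI)
    fix y assume "y \<in> orbit_pt x ` pball a k"
    then obtain s where s: "s \<in> pball a k" "y = orbit_pt x s" by blast
    have "y = Gcoset (uu s ** delta x ** mat 1)" by (simp add: s(2) orbit_pt_def)
    then show "y \<in> Gcoset ` ?H \<inter> range (orbit_pt x)"
      using s congruence_subgroup_one by blast
  next
    fix y assume "y \<in> Gcoset ` ?H \<inter> range (orbit_pt x)"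
    then obtain s \<kappa> r where s: "s \<in> pball a k" "\<kappa> \<in> congruence_subgroup l"
      "Gcoset (uu s ** delta x ** \<kappa>) = Gcoset (uu r ** delta x)" and y: "y = orbit_pt x r"
      unfolding orbit_pt_def by blast
    obtain \<gamma> where \<gamma>: "\<gamma> \<in> Gam" "uu s ** delta x ** \<kappa> = \<gamma> ** (uu r ** delta x)"
      using s(3) unfolding Gcoset_eq_iff by blast
    obtain p q u v where k: "\<kappa> = mat22 p q u v" by (rule mat22_exhaust)
    obtain \<alpha> \<beta> \<zeta> \<eta> where g: "\<gamma> = mat22 \<alpha> \<beta> \<zeta> \<eta>" by (rule mat22_exhaust)
    have pquv: "p - 1 \<in> pideal l" "q \<in> pideal l" "u \<in> pideal l" "v - 1 \<in> pideal l" "p * v - q * u = 1"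
      using s(2) unfolding k mat22_in_congruence_subgroup by auto
    have poly: "\<alpha> \<in> poly_ring" "\<beta> \<in> poly_ring" "\<zeta> \<in> poly_ring" "\<eta> \<in> poly_ring"
      using \<gamma>(1) unfolding g Gam_def SL2_iff by auto
    have eq: "x * p + s * inverse x * u = \<alpha> * x" "x * q + s * inverse x * v = \<alpha> * (r * inverse x) + \<beta> * inverse x"
       "inverse x * u = \<zeta> * x" "inverse x * v = \<zeta> * (r * inverse x) + \<eta> * inverse x"
      using \<gamma>(2) unfolding g k uu_delta by auto
    have "\<zeta> = u / (x * x)" using eq(3) x by (simp add: field_simps)
    moreover have "u / (x * x) \<in> pideal 1"
      by (rule pideal_divide[OF pquv(3)]) (use x l(3) in auto)
    ultimately have z: "\<zeta> = 0" using poly_ring_Int_pideal poly(3) by blast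
    then have u: "u = 0" using eq(3) x by simp
    have "p - 1 \<in> pideal 1" "v - 1 \<in> pideal 1" using pquv(1,4) l(2) pideal_mono by blast+
    moreover have pa: "p = \<alpha>" "v = \<eta>" using eq(1,4) u z x by auto
    ultimately have "\<alpha> - 1 = 0" "\<eta> - 1 = 0"
      using poly_ring_Int_pideal poly_ring_diff[OF poly(1) poly_ring_1] poly_ring_diff[OF poly(4) poly_ring_1]
      unfolding pa by blast+
    then have "p = 1" "v = 1" "\<alpha> = 1" using pa by auto
    then have "x * x * q + s = r + \<beta>"
      using arg_cong[OF eq(2), of "\<lambda>y. y * x"] x by (simp add: algebra_simps)
    then have "(s + x * x * q) - r = \<beta>" by (simp add: algebra_simps)
    then have "orbit_pt x (s + x * x * q) = y" unfolding y orbit_pt_eq_iff[OF x] using poly(2) by simp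
    moreover have "x * x \<in> pideal (2 * fls_subdegree x)" using x by (simp add: pideal_iff_subdegree)
    then have "x * x * q \<in> pideal k" by (rule pideal_mult[OF _ pquv(2)]) (rule l(4))
    then have "s + x * x * q \<in> pball a k" using s(1) pideal_add[of "s - a" k "x * x * q"] by (simp add: pball_def algebra_simps)
    ultimately show "y \<in> orbit_pt x ` pball a k" by blast
  qed
  ultimately show ?thesis
    unfolding openin_subtopology by (intro exI[of _ "Gcoset ` ?H"]) simp
qed

section \<open>The invariant measure on a closed orbit\<close>

definition orbit_borel :: "'a :: {finite, field} fls \<Rightarrow> ('a fls ^ 2 ^ 2) set measure" where
  "orbit_borel x = borel_of_top (subtopology XX_top (range (orbit_pt x)))"

lemma space_borel_of_top: "space (borel_of_top T) = topspace T"
  unfolding borel_of_top_def by (rule space_measure_of) (auto dest: openin_subset)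

lemma sets_borel_of_top: "sets (borel_of_top T) = sigma_sets (topspace T) {A. openin T A}"
  unfolding borel_of_top_def by (rule sets_measure_of) (auto dest: openin_subset)

lemma topspace_orbit: "x \<noteq> 0 \<Longrightarrow> topspace (subtopology XX_top (range (orbit_pt x))) = range (orbit_pt x)"
  unfolding topspace_subtopology topspace_XX_top using orbit_pt_in_XX by blast

lemma space_orbit_borel: "x \<noteq> 0 \<Longrightarrow> space (orbit_borel x) = range (orbit_pt x)"
  unfolding orbit_borel_def space_borel_of_top by (rule topspace_orbit)

lemma orbit_pt_pball_sets: "x \<noteq> 0 \<Longrightarrow> orbit_pt x ` pball a k \<in> sets (orbit_borel x)"
  unfolding orbit_borel_def sets_borel_of_top by (blast intro: openin_orbit_pt_pball)

lemma orbit_pt_image_open_sigma: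
  assumes "open S"
  shows "orbit_pt x ` S \<in> sigma_sets (range (orbit_pt x)) {orbit_pt x ` pball a k | a k. l \<le> k}"
proof -
  obtain C where C: "countable C" "C \<subseteq> {pball a k | a k. l \<le> k}" "S = \<Union>C"
    using open_eq_Union_pballs[OF assms, of l] by blast
  have "orbit_pt x ` S = \<Union>((\<lambda>B. orbit_pt x ` B) ` C)" unfolding C(3) by blast
  moreover have "\<dots> \<in> sigma_sets (range (orbit_pt x)) {orbit_pt x ` pball a k | a k. l \<le> k}"
  proof (rule sigma_sets_UNION)
    fix A assume "A \<in> (\<lambda>B. orbit_pt x ` B) ` C"
    then obtain a k where "A = orbit_pt x ` pball a k" "l \<le> k" using C(2) by blast
    then show "A \<in> sigma_sets (range (orbit_pt x)) {orbit_pt x ` pball a k | a k. l \<le> k}"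
      by (intro sigma_sets.Basic) blast
  qed (use C(1) in simp)
  ultimately show ?thesis by simp
qed

text \<open>
  The orbit map is continuous and open, so the Borel sets of the orbit are generated by the images of balls.
\<close>

lemma sets_orbit_borel:
  assumes x: "x \<noteq> 0"
  shows "sets (orbit_borel x) = sigma_sets (range (orbit_pt x)) {orbit_pt x ` pball a k | a k. l \<le> k}"
  unfolding orbit_borel_def sets_borel_of_top topspace_orbit[OF x]
proof (rule sigma_sets_eqI)
  fix A assume "A \<in> {A. openin (subtopology XX_top (range (orbit_pt x))) A}"
  then obtain T where T: "openin XX_top T" "A = T \<inter> range (orbit_pt x)"
    unfolding openin_subtopology by blast
  have "A = orbit_pt x ` {s. orbit_pt x s \<in> T}" unfolding T(2) by blast
  then show "A \<in> sigma_sets (range (orbit_pt x)) {orbit_pt x ` pball a k | a k. l \<le> k}"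
    using orbit_pt_image_open_sigma[OF open_orbit_pt_vimage[OF x T(1)]] by simp
next
  fix A assume "A \<in> {orbit_pt x ` pball a k | a k. l \<le> k}"
  then show "A \<in> sigma_sets (range (orbit_pt x)) {A. openin (subtopology XX_top (range (orbit_pt x))) A}"
    by (auto intro!: sigma_sets.Basic openin_orbit_pt_pball[OF x])
qed

lemma orbit_pt_image_open_sets:
  assumes "x \<noteq> 0" "open S"
  shows "orbit_pt x ` S \<in> sets (orbit_borel x)"
  using orbit_pt_image_open_sigma[OF assms(2)] sets_orbit_borel[OF assms(1)] by blast

lemma orbit_pt_shift:
  assumes "x \<noteq> 0" "p \<in> poly_ring"
  shows "orbit_pt x (s + p) = orbit_pt x s"
  using assms by (simp add: orbit_pt_eq_iff)

lemma orbit_pt_pball_shift: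
  assumes x: "x \<noteq> 0" and p: "p \<in> poly_ring"
  shows "orbit_pt x ` pball (a + p) k = orbit_pt x ` pball a k"
proof (intro set_eqI iffI)
  fix y assume "y \<in> orbit_pt x ` pball (a + p) k"
  then obtain s where s: "s \<in> pball (a + p) k" "y = orbit_pt x s" by blast
  have "y = orbit_pt x (s - p)" using orbit_pt_shift[OF x p, of "s - p"] s(2) by simp
  moreover have "s - p \<in> pball a k" using s(1) by (simp add: pball_def algebra_simps)
  ultimately show "y \<in> orbit_pt x ` pball a k" by blast
next
  fix y assume "y \<in> orbit_pt x ` pball a k"
  then obtain s where s: "s \<in> pball a k" "y = orbit_pt x s" by blast
  have "y = orbit_pt x (s + p)" using orbit_pt_shift[OF x p, of s] s(2) by simp
  moreover have "s + p \<in> pball (a + p) k" using s(1) by (simp add: pball_def algebra_simps)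
  ultimately show "y \<in> orbit_pt x ` pball (a + p) k" by blast
qed

text \<open>
  Balls of index \<open>1\<close> are fundamental domains of \<open>\<F>\<^sub>q[t]\<close>: here they embed, and by the next lemma they cover.
\<close>

lemma inj_on_orbit_pt:
  assumes x: "x \<noteq> 0"
  shows "inj_on (orbit_pt x) (pball a 1)"
proof (rule inj_onI)
  fix s r assume sr: "s \<in> pball a 1" "r \<in> pball a 1" "orbit_pt x s = orbit_pt x r"
  have "(s - a) - (r - a) \<in> pideal 1" using sr(1,2) unfolding pball_def by (blast intro: pideal_diff)
  then have "s - r \<in> pideal 1" by simp
  moreover have "s - r \<in> poly_ring" using sr(3) unfolding orbit_pt_eq_iff[OF x] .
  ultimately have "s - r = 0" by (rule poly_ring_Int_pideal[rotated])
  then show "s = r" by simp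
qed

lemma orbit_pt_pball_1:
  assumes x: "x \<noteq> 0"
  shows "orbit_pt x ` pball a 1 = range (orbit_pt x)"
proof
  show "range (orbit_pt x) \<subseteq> orbit_pt x ` pball a 1"
  proof
    fix y assume "y \<in> range (orbit_pt x)"
    then obtain s where s: "y = orbit_pt x s" by blast
    obtain p where p: "p \<in> poly_ring" "(s - a) - p \<in> pideal 1" by (rule ex_poly_part)
    have "y = orbit_pt x (s - p)" using orbit_pt_shift[OF x p(1), of "s - p"] s by simp
    moreover have "s - p \<in> pball a 1" using p(2) by (simp add: pball_def algebra_simps)
    ultimately show "y \<in> orbit_pt x ` pball a 1" by blast
  qed
qed blast

text \<open>
  The nesting of balls survives in the orbit, because a periodic translate of a ball has the same image.
\<close>

lemma orbit_pt_pball_Int: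
  assumes x: "x \<noteq> 0" and kl: "k \<le> l"
  shows "orbit_pt x ` pball a k \<inter> orbit_pt x ` pball b l = {} \<or>
    orbit_pt x ` pball a k \<inter> orbit_pt x ` pball b l = orbit_pt x ` pball b l"
proof (cases "orbit_pt x ` pball a k \<inter> orbit_pt x ` pball b l = {}")
  case False
  then obtain s r where sr: "s \<in> pball a k" "r \<in> pball b l" "orbit_pt x s = orbit_pt x r" by blast
  then have p: "s - r \<in> poly_ring" unfolding orbit_pt_eq_iff[OF x] by simp
  have "s \<in> pball (b + (s - r)) l" using sr(2) by (simp add: pball_def algebra_simps)
  then have "pball (b + (s - r)) l \<subseteq> pball a k" using sr(1) pball_mono[OF kl] pball_eq by metis
  then have "orbit_pt x ` pball b l \<subseteq> orbit_pt x ` pball a k"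
    unfolding orbit_pt_pball_shift[OF x p, of b l, symmetric] by (rule image_mono)
  then show ?thesis by blast
qed simp

lemma orbit_measure_eqI:
  fixes x :: "'a::{finite,field} fls"
  assumes x: "x \<noteq> 0" and sets: "sets M = sets (orbit_borel x)" "sets N = sets (orbit_borel x)"
    and M: "\<And>a k. 1 \<le> k \<Longrightarrow> emeasure M (orbit_pt x ` pball a k) = f k"
    and N: "\<And>a k. 1 \<le> k \<Longrightarrow> emeasure N (orbit_pt x ` pball a k) = f k"
    and fin: "f 1 \<noteq> \<infinity>"
  shows "M = N"
proof -
  let ?Y = "range (orbit_pt x)"
  let ?Bs = "{orbit_pt x ` pball a k | a k. 1 \<le> k}"
  let ?E = "insert {} ?Bs"
  have E: "sigma_sets ?Y ?E = sigma_sets ?Y ?Bs"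
    by (rule sigma_sets_eqI) (auto intro: sigma_sets.intros)
  show ?thesis
  proof (rule measure_eqI_generator_eq[where E = ?E and \<Omega> = ?Y and A = "\<lambda>_. orbit_pt x ` pball 0 1"])
    show "Int_stable ?E"
    proof (rule Int_stableI)
      fix A B assume AB: "A \<in> ?E" "B \<in> ?E"
      then consider "A = {} \<or> B = {}"
        | a k b l where "A = orbit_pt x ` pball a k" "B = orbit_pt x ` pball b l" "1 \<le> k" "1 \<le> l"
        by blast
      then show "A \<inter> B \<in> ?E"
      proof cases
        case 2
        then have "A \<inter> B = {} \<or> A \<inter> B = A \<or> A \<inter> B = B"
          using orbit_pt_pball_Int[OF x, of k l a b, folded 2(1,2)] orbit_pt_pball_Int[OF x, of l k b a, folded 2(1,2)]
          by (metis Int_commute linear)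
        then show ?thesis using AB by (elim disjE) simp_all
      qed auto
    qed
    fix X assume "X \<in> ?E"
    then consider "X = {}" | a k where "X = orbit_pt x ` pball a k" "1 \<le> k" by blast
    then show "emeasure M X = emeasure N X"
    proof cases
      case (2 a k)
      show ?thesis unfolding 2(1) using M[OF 2(2), of a] N[OF 2(2), of a] by (rule trans[OF _ sym])
    next
      case 1
      show ?thesis unfolding 1 by simp
    qed
  next
    have S: "sets (orbit_borel x) = sigma_sets ?Y ?E" by (rule trans[OF sets_orbit_borel[OF x, of 1] E[symmetric]])
    show "sets M = sigma_sets ?Y ?E" by (rule trans[OF sets(1) S])
    show "sets N = sigma_sets ?Y ?E" by (rule trans[OF sets(2) S])
    show "(\<Union>i::nat. orbit_pt x ` pball 0 1) = ?Y"
      using orbit_pt_pball_1[OF x] by simp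
    show "emeasure M (orbit_pt x ` pball 0 1) \<noteq> \<infinity>" using M fin by simp
  qed auto
qed

lemma orbit_translate_vimage:
  assumes x: "x \<noteq> 0"
  shows "(\<lambda>y. y \<star> uu r) -` (orbit_pt x ` pball a k) \<inter> range (orbit_pt x) = orbit_pt x ` pball (a - x * x * r) k"
proof (intro set_eqI iffI)
  fix y assume "y \<in> (\<lambda>y. y \<star> uu r) -` (orbit_pt x ` pball a k) \<inter> range (orbit_pt x)"
  then obtain s t where s: "y = orbit_pt x s" "t \<in> pball a k" "orbit_pt x (s + x * x * r) = orbit_pt x t"
    using orbit_pt_uu[OF x] by auto
  then have "s - (t - x * x * r) \<in> poly_ring" unfolding orbit_pt_eq_iff[OF x] by (simp add: algebra_simps)
  then have "y = orbit_pt x (t - x * x * r)" using s(1) orbit_pt_eq_iff[OF x] by blast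
  moreover have "t - x * x * r \<in> pball (a - x * x * r) k" using s(2) by (simp add: pball_def)
  ultimately show "y \<in> orbit_pt x ` pball (a - x * x * r) k" by blast
next
  fix y assume "y \<in> orbit_pt x ` pball (a - x * x * r) k"
  then obtain t where t: "t \<in> pball (a - x * x * r) k" "y = orbit_pt x t" by blast
  have "t + x * x * r \<in> pball a k" using t(1) by (simp add: pball_def algebra_simps)
  then show "y \<in> (\<lambda>y. y \<star> uu r) -` (orbit_pt x ` pball a k) \<inter> range (orbit_pt x)"
    using t(2) orbit_pt_uu[OF x] by auto
qed

lemma measurable_orbit_translate:
  assumes x: "x \<noteq> 0"
  shows "(\<lambda>y. y \<star> uu r) \<in> measurable (orbit_borel x) (orbit_borel x)"
proof (rule measurable_sigma_sets[OF sets_orbit_borel[OF x, of 1]])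
  show "(\<lambda>y. y \<star> uu r) \<in> space (orbit_borel x) \<rightarrow> range (orbit_pt x)"
    using orbit_pt_uu[OF x] by (auto simp: space_orbit_borel[OF x])
qed (auto simp: space_orbit_borel[OF x] orbit_translate_vimage[OF x] orbit_pt_pball_sets[OF x])

definition invariant_prob :: "'a :: {finite, field} fls \<Rightarrow> ('a fls ^ 2 ^ 2) set measure \<Rightarrow> bool" where
  "invariant_prob x \<nu> \<longleftrightarrow> sets \<nu> = sets (orbit_borel x) \<and> prob_space \<nu> \<and>
     (\<forall>s. distr \<nu> \<nu> (\<lambda>y. y \<star> uu s) = \<nu>)"

lemma nu_eq: "x \<noteq> 0 \<Longrightarrow> nu (orbit_U (delta x)) = (THE \<nu>. invariant_prob x \<nu>)"
  by (simp add: nu_def invariant_prob_def orbit_borel_def orbit_U_delta)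

text \<open>
  Invariance makes the images of balls of one index equally heavy, and for \<open>k \<ge> 1\<close> the splitting of a ball into \<open>q\<close>
  smaller ones remains disjoint in the orbit.
\<close>

lemma invariant_prob_pball:
  fixes x :: "'a::{finite,field} fls"
  assumes x: "x \<noteq> 0" and \<nu>: "invariant_prob x \<nu>" and k: "1 \<le> k"
  shows "emeasure \<nu> (orbit_pt x ` pball a k) = ennreal (real CARD('a) powi (1 - k))"
proof -
  have sets: "sets \<nu> = sets (orbit_borel x)" and prob: "prob_space \<nu>"
    and inv: "\<And>s. distr \<nu> \<nu> (\<lambda>y. y \<star> uu s) = \<nu>" using \<nu> by (auto simp: invariant_prob_def)
  have sp: "space \<nu> = range (orbit_pt x)" using sets_eq_imp_space_eq[OF sets] space_orbit_borel[OF x] by simp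
  have meas: "(\<lambda>y. y \<star> uu s) \<in> measurable \<nu> \<nu>" for s
    using measurable_orbit_translate[OF x] measurable_cong_sets[OF sets sets] by blast
  have trans: "emeasure \<nu> (orbit_pt x ` pball a k) = emeasure \<nu> (orbit_pt x ` pball 0 k)" for a k
  proof -
    have "emeasure \<nu> (orbit_pt x ` pball a k) = emeasure (distr \<nu> \<nu> (\<lambda>y. y \<star> uu (a / (x * x)))) (orbit_pt x ` pball a k)"
      using inv by simp
    also have "\<dots> = emeasure \<nu> (orbit_pt x ` pball (a - x * x * (a / (x * x))) k)"
      by (subst emeasure_distr[OF meas]) (simp_all only: sets sp orbit_pt_pball_sets[OF x] orbit_translate_vimage[OF x])
    finally show ?thesis using x by simp
  qed
  have step: "emeasure \<nu> (orbit_pt x ` pball 0 k) = ennreal (real CARD('a)) * emeasure \<nu> (orbit_pt x ` pball 0 (k + 1))"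
    if "1 \<le> k" for k
  proof -
    let ?B = "\<lambda>c :: 'a. pball (0 + fls_const c * fls_X powi k) (k + 1)"
    have U: "orbit_pt x ` pball 0 k = (\<Union>c. orbit_pt x ` ?B c)"
      unfolding pball_split[of 0 k] by blast
    have disj: "disjoint_family (\<lambda>c. orbit_pt x ` ?B c)"
      unfolding disjoint_family_on_def
    proof (intro ballI impI)
      fix c d :: 'a assume "c \<noteq> d"
      then have "?B c \<inter> ?B d = {}" using pball_split_disjoint[of 0 k] unfolding disjoint_family_on_def by blast
      moreover have "?B c \<subseteq> pball 0 1" "?B d \<subseteq> pball 0 1"
        using pball_split[of 0 k] pball_mono[OF that, of 0] by blast+
      ultimately show "orbit_pt x ` ?B c \<inter> orbit_pt x ` ?B d = {}"
        using inj_on_image_Int[OF inj_on_orbit_pt[OF x, of 0], of "?B c" "?B d"] by simp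
    qed
    have "emeasure \<nu> (orbit_pt x ` pball 0 k) = (\<Sum>c\<in>UNIV. emeasure \<nu> (orbit_pt x ` ?B c))"
      unfolding U
      by (rule sum_emeasure[symmetric, OF _ disj]) (auto simp only: sets intro: orbit_pt_pball_sets[OF x] finite)
    also have "\<dots> = (\<Sum>c\<in>(UNIV :: 'a set). emeasure \<nu> (orbit_pt x ` pball 0 (k + 1)))"
      by (intro sum.cong refl trans)
    finally show ?thesis by (simp add: ennreal_of_nat_eq_real_of_nat)
  qed
  have base: "emeasure \<nu> (orbit_pt x ` pball 0 1) = ennreal (real CARD('a) powi (1 - 1))"
    using prob_space.emeasure_space_1[OF prob] by (simp add: orbit_pt_pball_1[OF x] sp)
  show ?thesis
    unfolding trans[of a k]
    by (rule ball_mass_up[where f = "\<lambda>k. emeasure \<nu> (orbit_pt x ` pball 0 k)", OF step base k])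
qed

lemma measurable_orbit_pt:
  assumes x: "x \<noteq> 0"
  shows "orbit_pt x \<in> measurable borel (orbit_borel x)"
  unfolding orbit_borel_def borel_of_top_def topspace_orbit[OF x]
proof (rule measurable_measure_of)
  show "{A. openin (subtopology XX_top (range (orbit_pt x))) A} \<subseteq> Pow (range (orbit_pt x))"
    using openin_subset topspace_orbit[OF x] by blast
  fix A assume "A \<in> {A. openin (subtopology XX_top (range (orbit_pt x))) A}"
  then obtain T where T: "openin XX_top T" "A = T \<inter> range (orbit_pt x)"
    unfolding openin_subtopology by blast
  have "orbit_pt x -` A \<inter> space borel = {s. orbit_pt x s \<in> T}" unfolding T(2) by auto
  then show "orbit_pt x -` A \<inter> space borel \<in> sets borel"
    using open_orbit_pt_vimage[OF x T(1)] by (simp add: borel_open)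
qed auto

text \<open>
  Haar measure on the fundamental domain \<open>\<pi>\<O>\<close>, normalized and carried to the orbit.
\<close>

definition orbit_measure :: "'a :: {finite, field} fls \<Rightarrow> ('a fls ^ 2 ^ 2) set measure" where
  "orbit_measure x = distr (uniform_measure haar (pideal 1)) (orbit_borel x) (orbit_pt x)"

lemma orbit_measure_pball:
  fixes x :: "'a::{finite,field} fls"
  assumes x: "x \<noteq> 0" and k: "1 \<le> k"
  shows "emeasure (orbit_measure x) (orbit_pt x ` pball a k) = ennreal (real CARD('a) powi (1 - k))"
proof -
  obtain p where p: "p \<in> poly_ring" "a - p \<in> pideal 1" by (rule ex_poly_part)
  let ?b = "a - p"
  have b: "pball ?b k \<subseteq> pideal 1"
  proof -
    have "pball ?b k \<subseteq> pball ?b 1" by (rule pball_mono[OF k])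
    also have "pball ?b 1 = pball 0 1" by (rule pball_eq) (use p(2) in \<open>simp add: pball_def\<close>)
    finally show ?thesis by (simp add: pball_0)
  qed
  have im: "orbit_pt x ` pball a k = orbit_pt x ` pball ?b k"
    using orbit_pt_pball_shift[OF x p(1), of ?b k] by simp
  have meas: "orbit_pt x \<in> measurable (uniform_measure haar (pideal 1)) (orbit_borel x)"
    using measurable_orbit_pt[OF x] measurable_cong_sets[of "uniform_measure haar (pideal 1)" borel, OF _ refl] sets_haar
    by (metis sets_uniform_measure)
  have sp: "space haar = (UNIV :: 'a fls set)" using sets_eq_imp_space_eq[OF sets_haar] by simp
  have vim: "pideal 1 \<inter> orbit_pt x -` (orbit_pt x ` pball ?b k) = pball ?b k"
    using inj_on_orbit_pt[OF x, of 0] b unfolding pball_0 inj_on_def by blast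
  have P: "pideal 1 \<in> sets (haar :: 'a fls measure)"
    using pball_in_borel[of 0 1] by (simp add: sets_haar pball_0)
  have pre: "orbit_pt x -` (orbit_pt x ` pball ?b k) \<in> sets haar"
    using measurable_sets[OF measurable_orbit_pt[OF x] orbit_pt_pball_sets[OF x], of ?b k] by (simp add: sets_haar)
  have "emeasure (orbit_measure x) (orbit_pt x ` pball a k) = emeasure (uniform_measure haar (pideal 1)) (orbit_pt x -` (orbit_pt x ` pball ?b k))"
    unfolding orbit_measure_def im using emeasure_distr[OF meas orbit_pt_pball_sets[OF x]] sp by simp
  also have "\<dots> = emeasure haar (pball ?b k) / emeasure haar (pideal 1 :: 'a fls set)"
    using emeasure_uniform_measure[OF P pre] by (simp add: vim)
  also have "emeasure haar (pideal 1 :: 'a fls set) = ennreal (real CARD('a) powi (- 1))"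
    using haar_pball[of 0 1] by (simp add: pball_0)
  also have "emeasure haar (pball ?b k) / \<dots> = ennreal (real CARD('a) powi (- k) / real CARD('a) powi (- 1))"
    unfolding haar_pball by (rule divide_ennreal) auto
  also have "real CARD('a) powi (- k) / real CARD('a) powi (- 1) = real CARD('a) powi (1 - k)"
    using power_int_diff[of "real CARD('a)" "- k" "- 1"] by simp
  finally show ?thesis .
qed

lemma invariant_prob_orbit_measure:
  fixes x :: "'a::{finite,field} fls"
  assumes x: "x \<noteq> 0"
  shows "invariant_prob x (orbit_measure x)"
proof -
  let ?M = "orbit_measure x"
  have sets: "sets ?M = sets (orbit_borel x)" by (simp add: orbit_measure_def)
  have sp: "space ?M = range (orbit_pt x)" using sets_eq_imp_space_eq[OF sets] space_orbit_borel[OF x] by simp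
  have "emeasure ?M (space ?M) = 1"
    using orbit_measure_pball[OF x, of 1 0] by (simp add: sp orbit_pt_pball_1[OF x])
  then have prob: "prob_space ?M" by (rule prob_spaceI)
  have meas: "(\<lambda>y. y \<star> uu s) \<in> measurable ?M ?M" for s
    using measurable_orbit_translate[OF x] measurable_cong_sets[OF sets sets] by blast
  have "distr ?M ?M (\<lambda>y. y \<star> uu s) = ?M" for s
  proof (rule orbit_measure_eqI[OF x, where f = "\<lambda>k. ennreal (real CARD('a) powi (1 - k))"])
    fix a :: "'a fls" and k :: int assume k: "1 \<le> k"
    have "emeasure (distr ?M ?M (\<lambda>y. y \<star> uu s)) (orbit_pt x ` pball a k) = emeasure ?M (orbit_pt x ` pball (a - x * x * s) k)"
      by (subst emeasure_distr[OF meas]) (simp_all only: sets sp orbit_pt_pball_sets[OF x] orbit_translate_vimage[OF x])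
    then show "emeasure (distr ?M ?M (\<lambda>y. y \<star> uu s)) (orbit_pt x ` pball a k) = ennreal (real CARD('a) powi (1 - k))"
      using orbit_measure_pball[OF x k] by simp
  qed (auto simp: sets orbit_measure_pball[OF x])
  then show ?thesis using sets prob by (simp add: invariant_prob_def)
qed

text \<open>
  The measure on the orbit is defined by a description; this is its existence and uniqueness.
\<close>

lemma invariant_prob_nu:
  assumes x: "x \<noteq> 0"
  shows "invariant_prob x (nu (orbit_U (delta x)))"
  unfolding nu_eq[OF x]
proof (rule theI[of "invariant_prob x"])
  show "invariant_prob x (orbit_measure x)" by (rule invariant_prob_orbit_measure[OF x])
  fix \<nu> assume "invariant_prob x \<nu>"
  then show "\<nu> = orbit_measure x"
    using invariant_prob_orbit_measure[OF x]
    by (intro orbit_measure_eqI[OF x, where f = "\<lambda>k. ennreal (real CARD('a) powi (1 - k))"] invariant_prob_pball[OF x])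
      (auto simp: invariant_prob_def)
qed

section \<open>The distribution of the height\<close>

lemma finite_pball_cover:
  assumes "1 \<le> k"
  shows "\<exists>F :: 'a::{finite,field} fls set. finite F \<and> F \<subseteq> pideal 1 \<and> pideal 1 = (\<Union>s\<in>F. pball s k)"
  using assms
proof (induction k rule: int_ge_induct)
  case base
  show ?case by (rule exI[of _ "{0}"]) (simp add: pball_0)
next
  case (step k)
  then obtain F :: "'a fls set" where F: "finite F" "F \<subseteq> pideal 1" "pideal 1 = (\<Union>s\<in>F. pball s k)"
    by blast
  let ?F = "\<Union>s\<in>F. range (\<lambda>c. s + fls_const c * fls_X powi k)"
  have eq: "pideal 1 = (\<Union>s\<in>?F. pball s (k + 1))"
    unfolding F(3) pball_split[of _ k] by blast
  then have "?F \<subseteq> pideal 1" by (metis (no_types, lifting) UN_I pball_self subsetI)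
  then show ?case using eq F(1) by (intro exI[of _ ?F]) simp
qed

lemma horo_mat_fibre:
  assumes "s0 \<in> pideal 1" "1 \<le> n"
  shows "{s \<in> pideal 1. cls (horo_mat n s) = cls (horo_mat n s0)} = pball s0 (int n)"
proof -
  have iff: "cls (horo_mat n s) = cls (horo_mat n s0) \<longleftrightarrow> s \<in> pball s0 (int n)" for s
    using cls_horo_mat_eq_iff[OF GL2_one[OF subring_UNIV], of n s n s0] by (simp add: pball_def)
  have "s \<in> pideal 1" if "s \<in> pball s0 (int n)" for s
    using pideal_add[OF _ assms(1), of "s - s0"] pideal_mono[of "s - s0" "int n" 1] that assms(2)
    by (simp add: pball_def)
  then show ?thesis unfolding iff by blast
qed

lemma finite_horo_vertices:
  assumes "1 \<le> n"
  shows "finite (horo_vertices TYPE('a::{finite,field}) n)"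
proof -
  obtain F :: "'a fls set" where F: "finite F" "F \<subseteq> pideal 1" "pideal 1 = (\<Union>s\<in>F. pball s (int n))"
    using finite_pball_cover[of "int n"] assms by auto
  have "horo_vertices TYPE('a) n \<subseteq> (\<lambda>s. cls (horo_mat n s)) ` F"
  proof
    fix v assume "v \<in> horo_vertices TYPE('a) n"
    then obtain s where s: "s \<in> pideal 1" "v = cls (horo_mat n s)" unfolding horo_vertices_def by blast
    then obtain s0 where "s0 \<in> F" "s \<in> pball s0 (int n)" using F(3) by blast
    then show "v \<in> (\<lambda>s. cls (horo_mat n s)) ` F"
      using horo_mat_fibre[of s0 n] F(2) assms s(2) by blast
  qed
  then show ?thesis using F(1) finite_surj by blast
qed

text \<open>
  Parameters in \<open>\<pi>\<O>\<close> with the same vertex form one ball of index \<open>n\<close>, of mass \<open>q\<^sup>-\<^sup>(\<^sup>n\<^sup>-\<^sup>1\<^sup>)\<close>. So the mass of a height is that power times the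
  number of vertices of this height, which is the forward mass. The function \<open>G\<close> stands for the height composed
  with a diagonal translation.
\<close>

lemma distr_height:
  fixes x :: "'a::{finite,field} fls"
  assumes x: "x \<noteq> 0" and \<nu>: "invariant_prob x \<nu>" and n: "1 \<le> n"
    and G: "\<And>s. G (orbit_pt x s) = height (cls (horo_mat n s))"
  shows "distr \<nu> (count_space UNIV) G = mu_fwd TYPE('a) 1 (n - 1)"
proof -
  have sets: "sets \<nu> = sets (orbit_borel x)" using \<nu> by (simp add: invariant_prob_def)
  have sp: "space \<nu> = range (orbit_pt x)" using sets_eq_imp_space_eq[OF sets] space_orbit_borel[OF x] by simp
  let ?V = "horo_vertices TYPE('a) n"
  define C where "C v = orbit_pt x ` {s \<in> pideal 1. cls (horo_mat n s) = v}" for v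
  have C: "\<exists>a. C v = orbit_pt x ` pball a (int n)" if "v \<in> ?V" for v
  proof -
    obtain s0 where "s0 \<in> pideal 1" "v = cls (horo_mat n s0)" using \<open>v \<in> ?V\<close> unfolding horo_vertices_def by blast
    then show ?thesis unfolding C_def using horo_mat_fibre[OF _ n] by blast
  qed
  have C_sets: "C v \<in> sets \<nu>" if "v \<in> ?V" for v
    using C[OF that] orbit_pt_pball_sets[OF x] sets by auto
  have C_mass: "emeasure \<nu> (C v) = ennreal (1 / real CARD('a) ^ (n - 1))" if "v \<in> ?V" for v
  proof -
    have "emeasure \<nu> (C v) = ennreal (real CARD('a) powi (1 - int n))"
      using C[OF that] invariant_prob_pball[OF x \<nu>, of "int n"] n by auto
    also have "real CARD('a) powi (1 - int n) = 1 / real CARD('a) ^ (n - 1)"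
    proof -
      obtain m where m: "n = Suc m" using n by (cases n) auto
      show ?thesis by (simp add: m power_int_minus inverse_eq_divide)
    qed
    finally show ?thesis .
  qed
  have disj: "disjoint_family_on C W" for W
  proof (unfold disjoint_family_on_def, intro ballI impI)
    fix v w :: "('a fls ^ 2) set set" assume "v \<noteq> w"
    then show "C v \<inter> C w = {}"
      unfolding C_def using inj_on_orbit_pt[OF x, of 0] unfolding pball_0 inj_on_def by blast
  qed
  have pre: "G -` S \<inter> space \<nu> = (\<Union>v\<in>{v \<in> ?V. height v \<in> S}. C v)" for S
  proof (intro set_eqI iffI)
    fix y assume y: "y \<in> G -` S \<inter> space \<nu>"
    then have "y \<in> orbit_pt x ` pball 0 1" unfolding sp orbit_pt_pball_1[OF x] by blast
    then obtain s where "s \<in> pideal 1" "y = orbit_pt x s" unfolding pball_0 by blast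
    then show "y \<in> (\<Union>v\<in>{v \<in> ?V. height v \<in> S}. C v)"
      using y G unfolding C_def horo_vertices_def by (intro UN_I[of "cls (horo_mat n s)"]) auto
  qed (auto simp: C_def G sp)
  have fin: "finite {v \<in> ?V. height v \<in> S}" for S using finite_horo_vertices[where 'a = 'a, OF n] by simp
  have meas: "G \<in> measurable \<nu> (count_space UNIV)"
  proof (rule measurableI)
    fix S :: "nat set"
    show "G -` S \<inter> space \<nu> \<in> sets \<nu>"
      unfolding pre using fin C_sets by (intro sets.finite_UN) auto
  qed simp
  show ?thesis
  proof (rule measure_eqI_countable[where A = UNIV])
    fix j :: nat
    have "emeasure (distr \<nu> (count_space UNIV) G) {j} = emeasure \<nu> (\<Union>v\<in>{v \<in> ?V. height v \<in> {j}}. C v)"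
      using emeasure_distr[OF meas, of "{j}"] by (simp only: pre) simp
    also have "\<dots> = (\<Sum>v\<in>{v \<in> ?V. height v \<in> {j}}. emeasure \<nu> (C v))"
      using C_sets by (intro sum_emeasure[symmetric] disj fin) auto
    also have "\<dots> = (\<Sum>v\<in>{v \<in> ?V. height v = j}. ennreal (1 / real CARD('a) ^ (n - 1)))"
      by (intro sum.cong) (auto simp: C_mass)
    also have "\<dots> = ennreal (real (card {v \<in> ?V. height v = j}) / real CARD('a) ^ (n - 1))"
      by (simp add: sum_ennreal ennreal_of_nat_eq_real_of_nat ennreal_mult[symmetric])
    also have "\<dots> = emeasure (mu_fwd TYPE('a) 1 (n - 1)) {j}"
      using mu_fwd_mass_1[where 'a = 'a, of "n - 1" j] n
      by (simp add: mu_fwd_def emeasure_density nn_integral_indicator_singleton)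
    finally show "emeasure (distr \<nu> (count_space UNIV) G) {j} = emeasure (mu_fwd TYPE('a) 1 (n - 1)) {j}" .
  qed (auto simp: mu_fwd_def)
qed

section \<open>Compact orbits\<close>

text \<open>
  The ratio of the entries of the first column of \<open>g\<close> is not a point of the projective line over \<open>\<F>\<^sub>q(t)\<close>.
\<close>

definition irrational :: "'a :: {finite, field} fls ^ 2 ^ 2 \<Rightarrow> bool" where
  "irrational g \<longleftrightarrow> (\<forall>\<gamma>\<in>Gam. (\<gamma> ** g) $ 2 $ 1 \<noteq> 0)"

lemma uu_in_Gam: "p \<in> poly_ring \<Longrightarrow> uu p \<in> Gam"
  by (simp add: Gam_def uu_def SL2_iff poly_ring_0 poly_ring_1)

text \<open>
  A step of Euclid's algorithm replaces the lower left entry \<open>c\<close> by the remainder of \<open>a\<close> modulo \<open>c\<close>. Irrationality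
  keeps the algorithm from stopping, so the remainders become arbitrarily small.
\<close>

lemma irrational_euclid:
  assumes irr: "irrational g"
  shows "\<exists>\<gamma>\<in>Gam. (\<gamma> ** g) $ 2 $ 1 \<in> pideal (fls_subdegree (g $ 2 $ 1) + int n)"
proof (induction n)
  case 0
  have "mat 1 \<in> Gam" unfolding Gam_def by (rule SL2_one[OF subring_poly_ring])
  moreover have "g $ 2 $ 1 \<in> pideal (fls_subdegree (g $ 2 $ 1) + int 0)" by (simp add: pideal_iff_subdegree)
  ultimately show ?case by (metis matrix_mul_lid)
next
  case (Suc n)
  then obtain \<gamma> where \<gamma>: "\<gamma> \<in> Gam" "(\<gamma> ** g) $ 2 $ 1 \<in> pideal (fls_subdegree (g $ 2 $ 1) + int n)" by blast
  obtain a b c d where g: "\<gamma> ** g = mat22 a b c d" by (rule mat22_exhaust)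
  have c: "c \<noteq> 0" using irr \<gamma>(1) g unfolding irrational_def by (metis mat22_nth(3))
  obtain p where p: "p \<in> poly_ring" "a / c - p \<in> pideal 1" by (rule ex_poly_part)
  let ?w = "mat22 0 (- 1) 1 (- p)"
  have w: "?w \<in> Gam"
    using p(1) by (simp add: Gam_def SL2_iff poly_ring_0 poly_ring_1 poly_ring_uminus)
  have "c * (a / c - p) \<in> pideal (1 + fls_subdegree c)"
    using p(2) pideal_mult_iff[OF c] by blast
  then have small: "a - p * c \<in> pideal (1 + fls_subdegree c)" using c by (simp add: algebra_simps)
  have "fls_subdegree (g $ 2 $ 1) + int n \<le> fls_subdegree c"
    using \<gamma>(2) c unfolding g by (simp add: pideal_iff_subdegree)
  then have "a - p * c \<in> pideal (fls_subdegree (g $ 2 $ 1) + int (Suc n))"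
    by (intro pideal_mono[OF small]) simp
  moreover have "((?w ** \<gamma>) ** g) $ 2 $ 1 = a - p * c"
    by (simp add: g flip: matrix_mul_assoc)
  ultimately show ?case using Gam_mult[OF w \<gamma>(1)] by metis
qed

text \<open>
  With a small lower left entry \<open>c\<close>, the upper left entry can be adjusted by multiples of \<open>c\<close> to be close to \<open>1\<close>. Acting by
  \<open>U\<close> then clears the upper right entry. Hence the orbit comes arbitrarily close to the coset of \<open>1\<close>.
\<close>

lemma irrational_approximation:
  assumes irr: "irrational g" and g: "g \<in> GG" and N: "1 \<le> N"
  shows "\<exists>\<gamma>\<in>Gam. \<exists>s. \<gamma> ** (g ** uu s) \<in> congruence_subgroup N"
proof -
  obtain \<gamma> where \<gamma>: "\<gamma> \<in> Gam"
    "(\<gamma> ** g) $ 2 $ 1 \<in> pideal (fls_subdegree (g $ 2 $ 1) + int (nat (N - fls_subdegree (g $ 2 $ 1))))"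
    using irrational_euclid[OF irr] by blast
  obtain a b c d where h: "\<gamma> ** g = mat22 a b c d" by (rule mat22_exhaust)
  have c: "c \<noteq> 0" using irr \<gamma>(1) h unfolding irrational_def by (metis mat22_nth(3))
  have cN: "c \<in> pideal N" using \<gamma>(2) unfolding h by (auto intro: pideal_mono)
  have "\<gamma> ** g \<in> GG" using \<gamma>(1) g unfolding Gam_def GG_def
    by (intro SL2_mult[OF subring_UNIV]) (auto simp: SL2_def)
  then have det: "a * d - b * c = 1" unfolding h GG_def SL2_iff by simp
  obtain p where p: "p \<in> poly_ring" "(1 - a) / c - p \<in> pideal 1" by (rule ex_poly_part)
  define a' b' where "a' = a + p * c" and "b' = b + p * d"
  have h': "(uu p ** \<gamma>) ** g = mat22 a' b' c d"
    by (simp add: a'_def b'_def uu_def h flip: matrix_mul_assoc)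
  have "c * ((1 - a) / c - p) \<in> pideal N"
    by (rule pideal_mult[OF cN p(2)]) simp
  moreover have "c * ((1 - a) / c) = 1 - a" using c by simp
  then have "c * ((1 - a) / c - p) = - (a' - 1)"
    unfolding right_diff_distrib[of c "(1 - a) / c" p] by (simp add: a'_def)
  ultimately have aN: "a' - 1 \<in> pideal N" using pideal_uminus[of "- (a' - 1)" N] by simp
  have "a' - 1 \<in> pideal 1" by (rule pideal_mono[OF aN N])
  then have "fls_nth a' 0 = 1" by (auto dest: pidealD[of _ _ 0])
  then have a0: "a' \<noteq> 0" by auto
  have "a' \<in> pideal 0" using minus_one_in_pideal[OF aN] N by simp
  then have "0 \<le> fls_subdegree a'" using a0 by (simp add: pideal_iff_subdegree)
  moreover have "fls_subdegree a' \<le> 0" by (rule fls_subdegree_leI) (simp add: \<open>fls_nth a' 0 = 1\<close>)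
  ultimately have sub: "fls_subdegree a' = 0" by simp
  have det': "a' * d - b' * c = 1" using det by (simp add: a'_def b'_def algebra_simps)
  have "- (a' - 1) / a' \<in> pideal N"
    by (rule pideal_divide[OF pideal_uminus[OF aN] a0]) (simp add: sub)
  moreover have "- (a' - 1) / a' = 1 / a' - 1" using a0 by (simp add: field_simps)
  ultimately have iN: "1 / a' - 1 \<in> pideal N" by simp
  have "((uu p ** \<gamma>) ** g) ** uu (- b' / a') = mat22 a' 0 c (1 / a')"
    using det' a0 unfolding h' by (simp add: uu_def field_simps)
  moreover have "mat22 a' 0 c (1 / a') \<in> congruence_subgroup N"
    using aN cN iN a0 by (simp add: mat22_in_congruence_subgroup)
  ultimately show ?thesis
    using Gam_mult[OF uu_in_Gam[OF p(1)] \<gamma>(1)] by (metis matrix_mul_assoc)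
qed

text \<open>
  The orbits of a congruence subgroup acting on the right partition the space into open sets, so each of them has an
  open complement.
\<close>

lemma openin_far_from_congruence:
  assumes l: "0 \<le> l"
  shows "openin XX_top (XX - Gcoset ` congruence_subgroup l)"
proof (rule openin_XX_topI[of _ l])
  fix h \<kappa> :: "'a fls ^ 2 ^ 2"
  assume h: "h \<in> GG" "Gcoset h \<in> XX - Gcoset ` congruence_subgroup l" and \<kappa>: "\<kappa> \<in> congruence_subgroup l"
  have "Gcoset (h ** \<kappa>) \<in> XX" unfolding XX_def
    using h(1) \<kappa> GG_mult congruence_subgroup_subset_GG by blast
  moreover have "Gcoset (h ** \<kappa>) \<notin> Gcoset ` congruence_subgroup l"
  proof
    assume "Gcoset (h ** \<kappa>) \<in> Gcoset ` congruence_subgroup l"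
    then obtain \<eta> where \<eta>: "\<eta> \<in> congruence_subgroup l" "Gcoset (h ** \<kappa>) = Gcoset \<eta>" by blast
    obtain \<kappa>' where k: "\<kappa>' \<in> congruence_subgroup l" "\<kappa> ** \<kappa>' = mat 1"
      by (rule congruence_subgroup_inverse[OF \<kappa>])
    have "Gcoset h = Gcoset (h ** \<kappa>) \<star> \<kappa>'" by (simp add: ract_Gcoset k(2) flip: matrix_mul_assoc)
    also have "\<dots> = Gcoset (\<eta> ** \<kappa>')" by (simp add: \<eta>(2) ract_Gcoset)
    finally show False using h(2) congruence_subgroup_mult[OF l \<eta>(1) k(1)] by blast
  qed
  ultimately show "Gcoset (h ** \<kappa>) \<in> XX - Gcoset ` congruence_subgroup l" by blast
qed blast

lemma irrational_uu:
  assumes "irrational g"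
  shows "irrational (g ** uu s)"
  unfolding irrational_def
proof
  fix \<gamma> assume \<gamma>: "\<gamma> \<in> (Gam :: ('a fls^2^2) set)"
  obtain a b c d where h: "\<gamma> ** g = mat22 a b c d" by (rule mat22_exhaust)
  have "(\<gamma> ** (g ** uu s)) $ 2 $ 1 = c" by (simp add: matrix_mul_assoc h uu_def)
  moreover have "c \<noteq> 0" using assms \<gamma> h unfolding irrational_def by (metis mat22_nth(3))
  ultimately show "(\<gamma> ** (g ** uu s)) $ 2 $ 1 \<noteq> 0" by simp
qed

text \<open>
  Elements of the coset lying in \<open>SL\<^sub>2(\<O>)\<close> differ by the finite group of polynomial matrices with integral entries, which are constant. Their
  lower left entries therefore take finitely many values, all nonzero, and cannot tend to \<open>0\<close>.
\<close>

lemma irrational_separated: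
  assumes irr: "irrational h"
  shows "\<exists>k::nat. Gcoset h \<notin> Gcoset ` congruence_subgroup (int k)"
proof (rule ccontr)
  assume "\<nexists>k::nat. Gcoset h \<notin> Gcoset ` congruence_subgroup (int k)"
  then have near: "\<exists>\<kappa>\<in>congruence_subgroup (int k). Gcoset \<kappa> = Gcoset h" for k :: nat
    by (metis (no_types, lifting) imageE)
  obtain \<eta> where \<eta>: "\<eta> \<in> congruence_subgroup 0" "Gcoset \<eta> = Gcoset h" using near[of 0] by auto
  let ?f = "\<lambda>(\<alpha>, \<beta>). fls_const \<alpha> * \<eta> $ 1 $ 1 + fls_const \<beta> * \<eta> $ 2 $ 1"
  let ?S = "range ?f"
  have fin: "finite (fls_subdegree ` ?S)" by (intro finite_imageI) simp
  \<comment> \<open>No nonzero element of \<open>?S\<close> is divisible by \<open>\<pi>\<^sup>k\<close>.\<close>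
  define k where "k = nat (Max (fls_subdegree ` ?S) + 1)"
  obtain \<kappa> where \<kappa>: "\<kappa> \<in> congruence_subgroup (int k)" "Gcoset \<kappa> = Gcoset h" using near by blast
  have "Gcoset \<kappa> = Gcoset \<eta>" using \<kappa>(2) \<eta>(2) by simp
  then obtain \<sigma> where \<sigma>: "\<sigma> \<in> Gam" "\<kappa> = \<sigma> ** \<eta>" unfolding Gcoset_eq_iff by blast
  obtain \<eta>' where \<eta>': "\<eta>' \<in> congruence_subgroup 0" "\<eta> ** \<eta>' = mat 1"
    by (rule congruence_subgroup_inverse[OF \<eta>(1)])
  have "\<sigma> = \<kappa> ** \<eta>'" by (simp add: \<sigma>(2) \<eta>'(2) flip: matrix_mul_assoc)
  moreover have "\<kappa> ** \<eta>' \<in> SL2 (pideal 0)"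
    using \<kappa>(1) \<eta>'(1) by (intro SL2_mult[OF subring_pideal] congruence_subgroup_subset_SL2) auto
  ultimately have \<sigma>O: "\<sigma> \<in> SL2 (pideal 0)" by simp
  obtain a b c d where s: "\<sigma> = mat22 a b c d" by (rule mat22_exhaust)
  obtain a0 b0 c0 d0 where e: "\<eta> = mat22 a0 b0 c0 d0" by (rule mat22_exhaust)
  have cd: "c = fls_const (fls_nth c 0)" "d = fls_const (fls_nth d 0)"
    using \<sigma>(1) \<sigma>O unfolding s Gam_def SL2_iff by (auto intro: poly_ring_integral_const)
  have "\<kappa> $ 2 $ 1 = c * a0 + d * c0" by (simp add: \<sigma>(2) s e)
  also have "\<dots> = ?f (fls_nth c 0, fls_nth d 0)" using cd by (simp add: e)
  finally have "\<kappa> $ 2 $ 1 \<in> ?S" by blast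
  then have "fls_subdegree (\<kappa> $ 2 $ 1) \<le> Max (fls_subdegree ` ?S)" using fin by (intro Max_ge) auto
  then have "fls_subdegree (\<kappa> $ 2 $ 1) < int k" by (simp add: k_def)
  moreover have "\<kappa> $ 2 $ 1 \<in> pideal (int k)" using \<kappa>(1) by (simp add: congruence_subgroup_def)
  moreover have "\<kappa> $ 2 $ 1 \<noteq> 0" using irr \<kappa>(2) unfolding Gcoset_eq_iff irrational_def by blast
  ultimately show False by (auto simp: pideal_iff_subdegree)
qed

text \<open>
  An irrational orbit accumulates at the coset of \<open>1\<close> without containing it, so the complements of the shrinking neighbourhoods
  of that coset cover the orbit and no finite number of them does.
\<close>

lemma compact_orbit_not_irrational:
  fixes g :: "'a::{finite,field} fls ^ 2 ^ 2"
  assumes g: "g \<in> GG" and comp: "compactin XX_top (orbit_U g)"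
  shows "\<not> irrational g"
proof
  assume irr: "irrational g"
  define A :: "nat \<Rightarrow> ('a fls ^ 2 ^ 2) set set"
    where "A k = XX - Gcoset ` congruence_subgroup (int k)" for k
  have open_A: "openin XX_top (A k)" for k unfolding A_def by (rule openin_far_from_congruence) simp
  have "orbit_U g \<subseteq> \<Union>(range A)"
  proof
    fix y assume "y \<in> orbit_U g"
    then obtain s where y: "y = Gcoset (g ** uu s)" unfolding orbit_U_def ract_Gcoset by blast
    have "y \<in> XX" unfolding y XX_def using g GG_mult uu_in_GG by blast
    moreover obtain k where "y \<notin> Gcoset ` congruence_subgroup (int k)"
      using irrational_separated[OF irrational_uu[OF irr]] unfolding y by blast
    ultimately show "y \<in> \<Union>(range A)" unfolding A_def by blast
  qed
  then obtain F where F: "finite F" "F \<subseteq> range A" "orbit_U g \<subseteq> \<Union>F"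
    using comp open_A unfolding compactin_def by (metis (no_types, lifting) rangeE)
  then obtain I where I: "finite I" "F = A ` I" by (metis finite_subset_image)
  define N where "N = Max (insert 1 I)"
  have N: "1 \<le> N" "\<And>k. k \<in> I \<Longrightarrow> k \<le> N" unfolding N_def using I(1) by auto
  obtain \<gamma> s where \<gamma>: "\<gamma> \<in> Gam" "\<gamma> ** (g ** uu s) \<in> congruence_subgroup (int N)"
    using irrational_approximation[OF irr g, of "int N"] N(1) by auto
  have "Gcoset (g ** uu s) \<in> orbit_U g" unfolding orbit_U_def ract_Gcoset by blast
  then obtain k where k: "k \<in> I" "Gcoset (g ** uu s) \<in> A k" using F(3) I(2) by blast
  have "Gcoset (g ** uu s) = Gcoset (\<gamma> ** (g ** uu s))"
    using \<gamma>(1) Gcoset_eq_iff by metis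
  moreover have "congruence_subgroup (int N) \<subseteq> congruence_subgroup (int k)"
    by (rule congruence_subgroup_mono) (use N(2)[OF k(1)] in simp)
  ultimately have "Gcoset (g ** uu s) \<in> Gcoset ` congruence_subgroup (int k)" using \<gamma>(2) by blast
  then show False using k(2) unfolding A_def by blast
qed

text \<open>
  Compactness gives a polynomial row operation after which the matrix is upper triangular, hence the product of a diagonal and a unipotent matrix.
\<close>

lemma compact_orbit_cases:
  assumes "compact_orbit Y"
  obtains x where "x \<noteq> 0" "Y = orbit_U (delta x)"
proof -
  obtain g where g: "g \<in> GG" "Y = orbit_U g" "compactin XX_top (orbit_U g)"
    using assms unfolding compact_orbit_def by blast
  then obtain \<gamma> where \<gamma>: "\<gamma> \<in> Gam" "(\<gamma> ** g) $ 2 $ 1 = 0"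
    using compact_orbit_not_irrational unfolding irrational_def by blast
  obtain a b c d where h: "\<gamma> ** g = mat22 a b c d" by (rule mat22_exhaust)
  have "\<gamma> ** g \<in> GG" using \<gamma>(1) g(1) unfolding Gam_def GG_def
    by (intro SL2_mult[OF subring_UNIV]) (auto simp: SL2_def)
  then have det: "a * d = 1" "c = 0" using \<gamma>(2) unfolding h GG_def SL2_iff by auto
  then have a: "a \<noteq> 0" by auto
  have "inverse a = d" by (rule inverse_unique) (rule det(1))
  then have "\<gamma> ** g = delta a ** uu (b / a)" using det(2) a by (simp add: h delta_def uu_def)
  moreover have "Gcoset g = Gcoset (\<gamma> ** g)" using \<gamma>(1) Gcoset_eq_iff by metis
  ultimately have "Gcoset g \<star> uu s = Gcoset (delta a) \<star> uu (b / a + s)" for s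
    by (simp add: ract_Gcoset uu_mult flip: matrix_mul_assoc)
  then have "orbit_U g = range (\<lambda>s. Gcoset (delta a) \<star> uu (b / a + s))" unfolding orbit_U_def by simp
  also have "\<dots> = orbit_U (delta a)"
  proof -
    have "Gcoset (delta a) \<star> uu s = Gcoset (delta a) \<star> uu (b / a + (s - b / a))" for s by simp
    then show ?thesis unfolding orbit_U_def by blast
  qed
  finally show ?thesis using that a g(2) by blast
qed

text \<open>
  The period lattice of the orbit is \<open>x\<^sup>-\<^sup>2\<F>\<^sub>q[t]\<close>, the same for every base point since \<open>U\<close> is commutative. Its covolume is a
  power of \<open>q > 1\<close>, so the exponent is determined.
\<close>

lemma m_int_orbit_U_delta:
  fixes x :: "'a::{finite,field} fls"
  assumes x: "x \<noteq> 0"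
  shows "m_int (orbit_U (delta x)) = - fls_subdegree x"
proof -
  let ?c = "ennreal (real CARD('a) powi (2 * fls_subdegree x - 1))"
  have cov: "covolume (Lambda_U g) = ?c" if "orbit_U (delta x) = orbit_U g" for g
  proof -
    have "Gcoset g = Gcoset g \<star> uu 0" by (simp add: ract_Gcoset uu_def mat_1_mat22[symmetric])
    then have "Gcoset g \<in> orbit_U (delta x)" using that unfolding orbit_U_def[of g] by blast
    then obtain t where "Gcoset g = orbit_pt x t" unfolding orbit_U_delta[OF x] by blast
    then have "Lambda_U g = {s. (x * x) * s \<in> poly_ring}"
      by (simp add: Lambda_U_def orbit_pt_uu[OF x] orbit_pt_eq_iff[OF x])
    then show ?thesis using covolume_scaled_poly_ring[of "x * x"] x by simp
  qed
  have inj: "m = n" if "real CARD('a) powi m = real CARD('a) powi n" for m n :: int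
  proof -
    have "1 < real CARD('a)" using card_field_gt_1[where 'a = 'a] by simp
    then show ?thesis using that
      by (metis linorder_neqE_linordered_idom power_int_strict_increasing less_irrefl)
  qed
  show ?thesis
    unfolding m_int_def
  proof (rule the_equality)
    show "\<forall>g\<in>GG. orbit_U (delta x) = orbit_U g \<longrightarrow>
        covolume (Lambda_U g) = ennreal (real CARD('a) powi (- 2 * - fls_subdegree x - 1))"
      using cov by simp
  next
    fix m assume "\<forall>g\<in>GG. orbit_U (delta x) = orbit_U g \<longrightarrow>
        covolume (Lambda_U g) = ennreal (real CARD('a) powi (- 2 * m - 1))"
    then have "covolume (Lambda_U (delta x)) = ennreal (real CARD('a) powi (- 2 * m - 1))"
      using delta_in_GG[OF x] by blast
    then have "ennreal (real CARD('a) powi (- 2 * m - 1)) = ?c" using cov[OF refl] by simp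
    then have "real CARD('a) powi (- 2 * m - 1) = real CARD('a) powi (2 * fls_subdegree x - 1)"
      by (subst (asm) ennreal_inj) auto
    then show "m = - fls_subdegree x" by (auto dest: inj)
  qed
qed

section \<open>Heights along expanded orbits\<close>

text \<open>
  The height is locally constant: the stabilizer of \<open>[\<O>\<^sup>2]\<close> contains the open group \<open>SL\<^sub>2(\<O>)\<close>.
\<close>

lemma measurable_h_K:
  "h_K \<in> measurable (borel_of_top (XX_top :: ('a::{finite,field} fls ^ 2 ^ 2) set topology)) (count_space UNIV)"
proof (rule measurableI)
  fix S :: "nat set"
  have "openin XX_top {y \<in> (XX :: ('a fls ^ 2 ^ 2) set set). h_K y \<in> S}"
  proof (rule openin_XX_topI[of _ 0])
    fix h \<kappa> :: "'a fls ^ 2 ^ 2"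
    assume h: "h \<in> GG" "Gcoset h \<in> {y \<in> XX. h_K y \<in> S}" and \<kappa>: "\<kappa> \<in> congruence_subgroup 0"
    have "\<kappa> \<in> GL2 (pideal 0)"
      using congruence_subgroup_subset_SL2[OF _ \<kappa>] SL2_subset_GL2[OF subring_pideal] by simp
    then have "cls (h ** \<kappa>) = cls h" by (simp add: cls_def lat_mult_integral)
    moreover have hk: "h ** \<kappa> \<in> GG" using GG_mult[OF h(1) congruence_subgroup_subset_GG[OF \<kappa>]] .
    ultimately have "h_K (Gcoset (h ** \<kappa>)) = h_K (Gcoset h)" by (simp add: h_K_Gcoset h(1))
    then show "Gcoset (h ** \<kappa>) \<in> {y \<in> XX. h_K y \<in> S}" using h(2) hk unfolding XX_def by simp
  qed auto
  moreover have "h_K -` S \<inter> space (borel_of_top XX_top) = {y \<in> (XX :: ('a fls ^ 2 ^ 2) set set). h_K y \<in> S}"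
    unfolding space_borel_of_top topspace_XX_top by auto
  ultimately show "h_K -` S \<inter> space (borel_of_top XX_top) \<in> sets (borel_of_top (XX_top :: ('a fls^2^2) set topology))"
    by (simp add: sets_borel_of_top sigma_sets.Basic)
qed simp

text \<open>
  In the parameter, the translation is the orbit map of another diagonal matrix, which is continuous.
\<close>

lemma measurable_ract_aa:
  fixes x :: "'a::{finite,field} fls"
  assumes x: "x \<noteq> 0"
  shows "(\<lambda>y. y \<star> aa n) \<in> measurable (orbit_borel x) (borel_of_top XX_top)"
  unfolding borel_of_top_def[of XX_top]
proof (rule measurable_measure_of)
  let ?x = "x * tt powi n"
  have x': "?x \<noteq> 0" using x by simp
  show "{A. openin XX_top A} \<subseteq> Pow (topspace XX_top)" using openin_subset by blast
  show "(\<lambda>y. y \<star> aa n) \<in> space (orbit_borel x) \<rightarrow> topspace XX_top"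
    unfolding space_orbit_borel[OF x] topspace_XX_top using orbit_pt_in_XX[OF x'] by (auto simp: orbit_pt_aa)
  fix A :: "('a fls ^ 2 ^ 2) set set" assume "A \<in> {A. openin XX_top A}"
  then have "open {s. orbit_pt ?x s \<in> A}" using open_orbit_pt_vimage[OF x'] by blast
  moreover have "(\<lambda>y. y \<star> aa n) -` A \<inter> space (orbit_borel x) = orbit_pt x ` {s. orbit_pt ?x s \<in> A}"
    unfolding space_orbit_borel[OF x] by (auto simp: orbit_pt_aa)
  ultimately show "(\<lambda>y. y \<star> aa n) -` A \<inter> space (orbit_borel x) \<in> sets (orbit_borel x)"
    using orbit_pt_image_open_sets[OF x] by simp
qed

theorem proposition4p3:
  shows "(\<forall>d::nat. d \<ge> 1 \<longrightarrow>
            distr (nu (orbit_U (aa (- int d) :: 'a :: {finite, field} fls ^ 2 ^ 2))) (count_space UNIV) h_K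
              = mu_fwd TYPE('a) 1 (2 * d - 1))
       \<and> (\<forall>(Y :: ('a fls ^ 2 ^ 2) set set) (n::int).
            compact_orbit Y \<longrightarrow> n \<ge> 0 \<longrightarrow> n > m_int Y \<longrightarrow>
            distr (lambda_per Y n) (count_space UNIV) h_K
              = mu_fwd TYPE('a) 1 (nat (2 * (n - m_int Y) - 1)))"
proof (intro conjI allI impI)
  fix d :: nat assume d: "d \<ge> 1"
  let ?x = "tt powi (- int d) :: 'a fls"
  have x: "?x \<noteq> 0" by simp
  have "fls_subdegree ?x = int d" by (simp add: tt_powi)
  then show "distr (nu (orbit_U (aa (- int d) :: 'a fls ^ 2 ^ 2))) (count_space UNIV) h_K
      = mu_fwd TYPE('a) 1 (2 * d - 1)"
    unfolding aa_eq_delta using d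
    by (intro distr_height[OF x invariant_prob_nu[OF x]] h_K_orbit_pt[OF x]) auto
next
  fix Y :: "('a fls ^ 2 ^ 2) set set" and n :: int
  assume Y: "compact_orbit Y" and n: "n > m_int Y"
  obtain x where x: "x \<noteq> 0" and Y_eq: "Y = orbit_U (delta x)" by (rule compact_orbit_cases[OF Y])
  let ?x = "x * tt powi (- n)"
  define d where "d = nat (n - m_int Y)"
  have x': "?x \<noteq> 0" using x by simp
  have m: "m_int Y = - fls_subdegree x" unfolding Y_eq by (rule m_int_orbit_U_delta[OF x])
  have "fls_subdegree ?x = fls_subdegree x + n" using x by (simp add: tt_powi)
  then have sub: "fls_subdegree ?x = int d" using n by (simp add: d_def m)
  have inv: "invariant_prob x (nu Y)" unfolding Y_eq by (rule invariant_prob_nu[OF x])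
  then have "sets (nu Y) = sets (orbit_borel x)" by (simp add: invariant_prob_def)
  then have "(\<lambda>y. y \<star> aa (- n)) \<in> measurable (nu Y) (borel_of_top XX_top)"
    using measurable_ract_aa[OF x] measurable_cong_sets by blast
  then have "distr (lambda_per Y n) (count_space UNIV) h_K = distr (nu Y) (count_space UNIV) (h_K \<circ> (\<lambda>y. y \<star> aa (- n)))"
    unfolding lambda_per_def by (rule distr_distr[OF measurable_h_K])
  also have "\<dots> = mu_fwd TYPE('a) 1 (2 * d - 1)"
    using n by (intro distr_height[OF x inv]) (auto simp: d_def orbit_pt_aa h_K_orbit_pt[OF x' sub])
  also have "2 * d - 1 = nat (2 * (n - m_int Y) - 1)" using n by (simp add: d_def)
  finally show "distr (lambda_per Y n) (count_space UNIV) h_K = mu_fwd TYPE('a) 1 (nat (2 * (n - m_int Y) - 1))" .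
qed

end
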